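(* Let $X$ and $Y$ be the subproduct systems associated with homogeneous ideals $\mathcal I$ of $\mathbb C\langle x_1,\dots,x_d\rangle$ and $\mathcal J$ of $\mathbb C\langle y_1,\dots,y_{d'}\rangle$, respectively. Then: (i) $\mathcal A_X$ and $\mathcal A_Y$ are completely isometrically isomorphic if and only if $\mathcal A_X$ and $\mathcal A_Y$ are isometrically isomorphic if and only if $X$ and $Y$ are isomorphic; (ii) $\mathcal A_X$ and $\mathcal A_Y$ are isomorphic by a completely bounded map if and only if $\mathcal A_X$ and $\mathcal A_Y$ are isomorphic as topological algebras if and only if $X$ and $Y$ are similar.
   Context: $\mathbb C\langle x_1,\dots,x_d\rangle$ is the ring of polynomials in $d$ noncommuting variables; a homogeneous ideal is a two-sided ideal generated by homogeneous polynomials, here assumed proper. Let $\{e_1,\dots,e_d\}$ be the standard orthonormal basis of $\mathbb C^d$, and for $f=\sum_w\lambda_wx^w$ (sum over words $w=w_1\cdots w_n$) put $f(\underline e)=\sum_w\lambda_w e_{w_1}\otimes\cdots\otimes e_{w_{n}}$. The subproduct system associated with a homogeneous ideal $\mathcal I$ is $X=(X(n),p_n)_{n\ge0}$, where $X(n)=(\mathbb C^d)^{\otimes n}\ominus\{f(\underline e): f\in\mathcal I\text{ homogeneous of degree }n\}$ and $p_n$ is the orthogonal projection of $(\mathbb C^d)^{\otimes n}$ onto $X(n)$; thus $X(0)=\mathbb C$. Let $\mathcal F_X=\bigoplus_{n\ge0}X(n)$ and $T_i\in B(\mathcal F_X)$, $T_i\xi=p_{n+1}(e_i\otimes\xi)$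 for $\xi\in X(n)$. The tensor algebra $\mathcal A_X$ is the norm-closed unital algebra generated by $T_1,\dots,T_d$. $X=(X(n),p_n)$ and $Y=(Y(n),q_n)$ are similar if there are invertible linear maps $V_n:X(n)\to Y(n)$, $n\ge 0$, with $\sup_n\|V_n\|<\infty$, $\sup_n\|V_n^{-1}\|<\infty$ and $V_{m+n}(p_{m+n}(\xi\otimes\eta))=q_{m+n}(V_m\xi\otimes V_n\eta)$ for all $m,n$, $\xi\in X(m)$, $\eta\in X(n)$. They are isomorphic if such $V_n$ can be chosen unitary. Isomorphisms of operator algebras are algebra isomorphisms; "isomorphic as topological algebras" means via a bounded isomorphism with bounded inverse. *)

theory Defs
  imports "HOL-Analysis.Analysis" "HOL-Library.Poly_Mapping"
begin

section \<open>Noncommutative polynomials and homogeneous ideals\<close>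

text \<open>
  Words are lists of letters, the letters being the elements of a finite type \<open>'a\<close>, so that
  \<open>d = CARD('a)\<close>. Making words the additive monoid under concatenation turns
  \<open>'a list \<Rightarrow>\<^sub>0 complex\<close> with its library ring structure into the free algebra: the
  coefficient of the word \<open>w\<close> in \<open>f\<close> is \<open>lookup f w\<close>.
\<close>

instantiation list :: (type) monoid_add
begin

definition zero_list_def: "(0 :: 'a list) = []"
definition plus_list_def: "(u :: 'a list) + v = u @ v"

instance
  by standard (simp_all add: zero_list_def plus_list_def)

end

type_synonym 'a free_algebra = "'a list \<Rightarrow>\<^sub>0 complex"

definition homogeneous :: "nat \<Rightarrow> 'a free_algebra \<Rightarrow> bool" where
  "homogeneous n f \<longleftrightarrow> (\<forall>w \<in> Poly_Mapping.keys f. length w = n)"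

definition two_sided_ideal :: "'r::ring_1 set \<Rightarrow> bool" where
  "two_sided_ideal I \<longleftrightarrow>
     0 \<in> I \<and> (\<forall>f\<in>I. \<forall>g\<in>I. f + g \<in> I) \<and> (\<forall>f\<in>I. \<forall>g. g * f \<in> I \<and> f * g \<in> I)"

definition homogeneous_ideal :: "'a free_algebra set \<Rightarrow> bool" where
  "homogeneous_ideal I \<longleftrightarrow>
     I \<noteq> UNIV \<and> (\<exists>S. (\<forall>f\<in>S. \<exists>n. homogeneous n f) \<and> I = two_sided_ideal hull S)"


section \<open>The Hilbert space of square-summable families\<close>

lemma cmod_sum_sq_le: "(cmod (x + y))\<^sup>2 \<le> 2 * (cmod x)\<^sup>2 + 2 * (cmod y)\<^sup>2"
proof -
  have "(cmod (x + y))\<^sup>2 \<le> (cmod x + cmod y)\<^sup>2"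
    by (intro power_mono norm_triangle_ineq) auto
  also have "\<dots> \<le> 2 * (cmod x)\<^sup>2 + 2 * (cmod y)\<^sup>2"
    using sum_squares_bound[of "cmod x" "cmod y"] by (simp add: power2_sum)
  finally show ?thesis .
qed

typedef 'b ell2 = "{f :: 'b \<Rightarrow> complex. (\<lambda>x. (cmod (f x))\<^sup>2) summable_on UNIV}"
  by (rule exI[of _ "\<lambda>_. 0"]) simp

setup_lifting type_definition_ell2

lemma summable_ell2: "(\<lambda>x. (cmod (Rep_ell2 f x))\<^sup>2) summable_on UNIV"
  using Rep_ell2[of f] by simp

lemma summable_inner_ell2: "(\<lambda>x. Rep_ell2 f x \<bullet> Rep_ell2 g x) summable_on UNIV"
proof (rule abs_summable_summable, rule Infinite_Sum.abs_summable_on_comparison_test')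
  show "(\<lambda>x. (cmod (Rep_ell2 f x))\<^sup>2 + (cmod (Rep_ell2 g x))\<^sup>2) summable_on UNIV"
    by (intro summable_on_add summable_ell2)
  fix x
  have "norm (Rep_ell2 f x \<bullet> Rep_ell2 g x) \<le> cmod (Rep_ell2 f x) * cmod (Rep_ell2 g x)"
    using Cauchy_Schwarz_ineq2 by simp
  also have "\<dots> \<le> (cmod (Rep_ell2 f x))\<^sup>2 + (cmod (Rep_ell2 g x))\<^sup>2"
    using sum_squares_bound[of "cmod (Rep_ell2 f x)" "cmod (Rep_ell2 g x)"]
      mult_nonneg_nonneg[OF norm_ge_zero[of "Rep_ell2 f x"] norm_ge_zero[of "Rep_ell2 g x"]]
    by linarith
  finally show "norm (Rep_ell2 f x \<bullet> Rep_ell2 g x)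
      \<le> (cmod (Rep_ell2 f x))\<^sup>2 + (cmod (Rep_ell2 g x))\<^sup>2" .
qed

instantiation ell2 :: (type) real_inner
begin

lift_definition zero_ell2 :: "'a ell2" is "\<lambda>_. 0" by simp

lift_definition plus_ell2 :: "'a ell2 \<Rightarrow> 'a ell2 \<Rightarrow> 'a ell2" is "\<lambda>f g x. f x + g x"
proof -
  fix f g :: "'a \<Rightarrow> complex"
  assume "(\<lambda>x. (cmod (f x))\<^sup>2) summable_on UNIV" "(\<lambda>x. (cmod (g x))\<^sup>2) summable_on UNIV"
  then have "(\<lambda>x. 2 * (cmod (f x))\<^sup>2 + 2 * (cmod (g x))\<^sup>2) summable_on UNIV"
    by (intro summable_on_add summable_on_cmult_right)
  then show "(\<lambda>x. (cmod (f x + g x))\<^sup>2) summable_on UNIV"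
    by (rule summable_on_comparison_test) (auto intro: cmod_sum_sq_le)
qed

lift_definition uminus_ell2 :: "'a ell2 \<Rightarrow> 'a ell2" is "\<lambda>f x. - f x" by simp

definition minus_ell2 :: "'a ell2 \<Rightarrow> 'a ell2 \<Rightarrow> 'a ell2" where "minus_ell2 f g = f + - g"

lift_definition scaleR_ell2 :: "real \<Rightarrow> 'a ell2 \<Rightarrow> 'a ell2" is "\<lambda>r f x. r *\<^sub>R f x"
  by (simp add: power_mult_distrib summable_on_cmult_right)

definition inner_ell2 :: "'a ell2 \<Rightarrow> 'a ell2 \<Rightarrow> real" where
  "inner_ell2 f g = (\<Sum>\<^sub>\<infinity>x. Rep_ell2 f x \<bullet> Rep_ell2 g x)"

definition norm_ell2 :: "'a ell2 \<Rightarrow> real" where "norm_ell2 f = sqrt (f \<bullet> f)"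

definition dist_ell2 :: "'a ell2 \<Rightarrow> 'a ell2 \<Rightarrow> real" where "dist_ell2 f g = norm (f - g)"

definition sgn_ell2 :: "'a ell2 \<Rightarrow> 'a ell2" where "sgn_ell2 f = inverse (norm f) *\<^sub>R f"

definition uniformity_ell2 :: "('a ell2 \<times> 'a ell2) filter" where
  "uniformity_ell2 = (INF e\<in>{0 <..}. principal {(x, y). dist x y < e})"

definition open_ell2 :: "'a ell2 set \<Rightarrow> bool" where
  "open_ell2 U \<longleftrightarrow> (\<forall>x\<in>U. eventually (\<lambda>(x', y). x' = x \<longrightarrow> y \<in> U) uniformity)"

instance
proof
  fix f g h :: "'a ell2" and r s :: real
  show "f + g + h = f + (g + h)" "f + g = g + f" "0 + f = f" "- f + f = 0"
    "r *\<^sub>R (f + g) = r *\<^sub>R f + r *\<^sub>R g" "(r + s) *\<^sub>R f = r *\<^sub>R f + s *\<^sub>R f"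
    "r *\<^sub>R s *\<^sub>R f = (r * s) *\<^sub>R f" "1 *\<^sub>R f = f"
    by (transfer; force simp: algebra_simps)+
  show "f - g = f + - g" "dist f g = norm (f - g)" "sgn f = inverse (norm f) *\<^sub>R f"
    "norm f = sqrt (f \<bullet> f)"
    by (simp_all add: minus_ell2_def dist_ell2_def sgn_ell2_def norm_ell2_def)
  show "(uniformity :: ('a ell2 \<times> 'a ell2) filter) =
      (INF e\<in>{0 <..}. principal {(x, y). dist x y < e})"
    by (simp add: uniformity_ell2_def)
  show "open U \<longleftrightarrow> (\<forall>x\<in>U. \<forall>\<^sub>F (x', y) in uniformity. x' = x \<longrightarrow> y \<in> U)" for U :: "'a ell2 set"
    by (simp add: open_ell2_def)
  show "f \<bullet> g = g \<bullet> f"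
    by (simp add: inner_ell2_def inner_commute)
  show "(f + g) \<bullet> h = f \<bullet> h + g \<bullet> h"
    by (simp add: inner_ell2_def plus_ell2.rep_eq inner_add_left infsum_add summable_inner_ell2)
  show "(r *\<^sub>R f) \<bullet> g = r * (f \<bullet> g)"
    by (simp add: inner_ell2_def scaleR_ell2.rep_eq infsum_cmult_right')
  show "0 \<le> f \<bullet> f"
    unfolding inner_ell2_def by (intro infsum_nonneg) simp
  show "(f \<bullet> f = 0) = (f = 0)"
  proof
    assume "f \<bullet> f = 0"
    then have "Rep_ell2 f x \<bullet> Rep_ell2 f x = 0" for x
      unfolding inner_ell2_def
      by (intro nonneg_infsum_le_0D[where A = UNIV]) (auto intro: summable_inner_ell2)
    then show "f = 0"
      by (simp add: Rep_ell2_inject[symmetric] zero_ell2.rep_eq fun_eq_iff)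
  qed (simp add: inner_ell2_def zero_ell2.rep_eq)
qed

end

lift_definition scaleC :: "complex \<Rightarrow> 'b ell2 \<Rightarrow> 'b ell2" is "\<lambda>c f x. c * f x"
  by (simp add: norm_mult power_mult_distrib summable_on_cmult_right)

definition cinner :: "'b ell2 \<Rightarrow> 'b ell2 \<Rightarrow> complex" where
  "cinner f g = (\<Sum>\<^sub>\<infinity>x. Rep_ell2 f x * cnj (Rep_ell2 g x))"

lemma norm_scaleC: "norm (scaleC c f) = cmod c * norm f"
  by (simp add: norm_ell2_def inner_ell2_def scaleC.rep_eq dot_square_norm norm_mult
      power_mult_distrib infsum_cmult_right' real_sqrt_mult)

lift_definition scaleC_op :: "complex \<Rightarrow> 'b ell2 \<Rightarrow>\<^sub>L 'b ell2" is scaleC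
proof (rule bounded_linear_intro)
  fix c and f g :: "'b ell2" and r
  show "scaleC c (f + g) = scaleC c f + scaleC c g" "scaleC c (r *\<^sub>R f) = r *\<^sub>R scaleC c f"
    by (transfer; simp add: algebra_simps)+
  show "norm (scaleC c f) \<le> norm f * cmod c"
    by (simp add: norm_scaleC)
qed

text \<open>Orthogonal projection; meaningful when \<open>S\<close> is a closed complex subspace.\<close>

definition orth_proj :: "'b ell2 set \<Rightarrow> 'b ell2 \<Rightarrow> 'b ell2" where
  "orth_proj S \<xi> = (THE \<eta>. \<eta> \<in> S \<and> (\<forall>\<zeta>\<in>S. cinner (\<xi> - \<eta>) \<zeta> = 0))"


section \<open>Tensors and subproduct systems\<close>

text \<open>
  Everything lives in the full Fock space \<open>'a list ell2\<close>: the basis vector indexed by the word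
  \<open>w\<^sub>1 \<dots> w\<^sub>n\<close> is \<open>e\<^bsub>w\<^sub>1\<^esub> \<otimes> \<dots> \<otimes> e\<^bsub>w\<^sub>n\<^esub>\<close>.
\<close>

definition tensor_power :: "nat \<Rightarrow> 'a list ell2 set" where
  "tensor_power n = {\<xi>. \<forall>w. Rep_ell2 \<xi> w \<noteq> 0 \<longrightarrow> length w = n}"

text \<open>\<open>tensor m \<xi> \<eta>\<close> is \<open>\<xi> \<otimes> \<eta>\<close> for \<open>\<xi>\<close> in \<open>tensor_power m\<close>.\<close>

lift_definition tensor :: "nat \<Rightarrow> 'a list ell2 \<Rightarrow> 'a list ell2 \<Rightarrow> 'a list ell2" is
  "\<lambda>m f g w. f (take m w) * g (drop m w)"
proof -
  fix m and f g :: "'a list \<Rightarrow> complex"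
  assume f: "(\<lambda>x. (cmod (f x))\<^sup>2) summable_on UNIV" and g: "(\<lambda>x. (cmod (g x))\<^sup>2) summable_on UNIV"
  let ?s = "\<lambda>w::'a list. (take m w, drop m w)"
  have inj: "inj ?s"
    by (rule injI) (metis append_take_drop_id prod.inject)
  have "(\<lambda>(u, v). (cmod (f u))\<^sup>2 * (cmod (g v))\<^sup>2) summable_on UNIV \<times> UNIV"
    by (intro summable_on_SigmaI[where g = "\<lambda>u. (cmod (f u))\<^sup>2 * (\<Sum>\<^sub>\<infinity>v. (cmod (g v))\<^sup>2)"])
      (auto intro!: has_sum_cmult_right has_sum_infsum g summable_on_cmult_left f)
  then have "(\<lambda>(u, v). (cmod (f u))\<^sup>2 * (cmod (g v))\<^sup>2) summable_on range ?s"
    by (rule summable_on_subset_banach) simp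
  then have "((\<lambda>(u, v). (cmod (f u))\<^sup>2 * (cmod (g v))\<^sup>2) \<circ> ?s) summable_on UNIV"
    by (subst (asm) summable_on_reindex) (auto intro: inj)
  then show "(\<lambda>w. (cmod (f (take m w) * g (drop m w)))\<^sup>2) summable_on UNIV"
    by (simp add: o_def norm_mult power_mult_distrib)
qed

lift_definition eval_basis :: "'a free_algebra \<Rightarrow> 'a list ell2" is Poly_Mapping.lookup
proof -
  fix f :: "'a free_algebra"
  have "(\<lambda>x. (cmod (Poly_Mapping.lookup f x))\<^sup>2) summable_on Poly_Mapping.keys f"
    by simp
  then show "(\<lambda>x. (cmod (Poly_Mapping.lookup f x))\<^sup>2) summable_on UNIV"
    by (rule summable_on_cong_neutral[THEN iffD1, rotated -1]) (auto simp: in_keys_iff)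
qed

definition basis_vec :: "'a list \<Rightarrow> 'a list ell2" where
  "basis_vec w = eval_basis (Poly_Mapping.single w 1)"

text \<open>
  A subproduct system is represented by its fibres; the projections are \<open>p\<^sub>n = orth_proj (X n)\<close>.
\<close>

type_synonym 'a fibres = "nat \<Rightarrow> 'a list ell2 set"

definition subproduct_system :: "'a free_algebra set \<Rightarrow> 'a fibres" where
  "subproduct_system I n =
     {\<xi> \<in> tensor_power n. \<forall>f\<in>I. homogeneous n f \<longrightarrow> cinner \<xi> (eval_basis f) = 0}"

definition intertwining_maps ::
    "'a fibres \<Rightarrow> 'b fibres \<Rightarrow> (nat \<Rightarrow> 'a list ell2 \<Rightarrow> 'b list ell2) \<Rightarrow> bool" where
  "intertwining_maps X Y V \<longleftrightarrow>
     (\<forall>n. bij_betw (V n) (X n) (Y n)) \<and>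
     (\<forall>n. \<forall>\<xi>\<in>X n. \<forall>\<eta>\<in>X n. V n (\<xi> + \<eta>) = V n \<xi> + V n \<eta>) \<and>
     (\<forall>n. \<forall>\<xi>\<in>X n. \<forall>c. V n (scaleC c \<xi>) = scaleC c (V n \<xi>)) \<and>
     (\<forall>m n. \<forall>\<xi>\<in>X m. \<forall>\<eta>\<in>X n.
        V (m + n) (orth_proj (X (m + n)) (tensor m \<xi> \<eta>)) =
        orth_proj (Y (m + n)) (tensor m (V m \<xi>) (V n \<eta>)))"

definition similar_subproduct :: "'a fibres \<Rightarrow> 'b fibres \<Rightarrow> bool" where
  "similar_subproduct X Y \<longleftrightarrow>
     (\<exists>V. intertwining_maps X Y V \<and>
        (\<exists>C. \<forall>n. \<forall>\<xi>\<in>X n. norm (V n \<xi>) \<le> C * norm \<xi>) \<and>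
        (\<exists>C. \<forall>n. \<forall>\<eta>\<in>Y n. norm (inv_into (X n) (V n) \<eta>) \<le> C * norm \<eta>))"

definition isomorphic_subproduct :: "'a fibres \<Rightarrow> 'b fibres \<Rightarrow> bool" where
  "isomorphic_subproduct X Y \<longleftrightarrow>
     (\<exists>V. intertwining_maps X Y V \<and>
        (\<forall>n. \<forall>\<xi>\<in>X n. \<forall>\<eta>\<in>X n. cinner (V n \<xi>) (V n \<eta>) = cinner \<xi> \<eta>))"


section \<open>The Fock space and the tensor algebra\<close>

lift_definition component :: "nat \<Rightarrow> 'a list ell2 \<Rightarrow> 'a list ell2" is
  "\<lambda>n f w. if length w = n then f w else 0"
proof -
  fix n and f :: "'a list \<Rightarrow> complex"
  assume "(\<lambda>x. (cmod (f x))\<^sup>2) summable_on UNIV"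
  then show "(\<lambda>x. (cmod (if length x = n then f x else 0))\<^sup>2) summable_on UNIV"
    by (rule summable_on_comparison_test) auto
qed

definition fock :: "'a fibres \<Rightarrow> 'a list ell2 set" where
  "fock X = {\<xi>. \<forall>n. component n \<xi> \<in> X n}"

text \<open>
  An operator on \<open>fock X\<close> is represented by its extension by zero to the orthogonal complement
  of \<open>fock X\<close> in the full Fock space. This identifies the algebra of bounded operators on
  \<open>fock X\<close> isometrically with a corner of the bounded operators on \<open>'a list ell2\<close>, whose unit is
  the projection onto \<open>fock X\<close>. The operator \<open>fock_op X g\<close> is the one that acts as \<open>g n\<close> on \<open>X n\<close>.
\<close>

definition fock_op ::
    "'a fibres \<Rightarrow> (nat \<Rightarrow> 'a list ell2 \<Rightarrow> 'a list ell2) \<Rightarrow> 'a list ell2 \<Rightarrow>\<^sub>L 'a list ell2" where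
  "fock_op X g = (THE T. (\<forall>n. \<forall>\<xi>\<in>X n. blinfun_apply T \<xi> = g n \<xi>) \<and>
                         (\<forall>\<xi>. (\<forall>\<eta>\<in>fock X. cinner \<xi> \<eta> = 0) \<longrightarrow> blinfun_apply T \<xi> = 0))"

definition fock_id :: "'a fibres \<Rightarrow> 'a list ell2 \<Rightarrow>\<^sub>L 'a list ell2" where
  "fock_id X = fock_op X (\<lambda>n \<xi>. \<xi>)"

definition shift :: "'a fibres \<Rightarrow> 'a \<Rightarrow> 'a list ell2 \<Rightarrow>\<^sub>L 'a list ell2" where
  "shift X i = fock_op X (\<lambda>n \<xi>. orth_proj (X (n + 1)) (tensor 1 (basis_vec [i]) \<xi>))"

definition closed_unital_algebra :: "'a fibres \<Rightarrow> ('a list ell2 \<Rightarrow>\<^sub>L 'a list ell2) set \<Rightarrow> bool" where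
  "closed_unital_algebra X \<A> \<longleftrightarrow>
     closed \<A> \<and> fock_id X \<in> \<A> \<and> (\<forall>A\<in>\<A>. \<forall>c. scaleC_op c o\<^sub>L A \<in> \<A>) \<and>
     (\<forall>A\<in>\<A>. \<forall>B\<in>\<A>. A + B \<in> \<A> \<and> A o\<^sub>L B \<in> \<A>)"

definition tensor_algebra :: "'a fibres \<Rightarrow> ('a list ell2 \<Rightarrow>\<^sub>L 'a list ell2) set" where
  "tensor_algebra X = closed_unital_algebra X hull range (shift X)"


section \<open>Isomorphisms of operator algebras\<close>

definition algebra_iso ::
    "('b ell2 \<Rightarrow>\<^sub>L 'b ell2) set \<Rightarrow> ('c ell2 \<Rightarrow>\<^sub>L 'c ell2) set \<Rightarrow>
     (('b ell2 \<Rightarrow>\<^sub>L 'b ell2) \<Rightarrow> ('c ell2 \<Rightarrow>\<^sub>L 'c ell2)) \<Rightarrow> bool" where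
  "algebra_iso \<A> \<B> \<phi> \<longleftrightarrow>
     bij_betw \<phi> \<A> \<B> \<and>
     (\<forall>A\<in>\<A>. \<forall>B\<in>\<A>. \<phi> (A + B) = \<phi> A + \<phi> B \<and> \<phi> (A o\<^sub>L B) = \<phi> A o\<^sub>L \<phi> B) \<and>
     (\<forall>A\<in>\<A>. \<forall>c. \<phi> (scaleC_op c o\<^sub>L A) = scaleC_op c o\<^sub>L \<phi> A)"

text \<open>
  The norm of the \<open>n \<times> n\<close> operator matrix \<open>(A i j)\<close>, \<open>i, j < n\<close>, acting on the direct sum of
  \<open>n\<close> copies of the Hilbert space.
\<close>

definition matrix_norm :: "nat \<Rightarrow> (nat \<Rightarrow> nat \<Rightarrow> 'b ell2 \<Rightarrow>\<^sub>L 'b ell2) \<Rightarrow> real" where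
  "matrix_norm n A =
     (SUP \<xi> \<in> {\<xi>. L2_set (\<lambda>j. norm (\<xi> j)) {..<n} \<le> 1}.
        L2_set (\<lambda>i. norm (\<Sum>j<n. blinfun_apply (A i j) (\<xi> j))) {..<n})"

definition isometric_on where
  "isometric_on \<A> \<phi> \<longleftrightarrow> (\<forall>A\<in>\<A>. norm (\<phi> A) = norm A)"

definition completely_isometric_on ::
    "('b ell2 \<Rightarrow>\<^sub>L 'b ell2) set \<Rightarrow> (('b ell2 \<Rightarrow>\<^sub>L 'b ell2) \<Rightarrow> ('c ell2 \<Rightarrow>\<^sub>L 'c ell2)) \<Rightarrow> bool" where
  "completely_isometric_on \<A> \<phi> \<longleftrightarrow>
     (\<forall>n A. (\<forall>i<n. \<forall>j<n. A i j \<in> \<A>) \<longrightarrow> matrix_norm n (\<lambda>i j. \<phi> (A i j)) = matrix_norm n A)"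

definition bounded_on where
  "bounded_on \<A> \<phi> \<longleftrightarrow> (\<exists>C. \<forall>A\<in>\<A>. norm (\<phi> A) \<le> C * norm A)"

definition completely_bounded_on ::
    "('b ell2 \<Rightarrow>\<^sub>L 'b ell2) set \<Rightarrow> (('b ell2 \<Rightarrow>\<^sub>L 'b ell2) \<Rightarrow> ('c ell2 \<Rightarrow>\<^sub>L 'c ell2)) \<Rightarrow> bool" where
  "completely_bounded_on \<A> \<phi> \<longleftrightarrow>
     (\<exists>C. \<forall>n A. (\<forall>i<n. \<forall>j<n. A i j \<in> \<A>) \<longrightarrow>
        matrix_norm n (\<lambda>i j. \<phi> (A i j)) \<le> C * matrix_norm n A)"

definition isometrically_isomorphic where
  "isometrically_isomorphic \<A> \<B> \<longleftrightarrow> (\<exists>\<phi>. algebra_iso \<A> \<B> \<phi> \<and> isometric_on \<A> \<phi>)"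

definition completely_isometrically_isomorphic where
  "completely_isometrically_isomorphic \<A> \<B> \<longleftrightarrow>
     (\<exists>\<phi>. algebra_iso \<A> \<B> \<phi> \<and> completely_isometric_on \<A> \<phi>)"

definition topologically_isomorphic where
  "topologically_isomorphic \<A> \<B> \<longleftrightarrow>
     (\<exists>\<phi>. algebra_iso \<A> \<B> \<phi> \<and> bounded_on \<A> \<phi> \<and> bounded_on \<B> (inv_into \<A> \<phi>))"

definition completely_boundedly_isomorphic where
  "completely_boundedly_isomorphic \<A> \<B> \<longleftrightarrow>
     (\<exists>\<phi>. algebra_iso \<A> \<B> \<phi> \<and> completely_bounded_on \<A> \<phi>)"

end

theory Submission
  imports Defs "HOL-Complex_Analysis.Complex_Analysis"
begin

text \<open>
  The two halves of the theorem are proved together. An isomorphism is always handled as a pair of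
  mutually inverse homomorphisms with explicit norm bounds \<open>C\<close> and \<open>D\<close>; bounds \<open>C = D = 1\<close> give the
  isometric half, arbitrary ones the topological half.

  From subproduct systems to algebras: maps \<open>V n\<close> that intertwine the two systems and are uniformly
  bounded add up to an invertible operator \<open>S\<close> between the Fock spaces, and the multiplicativity of
  \<open>V\<close> says exactly that \<open>A \<mapsto> S A S\<inverse>\<close> sends the creation operator of \<open>\<xi>\<close> to that of \<open>V \<xi>\<close>
  (\<open>conj_bounded_hom\<close>, \<open>conj_iso_pair\<close>). Conjugation is completely bounded, and completely isometric
  when \<open>S\<close> is unitary (\<open>matrix_norm_conj\<close>).

  From algebras to subproduct systems: every \<open>A\<close> in the tensor algebra of \<open>X\<close> has Fourier coefficients
  \<open>coefficient n A\<close> in \<open>X n\<close>, namely the components of \<open>A\<close> applied to the vacuum. They determine \<open>A\<close>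
  and multiply like the coefficients of power series (\<open>component_apply\<close>, \<open>coeff_mult\<close>), and the
  operators with a single coefficient are the creation operators, whose norm is the norm of that
  coefficient. If an isomorphism \<open>\<phi>\<close> respects the character \<open>ev 0\<close>, which takes the constant
  coefficient, then it respects the filtration by the order of vanishing, and the leading coefficient
  of \<open>\<phi>\<close> of the creation operator of \<open>\<xi>\<close> defines \<open>V n \<xi>\<close> (\<open>intertwining_of_iso_pair\<close>).

  It remains to replace an arbitrary isomorphism \<open>\<phi>\<close> by one that respects \<open>ev 0\<close>
  (\<open>vacuum_preserving\<close>). Bounded characters are contractive, hence given by points of the closed unit
  ball of \<open>tensor_power 1\<close> in the zero set of the ideal, and conversely every point of the zero set in
  the open ball gives a character (\<open>char_point\<close>, \<open>bounded_character_ev\<close>). So \<open>\<phi>\<close> induces a map \<open>F\<close>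
  from the open part of the zero set of \<open>Y\<close> to the zero set of \<open>X\<close>. Let \<open>b = F 0\<close> and let \<open>a\<close> be the
  point with \<open>F a = 0\<close>; assume that both are nonzero. By the maximum principle they lie in the open
  balls (\<open>point_norm_less_1\<close>). As zero sets of homogeneous ideals are unions of complex lines through \<open>0\<close>,
  the disc through \<open>a\<close> lies in the domain of \<open>F\<close>, and the Schwarz lemma gives \<open>\<parallel>b\<parallel> \<le> \<parallel>a\<parallel>\<close>. The inverse
  of \<open>\<phi>\<close> gives the opposite inequality, and the case of equality in the Schwarz lemma shows that \<open>F\<close>
  maps the disc through \<open>a\<close> to the disc through \<open>b\<close> by a Moebius transformation exchanging \<open>0\<close> with
  the point at radius \<open>\<parallel>a\<parallel>\<close> (\<open>schwarz_equality\<close>). Rotations of the discs come from gauge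
  automorphisms of the two algebras. Using one rotation of each disc, a composition of \<open>\<phi>\<close>, \<open>\<phi>\<inverse>\<close>, \<open>\<phi>\<close> and
  two gauge automorphisms can be made to fix the point \<open>0\<close> (\<open>disc_flip_circle\<close>).

  A completely bounded isomorphism has a bounded inverse by the Banach isomorphism theorem
  (\<open>bounded_inverse\<close>).
\<close>

section \<open>The complex Hilbert space of square-summable families\<close>

lemma ell2_eqI: "(\<And>w. Rep_ell2 f w = Rep_ell2 g w) \<Longrightarrow> f = g"
  by (simp add: Rep_ell2_inject[symmetric] fun_eq_iff)

lemma minus_ell2_rep_eq: "Rep_ell2 (f - g) = (\<lambda>w. Rep_ell2 f w - Rep_ell2 g w)"
  unfolding minus_ell2_def plus_ell2.rep_eq uminus_ell2.rep_eq by simp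

lemmas ell2_rep = zero_ell2.rep_eq plus_ell2.rep_eq uminus_ell2.rep_eq minus_ell2_rep_eq
  scaleR_ell2.rep_eq scaleC.rep_eq

lemma sum_ell2_rep: "Rep_ell2 (\<Sum>i\<in>A. f i) w = (\<Sum>i\<in>A. Rep_ell2 (f i) w)"
  by (induction A rule: infinite_finite_induct) (auto simp: ell2_rep)

interpretation ell2: vector_space scaleC
  by standard (auto intro!: ell2_eqI simp: ell2_rep algebra_simps)

lemma scaleC_of_real [simp]: "scaleC (of_real r) f = r *\<^sub>R f"
  by (rule ell2_eqI) (simp add: ell2_rep scaleR_conv_of_real)

lemma summable_cinner: "(\<lambda>x. Rep_ell2 f x * cnj (Rep_ell2 g x)) summable_on UNIV"
proof -
  have "(\<lambda>x. complex_of_real (Rep_ell2 f x \<bullet> Rep_ell2 g x) + \<i> *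
      complex_of_real (Rep_ell2 (scaleC (-\<i>) f) x \<bullet> Rep_ell2 g x)) summable_on UNIV"
    by (intro summable_on_add summable_on_cmult_right summable_on_of_real summable_inner_ell2)
  moreover have "complex_of_real (Rep_ell2 f x \<bullet> Rep_ell2 g x) + \<i> *
      complex_of_real (Rep_ell2 (scaleC (-\<i>) f) x \<bullet> Rep_ell2 g x)
      = Rep_ell2 f x * cnj (Rep_ell2 g x)" for x
    by (simp add: complex_eq_iff inner_complex_def ell2_rep)
  ultimately show ?thesis by simp
qed

text \<open>
  The real inner product determines the complex one. So the bounds and the continuity of the complex
  inner product can be read off from the \<open>real_inner\<close> structure.
\<close>

lemma cinner_eq_inner: "cinner f g = Complex (f \<bullet> g) (scaleC (-\<i>) f \<bullet> g)"
proof -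
  have 1: "Re (cinner f g) = f \<bullet> g" for f g :: "'a ell2"
  proof -
    have "Re (cinner f g) = (\<Sum>\<^sub>\<infinity>x. Re (Rep_ell2 f x * cnj (Rep_ell2 g x)))"
      unfolding cinner_def by (rule infsum_Re[symmetric]) (rule summable_cinner)
    then show ?thesis
      by (simp add: inner_ell2_def inner_complex_def)
  qed
  have "cinner (scaleC (-\<i>) f) g = (\<Sum>\<^sub>\<infinity>x. -\<i> * (Rep_ell2 f x * cnj (Rep_ell2 g x)))"
    by (simp add: cinner_def ell2_rep mult.assoc)
  also have "\<dots> = -\<i> * cinner f g"
    unfolding cinner_def by (rule infsum_cmult_right')
  finally have "Re (cinner (scaleC (-\<i>) f) g) = Im (cinner f g)" by simp
  then show ?thesis using 1 by (simp add: complex_eq_iff)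
qed

lemma Re_cinner: "Re (cinner f g) = f \<bullet> g"
  by (simp add: cinner_eq_inner)

lemma cinner_scaleC_left [simp]: "cinner (scaleC c f) g = c * cinner f g"
  by (simp add: cinner_def ell2_rep infsum_cmult_right' mult.assoc)

lemma cinner_scaleC_right [simp]: "cinner f (scaleC c g) = cnj c * cinner f g"
proof -
  have "cinner f (scaleC c g) = (\<Sum>\<^sub>\<infinity>x. cnj c * (Rep_ell2 f x * cnj (Rep_ell2 g x)))"
    unfolding cinner_def by (intro infsum_cong) (simp add: ell2_rep)
  also have "\<dots> = cnj c * cinner f g"
    unfolding cinner_def by (rule infsum_cmult_right')
  finally show ?thesis .
qed

lemma cinner_commute: "cinner g f = cnj (cinner f g)"
  by (simp add: cinner_def mult.commute flip: infsum_cnj)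

lemma cinner_add_left: "cinner (f + g) h = cinner f h + cinner g h"
  by (simp add: cinner_eq_inner inner_add_left inner_diff_left ell2.scale_right_distrib complex_eq_iff)
lemma cinner_diff_left: "cinner (f - g) h = cinner f h - cinner g h"
  by (simp add: cinner_eq_inner inner_diff_left ell2.scale_right_diff_distrib complex_eq_iff)
lemma cinner_add_right: "cinner h (f + g) = cinner h f + cinner h g"
  by (simp add: cinner_eq_inner inner_add_right complex_eq_iff)
lemma cinner_diff_right: "cinner h (f - g) = cinner h f - cinner h g"
  by (simp add: cinner_eq_inner inner_diff_right complex_eq_iff)
lemma cinner_zero_left [simp]: "cinner 0 f = 0"
  by (simp add: cinner_eq_inner complex_eq_iff)
lemma cinner_zero_right [simp]: "cinner f 0 = 0"
  by (simp add: cinner_eq_inner complex_eq_iff)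
lemma cinner_sum_left: "cinner (\<Sum>i\<in>A. f i) h = (\<Sum>i\<in>A. cinner (f i) h)"
  by (induction A rule: infinite_finite_induct) (auto simp: cinner_add_left)
lemma cinner_same: "cinner f f = of_real ((norm f)\<^sup>2)"
proof -
  have "Im (cinner f f) = 0"
    using cinner_commute[of f f] by (simp add: complex_eq_iff)
  then show ?thesis
    by (simp add: complex_eq_iff Re_cinner dot_square_norm)
qed

lemma norm_cinner_le: "cmod (cinner f g) \<le> norm f * norm g"
proof (cases "cinner f g = 0")
  case False
  define c where "c = cnj (sgn (cinner f g))"
  have c: "cmod c = 1" using False by (simp add: c_def norm_sgn)
  have "cinner (scaleC c f) g = of_real (cmod (cinner f g))"
    using False complex_norm_square[of "cinner f g"]
    by (simp add: c_def sgn_eq power2_eq_square field_simps)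
  then have "cmod (cinner f g) = scaleC c f \<bullet> g"
    by (metis Re_cinner Re_complex_of_real)
  also have "\<dots> \<le> norm (scaleC c f) * norm g" by (rule norm_cauchy_schwarz)
  finally show ?thesis by (simp add: norm_scaleC c)
qed simp

lemma scaleC_op_apply [simp]: "blinfun_apply (scaleC_op c) f = scaleC c f"
  by (simp add: scaleC_op.rep_eq)

lemma bounded_linear_cinner_left: "bounded_linear (\<lambda>f. cinner f g)"
proof (rule bounded_linear_intro)
  show "norm (cinner f g) \<le> norm f * norm g" for f by (rule norm_cinner_le)
  show "cinner (r *\<^sub>R f) g = r *\<^sub>R cinner f g" for r f
    by (simp flip: scaleC_of_real add: scaleR_conv_of_real)
qed (rule cinner_add_left)

lemma norm_ell2_sq: "(norm f)\<^sup>2 = (\<Sum>\<^sub>\<infinity>x. (cmod (Rep_ell2 f x))\<^sup>2)"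
  by (simp only: power2_norm_eq_inner inner_ell2_def)

lemma cmod_Rep_le_norm: "cmod (Rep_ell2 f w) \<le> norm f"
proof -
  have "(cmod (Rep_ell2 f w))\<^sup>2 = sum (\<lambda>x. (cmod (Rep_ell2 f x))\<^sup>2) {w}" by simp
  also have "\<dots> \<le> (\<Sum>\<^sub>\<infinity>x. (cmod (Rep_ell2 f x))\<^sup>2)"
    by (rule finite_sum_le_infsum) (auto intro: summable_ell2)
  also have "\<dots> = (norm f)\<^sup>2"
    by (rule norm_ell2_sq[symmetric])
  finally show ?thesis by (rule power2_le_imp_le) simp
qed

lemma bounded_linear_Rep_ell2: "bounded_linear (\<lambda>f. Rep_ell2 f w)"
  by (rule bounded_linear_intro[where K = 1]) (auto simp: ell2_rep cmod_Rep_le_norm)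

text \<open>
  The limit of a Cauchy sequence is taken pointwise; bounding finite partial sums of the squared
  distance, uniformly in the index, shows that it is square-summable and the limit in norm.
\<close>

instance ell2 :: (type) banach
proof
  fix f :: "nat \<Rightarrow> 'a ell2"
  assume C: "Cauchy f"
  have "Cauchy (\<lambda>n. Rep_ell2 (f n) w)" for w
    by (rule bounded_linear.Cauchy[OF bounded_linear_Rep_ell2 C])
  then have "\<forall>w. \<exists>l. (\<lambda>n. Rep_ell2 (f n) w) \<longlonglongrightarrow> l"
    using Cauchy_convergent unfolding convergent_def by blast
  then obtain l where l: "\<And>w. (\<lambda>n. Rep_ell2 (f n) w) \<longlonglongrightarrow> l w" by metis
  have fin: "(\<Sum>w\<in>F. (cmod (Rep_ell2 (f n) w - l w))\<^sup>2) \<le> e\<^sup>2"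
    if "finite F" and N: "\<And>m. m \<ge> N \<Longrightarrow> norm (f n - f m) \<le> e" and "e > 0" for F n N e
  proof (rule tendsto_upperbound[OF _ _ trivial_limit_sequentially])
    show "(\<lambda>m. \<Sum>w\<in>F. (cmod (Rep_ell2 (f n) w - Rep_ell2 (f m) w))\<^sup>2)
        \<longlonglongrightarrow> (\<Sum>w\<in>F. (cmod (Rep_ell2 (f n) w - l w))\<^sup>2)"
      by (intro tendsto_intros l)
    show "\<forall>\<^sub>F m in sequentially. (\<Sum>w\<in>F. (cmod (Rep_ell2 (f n) w - Rep_ell2 (f m) w))\<^sup>2) \<le> e\<^sup>2"
    proof (rule eventually_sequentiallyI[of N])
      fix m assume "m \<ge> N"
      have "(\<Sum>w\<in>F. (cmod (Rep_ell2 (f n - f m) w))\<^sup>2) \<le> (norm (f n - f m))\<^sup>2"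
        unfolding norm_ell2_sq
        by (rule finite_sum_le_infsum) (auto intro: summable_ell2 that)
      also have "\<dots> \<le> e\<^sup>2" using N[OF \<open>m \<ge> N\<close>] by (intro power_mono) auto
      finally show "(\<Sum>w\<in>F. (cmod (Rep_ell2 (f n) w - Rep_ell2 (f m) w))\<^sup>2) \<le> e\<^sup>2"
        by (simp add: ell2_rep)
    qed
  qed
  have summ: "(\<lambda>w. (cmod (Rep_ell2 (f n) w - l w))\<^sup>2) summable_on UNIV"
      and bnd: "(\<Sum>\<^sub>\<infinity>w. (cmod (Rep_ell2 (f n) w - l w))\<^sup>2) \<le> e\<^sup>2"
    if N: "\<And>m. m \<ge> N \<Longrightarrow> norm (f n - f m) \<le> e" "e > 0" for n N e
  proof -
    show s: "(\<lambda>w. (cmod (Rep_ell2 (f n) w - l w))\<^sup>2) summable_on UNIV"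
      by (rule nonneg_bdd_above_summable_on) (auto intro!: bdd_aboveI fin[OF _ N])
    show "(\<Sum>\<^sub>\<infinity>w. (cmod (Rep_ell2 (f n) w - l w))\<^sup>2) \<le> e\<^sup>2"
      by (rule infsum_le_finite_sums[OF s]) (rule fin[OF _ N])
  qed
  obtain N where N: "\<And>m n. m \<ge> N \<Longrightarrow> n \<ge> N \<Longrightarrow> norm (f m - f n) < 1"
    using C unfolding Cauchy_iff by (metis zero_less_one)
  define D where "D = Abs_ell2 (\<lambda>w. Rep_ell2 (f N) w - l w)"
  have "Rep_ell2 D = (\<lambda>w. Rep_ell2 (f N) w - l w)"
    unfolding D_def using summ[of N N 1] N by (subst Abs_ell2_inverse) (auto intro: less_imp_le)
  then have L: "Rep_ell2 (f N - D) w = l w" for w by (simp add: ell2_rep)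
  have "f \<longlonglongrightarrow> f N - D"
  proof (rule LIMSEQ_I)
    fix r :: real assume "r > 0"
    then obtain M where M: "\<And>m n. m \<ge> M \<Longrightarrow> n \<ge> M \<Longrightarrow> norm (f m - f n) < r/2"
      using C unfolding Cauchy_iff by (metis half_gt_zero)
    have "norm (f n - (f N - D)) < r" if "n \<ge> M" for n
    proof -
      have "(norm (f n - (f N - D)))\<^sup>2 \<le> (r/2)\<^sup>2"
        using bnd[of M n "r/2"] M[OF that] \<open>r > 0\<close> L
        by (simp add: norm_ell2_sq minus_ell2_rep_eq[of "f n"] less_imp_le)
      then have "norm (f n - (f N - D)) \<le> r/2" using \<open>r > 0\<close> power2_le_imp_le[of _ "r/2"] by simp
      then show ?thesis using \<open>r > 0\<close> by simp
    qed
    then show "\<exists>no. \<forall>n\<ge>no. norm (f n - (f N - D)) < r" by blast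
  qed
  then show "convergent f" by (auto simp: convergent_def)
qed

subsection \<open>Orthogonal projections\<close>

definition closed_csubspace :: "'b ell2 set \<Rightarrow> bool" where
  "closed_csubspace S \<longleftrightarrow> closed S \<and> ell2.subspace S"

lemma closed_csubspaceD:
  assumes "closed_csubspace S"
  shows "closed S" "0 \<in> S" "f \<in> S \<Longrightarrow> g \<in> S \<Longrightarrow> f + g \<in> S" "f \<in> S \<Longrightarrow> g \<in> S \<Longrightarrow> f - g \<in> S"
    "f \<in> S \<Longrightarrow> scaleC c f \<in> S" "f \<in> S \<Longrightarrow> r *\<^sub>R f \<in> S"
proof -
  have S: "closed S" "ell2.subspace S" using assms by (simp_all add: closed_csubspace_def)
  show "closed S" "0 \<in> S" using S by (simp_all add: ell2.subspace_0)
  show "f \<in> S \<Longrightarrow> g \<in> S \<Longrightarrow> f + g \<in> S" using S by (rule_tac ell2.subspace_add)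
  show "f \<in> S \<Longrightarrow> g \<in> S \<Longrightarrow> f - g \<in> S" using S by (rule_tac ell2.subspace_diff)
  show "f \<in> S \<Longrightarrow> scaleC c f \<in> S" using S by (rule_tac ell2.subspace_scale)
  show "f \<in> S \<Longrightarrow> r *\<^sub>R f \<in> S" using S ell2.subspace_scale[of S f "of_real r"] by simp
qed

text \<open>
  A minimizing sequence is Cauchy by the parallelogram law, and \<open>S\<close> is complete.
\<close>

lemma closest_point_exists:
  assumes S: "closed_csubspace S"
  shows "\<exists>\<eta>\<in>S. \<forall>\<zeta>\<in>S. norm (\<xi> - \<eta>) \<le> norm (\<xi> - \<zeta>)"
proof -
  note S = closed_csubspaceD[OF S]
  define d where "d = Inf ((\<lambda>\<eta>. norm (\<xi> - \<eta>)) ` S)"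
  have bdd: "bdd_below ((\<lambda>\<eta>. norm (\<xi> - \<eta>)) ` S)"
    by (rule bdd_belowI[of _ 0]) auto
  have d_le: "d \<le> norm (\<xi> - \<eta>)" if "\<eta> \<in> S" for \<eta>
    unfolding d_def using bdd that by (intro cInf_lower) auto
  have d0: "0 \<le> d" unfolding d_def using S(2) by (intro cInf_greatest) auto
  have "\<exists>\<eta>\<in>S. norm (\<xi> - \<eta>) < d + 1 / real (Suc n)" for n
  proof -
    have "\<exists>x\<in>(\<lambda>\<eta>. norm (\<xi> - \<eta>)) ` S. x < d + 1 / real (Suc n)"
      using S(2) bdd by (subst cInf_less_iff[symmetric]) (auto simp: d_def)
    then show ?thesis by auto
  qed
  then obtain \<eta> where \<eta>: "\<And>n. \<eta> n \<in> S" "\<And>n. norm (\<xi> - \<eta> n) < d + 1 / real (Suc n)" by metis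
  have par: "(norm (\<eta> m - \<eta> n))\<^sup>2 \<le> 2 * (norm (\<xi> - \<eta> m))\<^sup>2 + 2 * (norm (\<xi> - \<eta> n))\<^sup>2 - 4 * d\<^sup>2" for m n
  proof -
    have "d \<le> norm (\<xi> - (1/2) *\<^sub>R (\<eta> m + \<eta> n))"
      by (rule d_le) (intro S \<eta>)
    then have "d\<^sup>2 \<le> (norm (\<xi> - (1/2) *\<^sub>R (\<eta> m + \<eta> n)))\<^sup>2" using d0 by (intro power_mono)
    moreover have "(norm (\<eta> m - \<eta> n))\<^sup>2 + 4 * (norm (\<xi> - (1/2) *\<^sub>R (\<eta> m + \<eta> n)))\<^sup>2
        = 2 * (norm (\<xi> - \<eta> m))\<^sup>2 + 2 * (norm (\<xi> - \<eta> n))\<^sup>2"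
      by (simp add: power2_norm_eq_inner inner_simps inner_commute algebra_simps)
    ultimately show ?thesis by linarith
  qed
  have lim: "(\<lambda>n. norm (\<xi> - \<eta> n)) \<longlonglongrightarrow> d"
  proof (rule tendsto_sandwich[OF _ _ tendsto_const])
    show "\<forall>\<^sub>F n in sequentially. d \<le> norm (\<xi> - \<eta> n)" using d_le \<eta> by auto
    show "\<forall>\<^sub>F n in sequentially. norm (\<xi> - \<eta> n) \<le> d + 1 / real (Suc n)"
      by (intro always_eventually allI less_imp_le \<eta>)
    show "(\<lambda>n. d + 1 / real (Suc n)) \<longlonglongrightarrow> d"
      using tendsto_add[OF tendsto_const LIMSEQ_Suc[OF lim_1_over_n]] by simp
  qed
  have "Cauchy \<eta>"
  proof (rule CauchyI)
    fix e :: real assume e: "e > 0"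
    have "(\<lambda>n. 2 * (norm (\<xi> - \<eta> n))\<^sup>2 - 2 * d\<^sup>2) \<longlonglongrightarrow> 2 * d\<^sup>2 - 2 * d\<^sup>2"
      by (intro tendsto_intros lim)
    then have "\<forall>\<^sub>F n in sequentially. 2 * (norm (\<xi> - \<eta> n))\<^sup>2 - 2 * d\<^sup>2 < e\<^sup>2 / 2"
      using e by (intro order_tendstoD(2)) auto
    then obtain N where N: "\<And>n. n \<ge> N \<Longrightarrow> 2 * (norm (\<xi> - \<eta> n))\<^sup>2 - 2 * d\<^sup>2 < e\<^sup>2 / 2"
      by (auto simp: eventually_sequentially)
    have "norm (\<eta> m - \<eta> n) < e" if "m \<ge> N" "n \<ge> N" for m n
    proof -
      have "(norm (\<eta> m - \<eta> n))\<^sup>2 < e\<^sup>2" using par[of m n] N[OF that(1)] N[OF that(2)] by linarith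
      then show ?thesis using e by (auto intro: power_less_imp_less_base)
    qed
    then show "\<exists>M. \<forall>m\<ge>M. \<forall>n\<ge>M. norm (\<eta> m - \<eta> n) < e" by blast
  qed
  then obtain l where l: "\<eta> \<longlonglongrightarrow> l" by (auto simp: Cauchy_convergent_iff convergent_def)
  have "l \<in> S" using S(1) \<eta>(1) l closed_sequentially by blast
  moreover have "norm (\<xi> - l) = d"
    by (rule LIMSEQ_unique[OF _ lim]) (intro tendsto_intros l)
  ultimately show ?thesis using d_le by auto
qed

text \<open>
  If the closest point \<open>\<eta>\<close> were not the foot of a perpendicular, then moving it along an offending
  direction \<open>\<zeta>\<close> by the optimal multiple \<open>t\<close> would decrease the distance. This controls real parts;
  imaginary parts follow by testing with \<open>scaleC \<i> \<zeta>\<close>.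
\<close>

lemma orth_proj_exists:
  assumes S: "closed_csubspace S"
  shows "\<exists>\<eta>\<in>S. \<forall>\<zeta>\<in>S. cinner (\<xi> - \<eta>) \<zeta> = 0"
proof -
  obtain \<eta> where \<eta>: "\<eta> \<in> S" "\<And>\<zeta>. \<zeta> \<in> S \<Longrightarrow> norm (\<xi> - \<eta>) \<le> norm (\<xi> - \<zeta>)"
    using closest_point_exists[OF S] by blast
  note S = closed_csubspaceD[OF S]
  have 0: "(\<xi> - \<eta>) \<bullet> \<zeta> = 0" if "\<zeta> \<in> S" for \<zeta>
  proof (cases "\<zeta> = 0")
    case False
    define t where "t = ((\<xi> - \<eta>) \<bullet> \<zeta>) / (norm \<zeta>)\<^sup>2"
    have "norm (\<xi> - \<eta>) \<le> norm (\<xi> - (\<eta> + t *\<^sub>R \<zeta>))"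
      by (rule \<eta>) (intro S \<eta> that)
    then have "(norm (\<xi> - \<eta>))\<^sup>2 \<le> (norm ((\<xi> - \<eta>) - t *\<^sub>R \<zeta>))\<^sup>2"
      by (intro power_mono) (auto simp: algebra_simps)
    also have "\<dots> = (norm (\<xi> - \<eta>))\<^sup>2 - 2 * t * ((\<xi> - \<eta>) \<bullet> \<zeta>) + t\<^sup>2 * (norm \<zeta>)\<^sup>2"
      unfolding power2_norm_eq_inner
      by (simp add: inner_diff_left[of "\<xi> - \<eta>" "t *\<^sub>R \<zeta>"] inner_diff_right[of _ "\<xi> - \<eta>" "t *\<^sub>R \<zeta>"]
          inner_commute[of \<zeta> \<xi>] inner_commute[of \<zeta> \<eta>] power2_eq_square algebra_simps)
    also have "\<dots> = (norm (\<xi> - \<eta>))\<^sup>2 - ((\<xi> - \<eta>) \<bullet> \<zeta>)\<^sup>2 / (norm \<zeta>)\<^sup>2"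
      using False by (simp add: t_def power2_eq_square field_simps)
    finally have "((\<xi> - \<eta>) \<bullet> \<zeta>)\<^sup>2 / (norm \<zeta>)\<^sup>2 \<le> 0" by simp
    then show ?thesis using False by (simp add: divide_le_0_iff)
  qed simp
  have "cinner (\<xi> - \<eta>) \<zeta> = 0" if "\<zeta> \<in> S" for \<zeta>
  proof -
    have "Re (cinner (\<xi> - \<eta>) \<zeta>) = 0" using 0[OF that] by (simp add: Re_cinner)
    moreover have "Re (cinner (\<xi> - \<eta>) (scaleC \<i> \<zeta>)) = 0"
      using 0[OF S(5)[OF that]] by (simp only: Re_cinner)
    ultimately show ?thesis by (simp add: complex_eq_iff)
  qed
  then show ?thesis using \<eta> by blast
qed

lemma orth_proj_eqI:
  assumes S: "closed_csubspace S" and "\<eta> \<in> S" and "\<And>\<zeta>. \<zeta> \<in> S \<Longrightarrow> cinner (\<xi> - \<eta>) \<zeta> = 0"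
  shows "orth_proj S \<xi> = \<eta>"
  unfolding orth_proj_def
proof (rule the_equality)
  fix \<eta>' assume \<eta>': "\<eta>' \<in> S \<and> (\<forall>\<zeta>\<in>S. cinner (\<xi> - \<eta>') \<zeta> = 0)"
  then have m: "\<eta>' - \<eta> \<in> S" using closed_csubspaceD[OF S] assms by auto
  have "cinner (\<eta>' - \<eta>) (\<eta>' - \<eta>) = cinner (\<xi> - \<eta>) (\<eta>' - \<eta>) - cinner (\<xi> - \<eta>') (\<eta>' - \<eta>)"
    by (simp flip: cinner_diff_left)
  also have "\<dots> = 0" using m \<eta>' assms by simp
  finally show "\<eta>' = \<eta>" by (simp add: cinner_same)
qed (use assms in auto)

lemma orth_proj_in_orth:
  assumes "closed_csubspace S"
  shows "orth_proj S \<xi> \<in> S \<and> (\<forall>\<zeta>\<in>S. cinner (\<xi> - orth_proj S \<xi>) \<zeta> = 0)"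
proof -
  obtain \<eta> where \<eta>: "\<eta> \<in> S" "\<And>\<zeta>. \<zeta> \<in> S \<Longrightarrow> cinner (\<xi> - \<eta>) \<zeta> = 0"
    using orth_proj_exists[OF assms] by blast
  have "orth_proj S \<xi> = \<eta>" by (rule orth_proj_eqI[OF assms \<eta>])
  with \<eta> show ?thesis by simp
qed

lemma orth_proj_in: "closed_csubspace S \<Longrightarrow> orth_proj S \<xi> \<in> S"
  using orth_proj_in_orth by blast

lemma orth_proj_orth: "closed_csubspace S \<Longrightarrow> \<zeta> \<in> S \<Longrightarrow> cinner (\<xi> - orth_proj S \<xi>) \<zeta> = 0"
  using orth_proj_in_orth by blast

lemma cinner_orth_proj:
  assumes "closed_csubspace S" "\<zeta> \<in> S"
  shows "cinner (orth_proj S \<xi>) \<zeta> = cinner \<xi> \<zeta>"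
  using orth_proj_orth[OF assms, of \<xi>] by (simp add: cinner_diff_left)

lemma orth_proj_id [simp]:
  assumes "closed_csubspace S" "\<xi> \<in> S"
  shows "orth_proj S \<xi> = \<xi>"
  by (rule orth_proj_eqI[OF assms]) simp

lemma orth_proj_eq_0:
  assumes S: "closed_csubspace S" and "\<And>\<zeta>. \<zeta> \<in> S \<Longrightarrow> cinner \<xi> \<zeta> = 0"
  shows "orth_proj S \<xi> = 0"
  by (rule orth_proj_eqI[OF S closed_csubspaceD(2)[OF S]]) (simp add: assms(2))

lemma orth_proj_add:
  assumes S: "closed_csubspace S"
  shows "orth_proj S (f + g) = orth_proj S f + orth_proj S g"
proof (rule orth_proj_eqI[OF S])
  show "orth_proj S f + orth_proj S g \<in> S"
    by (rule closed_csubspaceD(3)[OF S]; rule orth_proj_in[OF S])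
qed (simp add: cinner_add_left cinner_diff_left cinner_orth_proj[OF S])

lemma orth_proj_scaleC:
  assumes S: "closed_csubspace S"
  shows "orth_proj S (scaleC c f) = scaleC c (orth_proj S f)"
proof (rule orth_proj_eqI[OF S])
  show "scaleC c (orth_proj S f) \<in> S"
    by (rule closed_csubspaceD(5)[OF S]; rule orth_proj_in[OF S])
qed (simp add: cinner_add_left cinner_diff_left cinner_orth_proj[OF S])

lemma orth_proj_diff:
  assumes S: "closed_csubspace S"
  shows "orth_proj S (f - g) = orth_proj S f - orth_proj S g"
proof (rule orth_proj_eqI[OF S])
  show "orth_proj S f - orth_proj S g \<in> S"
    by (rule closed_csubspaceD(4)[OF S]; rule orth_proj_in[OF S])
qed (simp add: cinner_add_left cinner_diff_left cinner_orth_proj[OF S])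

lemma orth_proj_zero [simp]: "closed_csubspace S \<Longrightarrow> orth_proj S 0 = 0"
  by (rule orth_proj_eq_0) simp_all

lemma norm_orth_proj_le:
  assumes S: "closed_csubspace S"
  shows "norm (orth_proj S f) \<le> norm f"
proof -
  have "cinner f (orth_proj S f) = of_real ((norm (orth_proj S f))\<^sup>2)"
    using cinner_orth_proj[OF S orth_proj_in[OF S], of f f] by (simp add: cinner_same)
  then have "(norm (orth_proj S f))\<^sup>2 \<le> norm f * norm (orth_proj S f)"
    using norm_cinner_le[of f "orth_proj S f"] by (metis abs_power2 norm_of_real real_norm_def)
  then show ?thesis
    by (cases "norm (orth_proj S f) = 0") (simp_all add: power2_eq_square)
qed

lemma bounded_linear_orth_proj:
  assumes S: "closed_csubspace S"
  shows "bounded_linear (orth_proj S)"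
proof (rule bounded_linear_intro[where K = 1])
  show "orth_proj S (r *\<^sub>R f) = r *\<^sub>R orth_proj S f" for r f
    using orth_proj_scaleC[OF S, of "of_real r" f] by simp
qed (simp_all add: orth_proj_add[OF S] norm_orth_proj_le[OF S])

section \<open>Words, components and tensors\<close>

lemma Rep_basis_vec: "Rep_ell2 (basis_vec w) v = (if v = w then 1 else 0)"
  by (simp add: basis_vec_def eval_basis.rep_eq lookup_single when_def)

lemma cinner_basis_vec: "cinner f (basis_vec w) = Rep_ell2 f w"
proof -
  have "cinner f (basis_vec w) = (\<Sum>\<^sub>\<infinity>x\<in>{w}. Rep_ell2 f x * cnj (Rep_ell2 (basis_vec w) x))"
    unfolding cinner_def by (rule infsum_cong_neutral) (auto simp: Rep_basis_vec)
  then show ?thesis by (simp add: Rep_basis_vec)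
qed

lemma norm_basis_vec [simp]: "norm (basis_vec w) = 1"
proof -
  have "complex_of_real ((norm (basis_vec w))\<^sup>2) = of_real 1"
    by (simp only: cinner_same[symmetric] cinner_basis_vec Rep_basis_vec) simp
  then have "(norm (basis_vec w))\<^sup>2 = 1" by (simp only: of_real_eq_iff)
  then show ?thesis by (simp add: power2_eq_1_iff) (metis norm_ge_zero not_one_le_zero neg_0_le_iff_le)
qed

lemma tensor_power_zeroD: "\<xi> \<in> tensor_power n \<Longrightarrow> length w \<noteq> n \<Longrightarrow> Rep_ell2 \<xi> w = 0"
  by (auto simp: tensor_power_def)

lemma basis_vec_in [simp]: "basis_vec w \<in> tensor_power n \<longleftrightarrow> length w = n"
  by (auto simp: tensor_power_def Rep_basis_vec)

lemma subspace_tensor_power: "ell2.subspace (tensor_power n :: 'a list ell2 set)"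
proof (rule ell2.subspaceI)
  show "(0 :: 'a list ell2) \<in> tensor_power n" by (simp add: tensor_power_def ell2_rep)
  fix x y :: "'a list ell2" and c assume x: "x \<in> tensor_power n"
  show "scaleC c x \<in> tensor_power n" using x by (auto simp: tensor_power_def ell2_rep)
  assume y: "y \<in> tensor_power n"
  show "x + y \<in> tensor_power n"
    using tensor_power_zeroD[OF x] tensor_power_zeroD[OF y]
    by (force simp: tensor_power_def ell2_rep)
qed

lemma closed_tensor_power: "closed (tensor_power n)"
proof -
  have "tensor_power n = (\<Inter>w\<in>{w. length w \<noteq> n}. {\<xi>. Rep_ell2 \<xi> w = 0})"
    by (auto simp: tensor_power_def)
  also have "closed \<dots>"
    by (intro closed_INT ballI closed_Collect_eq continuous_intros
        linear_continuous_on bounded_linear_Rep_ell2)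
  finally show ?thesis .
qed

lemma closed_csubspace_tensor_power: "closed_csubspace (tensor_power n)"
  by (simp add: closed_csubspace_def closed_tensor_power subspace_tensor_power)

lemmas tensor_power_closure = closed_csubspaceD[OF closed_csubspace_tensor_power]

subsection \<open>Homogeneous components\<close>

lemma component_in [simp]: "component n \<xi> \<in> tensor_power n"
  by (auto simp: tensor_power_def component.rep_eq)

lemma component_same: "\<xi> \<in> tensor_power n \<Longrightarrow> component m \<xi> = (if m = n then \<xi> else 0)"
  by (intro ell2_eqI) (auto simp: component.rep_eq ell2_rep tensor_power_zeroD)

lemma component_add: "component n (f + g) = component n f + component n g"
  by (intro ell2_eqI) (auto simp: component.rep_eq ell2_rep)
lemma component_diff: "component n (f - g) = component n f - component n g"
  by (intro ell2_eqI) (auto simp: component.rep_eq ell2_rep)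
lemma component_scaleC: "component n (scaleC c f) = scaleC c (component n f)"
  by (intro ell2_eqI) (auto simp: component.rep_eq ell2_rep)
lemma component_zero [simp]: "component n 0 = 0"
  by (intro ell2_eqI) (auto simp: component.rep_eq ell2_rep)
lemma norm_ell2_mono:
  assumes "\<And>w. cmod (Rep_ell2 f w) \<le> cmod (Rep_ell2 g w)"
  shows "norm f \<le> norm g"
proof (rule power2_le_imp_le)
  show "(norm f)\<^sup>2 \<le> (norm g)\<^sup>2"
    unfolding norm_ell2_sq using assms
    by (intro infsum_mono summable_ell2 power_mono) auto
qed simp

lemma norm_component_le: "norm (component n f) \<le> norm f"
  by (rule norm_ell2_mono) (simp add: component.rep_eq)

lemma bounded_linear_component: "bounded_linear (component n)"
proof (rule bounded_linear_intro[where K = 1])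
  show "component n (r *\<^sub>R f) = r *\<^sub>R component n f" for r f
    using component_scaleC[of n "of_real r" f] by simp
qed (simp_all add: component_add norm_component_le)

lemma component_eqI: "(\<And>n. component n f = component n g) \<Longrightarrow> f = g"
proof (rule ell2_eqI)
  fix w assume "\<And>n. component n f = component n g"
  then have "Rep_ell2 (component (length w) f) w = Rep_ell2 (component (length w) g) w" by simp
  then show "Rep_ell2 f w = Rep_ell2 g w" by (simp add: component.rep_eq)
qed

text \<open>
  Every square-summable family is almost carried by a finite set of words, hence by the words of
  bounded length. This makes operators on the Fock space determined by their values on fibres.
\<close>

lemma component_sums: "(\<lambda>n. component n \<xi>) sums \<xi>"
  unfolding sums_def
proof (rule LIMSEQ_I)
  fix r :: real assume r: "r > 0"
  let ?f = "\<lambda>w. (cmod (Rep_ell2 \<xi> w))\<^sup>2"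
  define S where "S = infsum ?f UNIV"
  have "(sum ?f \<longlongrightarrow> S) (finite_subsets_at_top UNIV)"
    using has_sum_infsum[OF summable_ell2] by (simp add: has_sum_def S_def)
  then have "\<forall>\<^sub>F F in finite_subsets_at_top UNIV. S - r\<^sup>2/2 < sum ?f F"
    by (rule order_tendstoD) (use r in auto)
  then obtain F where F: "finite F" "S - r\<^sup>2/2 < sum ?f F"
    unfolding eventually_finite_subsets_at_top by auto
  obtain N where N: "\<And>w. w \<in> F \<Longrightarrow> length w < N"
    using F(1) finite_nat_set_iff_bounded[of "length ` F"] by auto
  have "norm ((\<Sum>k<n. component k \<xi>) - \<xi>) < r" if n: "n \<ge> N" for n
  proof -
    define t where "t = (\<Sum>k<n. component k \<xi>) - \<xi>"
    have t: "Rep_ell2 t w = (if length w < n then 0 else - Rep_ell2 \<xi> w)" for w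
      by (auto simp: t_def ell2_rep sum_ell2_rep component.rep_eq sum.delta' if_distrib cong: if_cong)
    have "(norm t)\<^sup>2 \<le> S - sum ?f F"
      unfolding norm_ell2_sq
    proof (rule infsum_le_finite_sums[OF summable_ell2])
      fix G :: "'a list set" assume G: "finite G"
      have "(\<Sum>w\<in>G. (cmod (Rep_ell2 t w))\<^sup>2) \<le> sum ?f (G - F)"
      proof -
        have "(\<Sum>w\<in>G. (cmod (Rep_ell2 t w))\<^sup>2) = (\<Sum>w\<in>G - F. (cmod (Rep_ell2 t w))\<^sup>2)"
          using G N n by (intro sum.mono_neutral_right) (force simp: t)+
        also have "\<dots> \<le> sum ?f (G - F)" by (intro sum_mono) (simp add: t)
        finally show ?thesis .
      qed
      also have "sum ?f (G - F) = sum ?f (G \<union> F) - sum ?f F"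
        using sum.union_disjoint[of "G - F" F ?f] G F(1)
        by (simp add: Un_commute Int_commute[of _ F])
      also have "sum ?f (G \<union> F) \<le> S"
        unfolding S_def using G F by (intro finite_sum_le_infsum summable_ell2) auto
      finally show "(\<Sum>w\<in>G. (cmod (Rep_ell2 t w))\<^sup>2) \<le> S - sum ?f F" by simp
    qed
    also have "\<dots> < r\<^sup>2" using F(2) r by (smt (verit) zero_less_power2 field_sum_of_halves)
    finally show ?thesis unfolding t_def using r by (auto intro: power_less_imp_less_base)
  qed
  then show "\<exists>no. \<forall>n\<ge>no. norm ((\<Sum>k<n. component k \<xi>) - \<xi>) < r" by blast
qed

lemma cinner_component_right:
  assumes "\<xi> \<in> tensor_power n"
  shows "cinner \<xi> (component n \<eta>) = cinner \<xi> \<eta>"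
  unfolding cinner_def
  by (intro infsum_cong) (auto simp: component.rep_eq tensor_power_zeroD[OF assms])

lemma cinner_component_left:
  assumes "\<eta> \<in> tensor_power n"
  shows "cinner (component n \<xi>) \<eta> = cinner \<xi> \<eta>"
  using cinner_component_right[OF assms, of \<xi>] by (metis cinner_commute)

lemma cinner_eq_0_components:
  assumes "\<And>n. cinner (component n \<xi>) (component n \<eta>) = 0"
  shows "cinner \<xi> \<eta> = 0"
proof -
  have "(\<lambda>n. cinner (component n \<xi>) \<eta>) sums cinner \<xi> \<eta>"
    by (rule bounded_linear.sums[OF bounded_linear_cinner_left component_sums])
  moreover have "cinner (component n \<xi>) \<eta> = 0" for n
    using assms[of n] by (simp add: cinner_component_right)
  ultimately show ?thesis by (simp add: sums_unique2[OF _ sums_zero])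
qed

lemma finite_words: "finite {w::'a::finite list. length w = n}"
  using finite_lists_length_eq[of "UNIV :: 'a set" n] by simp

lemma tensor_power_expand:
  fixes \<xi> :: "'a::finite list ell2"
  assumes "\<xi> \<in> tensor_power n"
  shows "\<xi> = (\<Sum>w | length w = n. scaleC (Rep_ell2 \<xi> w) (basis_vec w))"
  by (rule ell2_eqI)
    (auto simp: sum_ell2_rep ell2_rep Rep_basis_vec finite_words tensor_power_zeroD[OF assms]
      if_distrib sum.delta' cong: if_cong)

text \<open>On a fibre of the full Fock space a complex-linear map is given by its values on words.\<close>

lemma tensor_power_induct [consumes 1, case_names basis add scale]:
  fixes \<xi> :: "'a::finite list ell2"
  assumes "\<xi> \<in> tensor_power n"
    and basis: "\<And>w. length w = n \<Longrightarrow> P (basis_vec w)"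
    and add: "\<And>f g. f \<in> tensor_power n \<Longrightarrow> g \<in> tensor_power n \<Longrightarrow> P f \<Longrightarrow> P g \<Longrightarrow> P (f + g)"
    and scale: "\<And>c f. f \<in> tensor_power n \<Longrightarrow> P f \<Longrightarrow> P (scaleC c f)"
  shows "P \<xi>"
proof -
  have "P (\<Sum>w\<in>A. scaleC (Rep_ell2 \<xi> w) (basis_vec w)) \<and>
      (\<Sum>w\<in>A. scaleC (Rep_ell2 \<xi> w) (basis_vec w)) \<in> tensor_power n"
    if "finite A" "A \<subseteq> {w. length w = n}" for A
    using that
  proof (induction A)
    case empty
    obtain w :: "'a list" where "length w = n" using Ex_list_of_length by blast
    then show ?case using scale[OF _ basis, of w 0] tensor_power_closure(2) by simp
  next
    case (insert u A)
    let ?u = "scaleC (Rep_ell2 \<xi> u) (basis_vec u)"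
    have u: "?u \<in> tensor_power n" "P ?u"
      using insert.prems by (auto intro!: tensor_power_closure scale basis)
    show ?case
      using insert u by (auto intro!: add tensor_power_closure)
  qed
  from this[OF finite_words subset_refl] tensor_power_expand[OF assms(1)] show ?thesis
    by metis
qed

subsection \<open>Tensor products\<close>

lemma tensor_add_left: "tensor m (f + g) h = tensor m f h + tensor m g h"
  by (intro ell2_eqI) (auto simp: tensor.rep_eq ell2_rep algebra_simps)
lemma tensor_add_right: "tensor m h (f + g) = tensor m h f + tensor m h g"
  by (intro ell2_eqI) (auto simp: tensor.rep_eq ell2_rep algebra_simps)
lemma tensor_diff_left: "tensor m (f - g) h = tensor m f h - tensor m g h"
  by (intro ell2_eqI) (auto simp: tensor.rep_eq ell2_rep algebra_simps)
lemma tensor_diff_right: "tensor m h (f - g) = tensor m h f - tensor m h g"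
  by (intro ell2_eqI) (auto simp: tensor.rep_eq ell2_rep algebra_simps)
lemma tensor_scaleC_left: "tensor m (scaleC c f) h = scaleC c (tensor m f h)"
  by (intro ell2_eqI) (auto simp: tensor.rep_eq ell2_rep algebra_simps)
lemma tensor_scaleC_right: "tensor m h (scaleC c f) = scaleC c (tensor m h f)"
  by (intro ell2_eqI) (auto simp: tensor.rep_eq ell2_rep algebra_simps)
lemma tensor_zero_left [simp]: "tensor m 0 h = 0"
  by (intro ell2_eqI) (auto simp: tensor.rep_eq ell2_rep)
lemma tensor_zero_right [simp]: "tensor m h 0 = 0"
  by (intro ell2_eqI) (auto simp: tensor.rep_eq ell2_rep)

lemma tensor_assoc: "tensor m \<xi> (tensor n \<eta> \<zeta>) = tensor (m + n) (tensor m \<xi> \<eta>) \<zeta>"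
  by (intro ell2_eqI) (simp add: tensor.rep_eq min_def take_drop add.commute)

lemma tensor_basis_vec: "length u = m \<Longrightarrow> tensor m (basis_vec u) (basis_vec v) = basis_vec (u @ v)"
  by (intro ell2_eqI)
    (auto simp: tensor.rep_eq Rep_basis_vec append_eq_conv_conj eq_commute[of _ "_ @ _"])

lemma tensor_in:
  assumes "\<xi> \<in> tensor_power m" "\<eta> \<in> tensor_power n"
  shows "tensor m \<xi> \<eta> \<in> tensor_power (m + n)"
  unfolding tensor_power_def
proof (intro CollectI allI impI)
  fix w assume "Rep_ell2 (tensor m \<xi> \<eta>) w \<noteq> 0"
  then have "length (take m w) = m" "length (drop m w) = n"
    using assms by (auto simp: tensor.rep_eq tensor_power_def)
  then show "length w = m + n" by auto
qed

lemma component_tensor: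
  assumes "\<xi> \<in> tensor_power m"
  shows "component k (tensor m \<xi> \<eta>) = (if k < m then 0 else tensor m \<xi> (component (k - m) \<eta>))"
proof (rule ell2_eqI)
  fix w :: "'a list"
  show "Rep_ell2 (component k (tensor m \<xi> \<eta>)) w =
      Rep_ell2 (if k < m then 0 else tensor m \<xi> (component (k - m) \<eta>)) w"
    using tensor_power_zeroD[OF assms, of "take m w"]
    by (cases "length w < m") (auto simp: component.rep_eq tensor.rep_eq ell2_rep)
qed

abbreviation vacuum :: "'a list ell2" where "vacuum \<equiv> basis_vec []"

lemma tensor_vacuum_left [simp]: "tensor 0 vacuum \<xi> = \<xi>"
  by (intro ell2_eqI) (simp add: tensor.rep_eq Rep_basis_vec)

lemma tensor_vacuum_right: "\<xi> \<in> tensor_power m \<Longrightarrow> tensor m \<xi> vacuum = \<xi>"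
proof (rule ell2_eqI)
  fix w :: "'a list" assume \<xi>: "\<xi> \<in> tensor_power m"
  show "Rep_ell2 (tensor m \<xi> vacuum) w = Rep_ell2 \<xi> w"
    using tensor_power_zeroD[OF \<xi>, of w]
    by (cases "length w \<le> m") (auto simp: tensor.rep_eq Rep_basis_vec)
qed

text \<open>
  A word of length at least \<open>m\<close> splits uniquely into a prefix of length \<open>m\<close> and a suffix, so the sum
  over words factors; shorter words contribute nothing because \<open>\<xi>\<close> has degree \<open>m\<close>.
\<close>

lemma cinner_tensor:
  assumes \<xi>: "\<xi> \<in> tensor_power m"
  shows "cinner (tensor m \<xi> \<eta>) (tensor m \<xi>' \<eta>') = cinner \<xi> \<xi>' * cinner \<eta> \<eta>'"
proof -
  let ?W = "{u::'a list. length u = m}"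
  let ?f = "\<lambda>w. Rep_ell2 (tensor m \<xi> \<eta>) w * cnj (Rep_ell2 (tensor m \<xi>' \<eta>') w)"
  let ?a = "\<lambda>(u, v::'a list). u @ v"
  have inj: "inj_on ?a (?W \<times> UNIV)" by (auto simp: inj_on_def)
  have fa: "?f (u @ v) = (Rep_ell2 \<xi> u * cnj (Rep_ell2 \<xi>' u)) * (Rep_ell2 \<eta> v * cnj (Rep_ell2 \<eta>' v))"
    if "length u = m" for u v using that by (simp add: tensor.rep_eq)
  have "?f summable_on ?a ` (?W \<times> UNIV)"
    by (rule summable_on_subset_banach[OF summable_cinner]) simp
  then have summ: "(\<lambda>(u, v). ?f (u @ v)) summable_on ?W \<times> UNIV"
    by (subst (asm) summable_on_reindex[OF inj]) (simp add: o_def case_prod_unfold)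
  have "cinner (tensor m \<xi> \<eta>) (tensor m \<xi>' \<eta>') = infsum ?f (?a ` (?W \<times> UNIV))"
    unfolding cinner_def
  proof (rule infsum_cong_neutral)
    fix w assume w: "w \<in> UNIV - ?a ` (?W \<times> UNIV)"
    have "length (take m w) \<noteq> m"
    proof
      assume "length (take m w) = m"
      then have "w \<in> ?a ` (?W \<times> UNIV)"
        by (intro image_eqI[of _ _ "(take m w, drop m w)"]) auto
      with w show False by simp
    qed
    then show "?f w = 0" using tensor_power_zeroD[OF \<xi>] by (simp add: tensor.rep_eq)
  qed auto
  also have "\<dots> = infsum (\<lambda>(u, v). ?f (u @ v)) (?W \<times> UNIV)"
    by (subst infsum_reindex[OF inj]) (simp add: o_def case_prod_unfold)
  also have "\<dots> = infsum (\<lambda>u. infsum (\<lambda>v. ?f (u @ v)) UNIV) ?W"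
    by (rule infsum_Sigma'_banach[OF summ, symmetric])
  also have "\<dots> = infsum (\<lambda>u. (Rep_ell2 \<xi> u * cnj (Rep_ell2 \<xi>' u)) * cinner \<eta> \<eta>') ?W"
    unfolding cinner_def by (intro infsum_cong) (simp add: fa infsum_cmult_right')
  also have "\<dots> = infsum (\<lambda>u. Rep_ell2 \<xi> u * cnj (Rep_ell2 \<xi>' u)) ?W * cinner \<eta> \<eta>'"
    by (rule infsum_cmult_left')
  also have "infsum (\<lambda>u. Rep_ell2 \<xi> u * cnj (Rep_ell2 \<xi>' u)) ?W = cinner \<xi> \<xi>'"
    unfolding cinner_def
    by (rule infsum_cong_neutral) (auto simp: tensor_power_zeroD[OF \<xi>])
  finally show ?thesis .
qed

lemma norm_tensor:
  assumes "\<xi> \<in> tensor_power m"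
  shows "norm (tensor m \<xi> \<eta>) = norm \<xi> * norm \<eta>"
proof -
  have "complex_of_real ((norm (tensor m \<xi> \<eta>))\<^sup>2) = of_real ((norm \<xi> * norm \<eta>)\<^sup>2)"
    using cinner_tensor[OF assms, of \<eta> \<xi> \<eta>] by (simp add: cinner_same power_mult_distrib)
  then have "(norm (tensor m \<xi> \<eta>))\<^sup>2 = (norm \<xi> * norm \<eta>)\<^sup>2" by (simp only: of_real_eq_iff)
  then show ?thesis by (simp add: power2_eq_iff_nonneg)
qed

lemma bounded_linear_tensor:
  assumes "\<xi> \<in> tensor_power m"
  shows "bounded_linear (tensor m \<xi>)"
proof (rule bounded_linear_intro[where K = "norm \<xi>"])
  show "tensor m \<xi> (r *\<^sub>R f) = r *\<^sub>R tensor m \<xi> f" for r f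
    using tensor_scaleC_right[of m \<xi> "of_real r" f] by simp
qed (simp_all add: tensor_add_right norm_tensor[OF assms] mult.commute)

section \<open>Subproduct systems and their creation operators\<close>

definition fock_proj :: "'a fibres \<Rightarrow> 'a list ell2 \<Rightarrow>\<^sub>L 'a list ell2" where
  "fock_proj X = Blinfun (orth_proj (fock X))"

text \<open>
  The operator \<open>\<zeta> \<mapsto> P (\<xi> \<otimes> \<zeta>)\<close> on the Fock space of \<open>X\<close>, with \<open>P\<close> the projection onto it. It is
  defined on the whole of \<open>'a list ell2\<close>, where for \<open>\<xi>\<close> of degree \<open>m\<close> it automatically annihilates the
  complement of \<open>fock X\<close>.
\<close>

definition creation :: "'a fibres \<Rightarrow> nat \<Rightarrow> 'a list ell2 \<Rightarrow> 'a list ell2 \<Rightarrow>\<^sub>L 'a list ell2" where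
  "creation X m \<xi> = fock_proj X o\<^sub>L Blinfun (tensor m \<xi>)"

text \<open>
  The two orthogonality axioms say that the fibres satisfy \<open>X (m + n) \<subseteq> X m \<otimes> X n\<close>, phrased through
  orthogonal complements: the relations of degree \<open>m + n\<close> contain the relations of degree \<open>m\<close> and
  of degree \<open>n\<close>, multiplied by arbitrary vectors.
\<close>

locale subproduct =
  fixes X :: "'a::finite fibres"
  assumes closed_fibre: "closed_csubspace (X n)"
    and fibre_subset: "X n \<subseteq> tensor_power n"
    and vacuum_in: "vacuum \<in> X 0"
    and orth_left: "\<xi> \<in> tensor_power m \<Longrightarrow> \<eta> \<in> tensor_power n \<Longrightarrow> \<zeta> \<in> X (m + n) \<Longrightarrow>
      (\<And>\<theta>. \<theta> \<in> X m \<Longrightarrow> cinner \<xi> \<theta> = 0) \<Longrightarrow> cinner (tensor m \<xi> \<eta>) \<zeta> = 0"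
    and orth_right: "\<xi> \<in> tensor_power m \<Longrightarrow> \<eta> \<in> tensor_power n \<Longrightarrow> \<zeta> \<in> X (m + n) \<Longrightarrow>
      (\<And>\<theta>. \<theta> \<in> X n \<Longrightarrow> cinner \<eta> \<theta> = 0) \<Longrightarrow> cinner (tensor m \<xi> \<eta>) \<zeta> = 0"
begin

abbreviation p :: "nat \<Rightarrow> 'a list ell2 \<Rightarrow> 'a list ell2" where "p n \<equiv> orth_proj (X n)"
abbreviation P :: "'a list ell2 \<Rightarrow> 'a list ell2" where "P \<equiv> orth_proj (fock X)"
abbreviation L :: "nat \<Rightarrow> 'a list ell2 \<Rightarrow> 'a list ell2 \<Rightarrow>\<^sub>L 'a list ell2" where "L \<equiv> creation X"

lemmas fibre_closure = closed_csubspaceD[OF closed_fibre]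
lemmas p_in = orth_proj_in[OF closed_fibre]
lemmas p_add = orth_proj_add[OF closed_fibre]
lemmas p_scaleC = orth_proj_scaleC[OF closed_fibre]
lemmas p_id = orth_proj_id[OF closed_fibre]
lemmas cinner_p = cinner_orth_proj[OF closed_fibre]
lemmas norm_p_le = norm_orth_proj_le[OF closed_fibre]
lemmas p_zero = orth_proj_zero[OF closed_fibre]

lemma fibre_tp: "\<xi> \<in> X n \<Longrightarrow> \<xi> \<in> tensor_power n"
  using fibre_subset by blast

lemma p_tp: "p n \<xi> \<in> tensor_power n"
  by (rule fibre_tp[OF p_in])

lemma closed_csubspace_fock: "closed_csubspace (fock X)"
  unfolding closed_csubspace_def
proof
  have "fock X = (\<Inter>n. component n -` X n)" by (auto simp: fock_def)
  also have "closed \<dots>"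
    by (intro closed_INT ballI continuous_closed_vimage fibre_closure(1)
        linear_continuous_at bounded_linear_component)
  finally show "closed (fock X)" .
  show "ell2.subspace (fock X)"
    by (rule ell2.subspaceI)
      (auto simp: fock_def component_add component_scaleC intro: fibre_closure)
qed

lemmas P_in = orth_proj_in[OF closed_csubspace_fock]
lemmas P_add = orth_proj_add[OF closed_csubspace_fock]
lemmas P_diff = orth_proj_diff[OF closed_csubspace_fock]
lemmas P_id = orth_proj_id[OF closed_csubspace_fock]

lemma fibre_fock: "\<xi> \<in> X n \<Longrightarrow> \<xi> \<in> fock X"
  by (simp add: fock_def component_same[OF fibre_tp] fibre_closure(2))

lemma component_P: "component n (P \<xi>) = p n (component n \<xi>)"
proof (rule orth_proj_eqI[OF closed_fibre, symmetric])
  show "component n (P \<xi>) \<in> X n" using P_in[of \<xi>] by (simp add: fock_def)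
  fix \<zeta> assume \<zeta>: "\<zeta> \<in> X n"
  have "cinner (component n \<xi> - component n (P \<xi>)) \<zeta> = cinner (\<xi> - P \<xi>) \<zeta>"
    by (simp add: component_diff[symmetric] cinner_component_left[OF fibre_tp[OF \<zeta>]])
  also have "\<dots> = 0" by (rule orth_proj_orth[OF closed_csubspace_fock fibre_fock[OF \<zeta>]])
  finally show "cinner (component n \<xi> - component n (P \<xi>)) \<zeta> = 0" .
qed

lemma P_homogeneous: "\<xi> \<in> tensor_power n \<Longrightarrow> P \<xi> = p n \<xi>"
  by (rule component_eqI) (auto simp: component_P component_same component_same[OF p_tp] p_zero)

lemma fock_proj_apply [simp]: "blinfun_apply (fock_proj X) \<xi> = P \<xi>"
  unfolding fock_proj_def
  by (simp add: bounded_linear_Blinfun_apply bounded_linear_orth_proj closed_csubspace_fock)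

lemma P_tensor_eq_0:
  assumes \<xi>: "\<xi> \<in> tensor_power m"
    and orth: "\<And>n \<zeta>. \<zeta> \<in> X (m + n) \<Longrightarrow> cinner (tensor m \<xi> (component n \<eta>)) \<zeta> = 0"
  shows "P (tensor m \<xi> \<eta>) = 0"
proof (rule orth_proj_eq_0[OF closed_csubspace_fock], rule cinner_eq_0_components)
  fix \<theta> k assume \<theta>: "\<theta> \<in> fock X"
  show "cinner (component k (tensor m \<xi> \<eta>)) (component k \<theta>) = 0"
  proof (cases "k < m")
    case False
    then have "component k \<theta> \<in> X (m + (k - m))" using \<theta> by (simp add: fock_def)
    from orth[OF this] False show ?thesis by (simp add: component_tensor[OF \<xi>])
  qed (simp add: component_tensor[OF \<xi>])
qed

text \<open>
  Together with \<open>P_tensor_p\<close> this is the associativity of the multiplication \<open>p (m + n) (\<xi> \<otimes> \<eta>)\<close>: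
  inner projections can be dropped, since what they remove stays orthogonal to the Fock space
  after tensoring.
\<close>

lemma P_tensor_P:
  assumes \<xi>: "\<xi> \<in> tensor_power m"
  shows "P (tensor m \<xi> (P \<zeta>)) = P (tensor m \<xi> \<zeta>)"
proof -
  have "P (tensor m \<xi> (\<zeta> - P \<zeta>)) = 0"
  proof (rule P_tensor_eq_0[OF \<xi>], rule orth_right[OF \<xi> component_in])
    show "cinner (component n (\<zeta> - P \<zeta>)) \<theta> = 0" if "\<theta> \<in> X n" for n \<theta>
      using orth_proj_orth[OF closed_csubspace_fock fibre_fock[OF that]]
      by (simp add: cinner_component_left[OF fibre_tp[OF that]])
  qed
  then show ?thesis by (simp add: tensor_diff_right P_diff)
qed

lemma P_tensor_p:
  assumes \<xi>: "\<xi> \<in> tensor_power m"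
  shows "P (tensor m (p m \<xi>) \<zeta>) = P (tensor m \<xi> \<zeta>)"
proof -
  have d: "\<xi> - p m \<xi> \<in> tensor_power m" by (intro tensor_power_closure \<xi> p_tp)
  have "P (tensor m (\<xi> - p m \<xi>) \<zeta>) = 0"
    by (rule P_tensor_eq_0[OF d], rule orth_left[OF d component_in])
      (auto intro: orth_proj_orth[OF closed_fibre])
  then show ?thesis by (simp add: tensor_diff_left P_diff)
qed

lemma p_tensor_p_right:
  assumes "\<xi> \<in> tensor_power m" "\<eta> \<in> tensor_power n"
  shows "p (m + n) (tensor m \<xi> (p n \<eta>)) = p (m + n) (tensor m \<xi> \<eta>)"
  using P_tensor_P[OF assms(1), of \<eta>]
  by (simp add: P_homogeneous[OF assms(2)] P_homogeneous[OF tensor_in[OF assms]]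
      P_homogeneous[OF tensor_in[OF assms(1) p_tp]])

lemma creation_apply: "\<xi> \<in> tensor_power m \<Longrightarrow> blinfun_apply (L m \<xi>) \<zeta> = P (tensor m \<xi> \<zeta>)"
  by (simp add: creation_def bounded_linear_Blinfun_apply bounded_linear_tensor)

lemma creation_mult:
  assumes "\<xi> \<in> tensor_power m" "\<eta> \<in> tensor_power n"
  shows "L m \<xi> o\<^sub>L L n \<eta> = L (m + n) (tensor m \<xi> \<eta>)"
  by (rule blinfun_eqI)
    (simp add: creation_apply assms tensor_in P_tensor_P tensor_assoc)

lemma creation_p: "\<xi> \<in> tensor_power m \<Longrightarrow> L m (p m \<xi>) = L m \<xi>"
  by (rule blinfun_eqI) (simp add: creation_apply p_tp P_tensor_p)

lemma creation_add:
  "\<xi> \<in> tensor_power m \<Longrightarrow> \<eta> \<in> tensor_power m \<Longrightarrow> L m (\<xi> + \<eta>) = L m \<xi> + L m \<eta>"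
  by (rule blinfun_eqI)
    (simp add: creation_apply tensor_power_closure plus_blinfun.rep_eq tensor_add_left P_add)

lemma creation_zero: "L m 0 = 0"
  by (rule blinfun_eqI)
    (simp add: creation_apply tensor_power_closure orth_proj_zero[OF closed_csubspace_fock])

lemma creation_scaleC:
  "\<xi> \<in> tensor_power m \<Longrightarrow> L m (scaleC c \<xi>) = scaleC_op c o\<^sub>L L m \<xi>"
  by (rule blinfun_eqI)
    (simp add: creation_apply tensor_power_closure tensor_scaleC_left
      orth_proj_scaleC[OF closed_csubspace_fock])

lemma creation_vacuum: "\<xi> \<in> tensor_power m \<Longrightarrow> blinfun_apply (L m \<xi>) vacuum = p m \<xi>"
  by (simp add: creation_apply tensor_vacuum_right P_homogeneous)

lemma norm_creation_le: "\<xi> \<in> tensor_power m \<Longrightarrow> norm (L m \<xi>) \<le> norm \<xi>"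
proof (rule norm_blinfun_bound)
  fix \<zeta> assume \<xi>: "\<xi> \<in> tensor_power m"
  have "norm (P (tensor m \<xi> \<zeta>)) \<le> norm (tensor m \<xi> \<zeta>)"
    by (rule norm_orth_proj_le[OF closed_csubspace_fock])
  then show "norm (blinfun_apply (L m \<xi>) \<zeta>) \<le> norm \<xi> * norm \<zeta>"
    by (simp add: creation_apply \<xi> norm_tensor)
qed simp

text \<open>
  The lower bound comes from the vacuum, which the creation operator maps to \<open>\<xi>\<close>.
\<close>

lemma norm_creation: "\<xi> \<in> X m \<Longrightarrow> norm (L m \<xi>) = norm \<xi>"
  using norm_creation_le[OF fibre_tp, of \<xi> m] norm_blinfun[of "L m \<xi>" vacuum]
  by (simp add: creation_vacuum fibre_tp p_id)

subsection \<open>The operators in the definition of the tensor algebra\<close>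

text \<open>
  The description in \<open>fock_op\<close> determines a bounded operator: a vector splits into its projection to
  the Fock space, which is the sum of its components in the fibres, and a part on which the
  operator vanishes.
\<close>

lemma fock_op_eqI:
  assumes "\<And>n \<xi>. \<xi> \<in> X n \<Longrightarrow> blinfun_apply T \<xi> = g n \<xi>"
    and "\<And>\<xi>. (\<And>\<eta>. \<eta> \<in> fock X \<Longrightarrow> cinner \<xi> \<eta> = 0) \<Longrightarrow> blinfun_apply T \<xi> = 0"
  shows "fock_op X g = T"
  unfolding fock_op_def
proof (rule the_equality)
  fix S assume S: "(\<forall>n. \<forall>\<xi>\<in>X n. blinfun_apply S \<xi> = g n \<xi>) \<and>
      (\<forall>\<xi>. (\<forall>\<eta>\<in>fock X. cinner \<xi> \<eta> = 0) \<longrightarrow> blinfun_apply S \<xi> = 0)"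
  show "S = T"
  proof (rule blinfun_eqI)
    fix \<xi>
    have c: "component n (P \<xi>) \<in> X n" for n using P_in[of \<xi>] by (simp add: fock_def)
    have "(\<lambda>n. g n (component n (P \<xi>))) sums blinfun_apply R (P \<xi>)"
      if "\<And>n \<xi>. \<xi> \<in> X n \<Longrightarrow> blinfun_apply R \<xi> = g n \<xi>" for R
      using bounded_linear.sums[OF blinfun.bounded_linear_right component_sums, of R "P \<xi>"]
      by (simp add: that[OF c])
    then have "blinfun_apply S (P \<xi>) = blinfun_apply T (P \<xi>)"
      using S assms(1) by (blast intro: sums_unique2)
    moreover have "blinfun_apply S (\<xi> - P \<xi>) = 0" "blinfun_apply T (\<xi> - P \<xi>) = 0"
      using S assms(2) orth_proj_orth[OF closed_csubspace_fock] by auto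
    ultimately show "blinfun_apply S \<xi> = blinfun_apply T \<xi>"
      by (simp add: blinfun.diff_right)
  qed
qed (use assms in auto)

lemma fock_id_eq: "fock_id X = fock_proj X"
  unfolding fock_id_def
  by (rule fock_op_eqI)
    (auto simp: P_id fibre_fock intro: orth_proj_eq_0[OF closed_csubspace_fock])

lemma shift_eq: "shift X i = L 1 (basis_vec [i])"
  unfolding shift_def
proof (rule fock_op_eqI)
  fix n \<xi> assume \<xi>: "\<xi> \<in> X n"
  have "tensor 1 (basis_vec [i]) \<xi> \<in> tensor_power (1 + n)"
    by (rule tensor_in[OF _ fibre_tp[OF \<xi>]]) simp
  then show "blinfun_apply (L 1 (basis_vec [i])) \<xi> = p (n + 1) (tensor 1 (basis_vec [i]) \<xi>)"
    by (simp add: creation_apply P_homogeneous)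
next
  fix \<xi> assume "\<And>\<eta>. \<eta> \<in> fock X \<Longrightarrow> cinner \<xi> \<eta> = 0"
  then have "P \<xi> = 0" by (rule orth_proj_eq_0[OF closed_csubspace_fock])
  then show "blinfun_apply (L 1 (basis_vec [i])) \<xi> = 0"
    using P_tensor_P[of "basis_vec [i]" 1 \<xi>]
    by (simp add: creation_apply orth_proj_zero[OF closed_csubspace_fock])
qed

lemma fock_proj_eq_creation: "fock_proj X = L 0 vacuum"
  by (rule blinfun_eqI) (simp add: creation_apply)

end

subsection \<open>The subproduct system of an ideal\<close>

text \<open>
  Multiplication in the free algebra is the tensor product: only the splitting of a word after
  \<open>m\<close> letters contributes, as the left factor is homogeneous of degree \<open>m\<close>.
\<close>

lemma eval_basis_mult:
  assumes "homogeneous m f"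
  shows "eval_basis (f * g) = tensor m (eval_basis f) (eval_basis g)"
proof (rule ell2_eqI)
  fix w :: "'a list"
  let ?r = "\<lambda>l q. Poly_Mapping.lookup g q when w = l + q"
  have inner: "Sum_any (?r (take m w)) = Poly_Mapping.lookup g (drop m w)"
  proof -
    have "Sum_any (?r (take m w)) = sum (?r (take m w)) {drop m w}"
      by (rule Sum_any.expand_superset) (auto simp: when_def plus_list_def, metis append_eq_conv_conj append_take_drop_id)
    then show ?thesis by (simp add: plus_list_def)
  qed
  have "Poly_Mapping.lookup (f * g) w = Sum_any (\<lambda>l. Poly_Mapping.lookup f l * Sum_any (?r l))"
    by (rule lookup_mult)
  also have "\<dots> = (\<Sum>l\<in>{take m w}. Poly_Mapping.lookup f l * Sum_any (?r l))"
  proof (rule Sum_any.expand_superset)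
    show "{l. Poly_Mapping.lookup f l * Sum_any (?r l) \<noteq> 0} \<subseteq> {take m w}"
    proof
      fix l assume "l \<in> {l. Poly_Mapping.lookup f l * Sum_any (?r l) \<noteq> 0}"
      then have l: "Poly_Mapping.lookup f l \<noteq> 0" "Sum_any (?r l) \<noteq> 0" by auto
      then have "length l = m" using assms by (auto simp: homogeneous_def in_keys_iff)
      moreover obtain q where "?r l q \<noteq> 0"
        using l(2) by (rule Sum_any.not_neutral_obtains_not_neutral)
      ultimately show "l \<in> {take m w}" by (auto simp: when_def plus_list_def split: if_splits)
    qed
  qed simp
  also have "\<dots> = Rep_ell2 (tensor m (eval_basis f) (eval_basis g)) w"
    by (simp add: inner tensor.rep_eq eval_basis.rep_eq)
  finally show "Rep_ell2 (eval_basis (f * g)) w = Rep_ell2 (tensor m (eval_basis f) (eval_basis g)) w"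
    by (simp add: eval_basis.rep_eq)
qed

lemma homogeneous_mult:
  assumes "homogeneous m f" "homogeneous n g"
  shows "homogeneous (m + n) (f * g)"
proof -
  have "eval_basis f \<in> tensor_power m" "eval_basis g \<in> tensor_power n"
    using assms by (auto simp: homogeneous_def tensor_power_def eval_basis.rep_eq in_keys_iff)
  from tensor_in[OF this] show ?thesis
    by (simp add: homogeneous_def tensor_power_def in_keys_iff
        flip: eval_basis_mult[OF assms(1)] eval_basis.rep_eq)
qed

lemma homogeneous_exists:
  fixes \<xi> :: "'a::finite list ell2"
  assumes "\<xi> \<in> tensor_power n"
  obtains f where "homogeneous n f" "eval_basis f = \<xi>"
proof -
  have "finite {w. Rep_ell2 \<xi> w \<noteq> 0}"
    by (rule finite_subset[OF _ finite_words[of n]]) (use assms in \<open>auto simp: tensor_power_def\<close>)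
  then have l: "Poly_Mapping.lookup (Abs_poly_mapping (Rep_ell2 \<xi>)) = Rep_ell2 \<xi>"
    by (rule Abs_poly_mapping_inverse[simplified])
  show ?thesis
  proof (rule that[of "Abs_poly_mapping (Rep_ell2 \<xi>)"])
    show "homogeneous n (Abs_poly_mapping (Rep_ell2 \<xi>))"
      using assms by (auto simp: homogeneous_def in_keys_iff l tensor_power_def)
    show "eval_basis (Abs_poly_mapping (Rep_ell2 \<xi>)) = \<xi>"
      by (rule ell2_eqI) (simp add: eval_basis.rep_eq l)
  qed
qed

lemma two_sided_ideal_homogeneous:
  assumes "homogeneous_ideal I"
  shows "two_sided_ideal I"
proof -
  obtain S where "I = two_sided_ideal hull S" using assms by (auto simp: homogeneous_ideal_def)
  moreover have "two_sided_ideal (two_sided_ideal hull S)"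
    by (rule hull_in) (auto simp: two_sided_ideal_def)
  ultimately show ?thesis by simp
qed

text \<open>
  Riesz representation on the finite-dimensional space \<open>tensor_power m\<close>.
\<close>

lemma cinner_functional:
  fixes F :: "'a::finite list ell2 \<Rightarrow> complex"
  assumes add: "\<And>f g. F (f + g) = F f + F g" and scale: "\<And>c f. F (scaleC c f) = c * F f"
  obtains \<theta> where "\<theta> \<in> tensor_power m" "\<And>\<xi>. \<xi> \<in> tensor_power m \<Longrightarrow> F \<xi> = cinner \<xi> \<theta>"
proof
  define \<theta> where "\<theta> = (\<Sum>u | length u = m. scaleC (cnj (F (basis_vec u))) (basis_vec u))"
  show "\<theta> \<in> tensor_power m"
    unfolding \<theta>_def by (intro ell2.subspace_sum subspace_tensor_power tensor_power_closure) auto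
  fix \<xi> :: "'a list ell2" assume "\<xi> \<in> tensor_power m"
  then show "F \<xi> = cinner \<xi> \<theta>"
  proof (induction rule: tensor_power_induct)
    case (basis u)
    then have "Rep_ell2 \<theta> u = cnj (F (basis_vec u))"
      by (simp add: \<theta>_def sum_ell2_rep ell2_rep Rep_basis_vec finite_words if_distrib sum.delta'
          cong: if_cong)
    then show ?case by (metis cinner_basis_vec cinner_commute complex_cnj_cnj)
  qed (simp_all add: add scale cinner_add_left)
qed

text \<open>
  \<open>F\<close> is represented by a vector orthogonal to the relations of degree \<open>m\<close>, that is, by a vector of
  the fibre.
\<close>

lemma functional_eq_0:
  fixes I :: "'a::finite free_algebra set"
  assumes lin: "\<And>f g. F (f + g) = F f + F g" "\<And>c f. F (scaleC c f) = c * F f"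
    and F0: "\<And>f. f \<in> I \<Longrightarrow> homogeneous m f \<Longrightarrow> F (eval_basis f) = 0"
    and \<xi>: "\<xi> \<in> tensor_power m" "\<And>\<theta>. \<theta> \<in> subproduct_system I m \<Longrightarrow> cinner \<xi> \<theta> = 0"
  shows "F \<xi> = 0"
proof -
  obtain \<theta> where \<theta>: "\<theta> \<in> tensor_power m" "\<And>\<xi>. \<xi> \<in> tensor_power m \<Longrightarrow> F \<xi> = cinner \<xi> \<theta>"
    using cinner_functional[OF lin] by metis
  have "cinner \<theta> (eval_basis f) = 0" if f: "f \<in> I" "homogeneous m f" for f
  proof -
    have "eval_basis f \<in> tensor_power m"
      using f(2) by (auto simp: homogeneous_def tensor_power_def eval_basis.rep_eq in_keys_iff)
    then have "cinner (eval_basis f) \<theta> = 0" by (simp add: F0 f flip: \<theta>(2))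
    then show ?thesis by (metis cinner_commute complex_cnj_zero)
  qed
  then have "\<theta> \<in> subproduct_system I m" using \<theta>(1) by (simp add: subproduct_system_def)
  then show ?thesis using \<xi> \<theta>(2) by simp
qed

text \<open>
  For fixed \<open>\<eta>\<close> and \<open>\<zeta>\<close> the functional \<open>\<xi> \<mapsto> \<langle>\<xi> \<otimes> \<eta>, \<zeta>\<rangle>\<close> kills the relations of degree \<open>m\<close>, because
  these stay in the ideal when multiplied by a polynomial with tensor \<open>\<eta>\<close>; the other side is symmetric.
  Properness of the ideal excludes relations of degree \<open>0\<close>, so that the vacuum survives.
\<close>

lemma subproduct_of_ideal:
  fixes I :: "'a::finite free_algebra set"
  assumes "homogeneous_ideal I"
  shows "subproduct (subproduct_system I)"
proof
  let ?X = "subproduct_system I"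
  have ideal: "f \<in> I \<Longrightarrow> g * f \<in> I" "f \<in> I \<Longrightarrow> f * g \<in> I" for f g
    using two_sided_ideal_homogeneous[OF assms] by (auto simp: two_sided_ideal_def)
  show sub: "?X n \<subseteq> tensor_power n" for n
    by (auto simp: subproduct_system_def)
  show "closed_csubspace (?X n)" for n
    unfolding closed_csubspace_def
  proof
    have "?X n = tensor_power n \<inter> (\<Inter>f\<in>{f\<in>I. homogeneous n f}. {\<xi>. cinner \<xi> (eval_basis f) = 0})"
      by (auto simp: subproduct_system_def)
    also have "closed \<dots>"
      by (intro closed_Int closed_INT ballI closed_Collect_eq continuous_intros
        linear_continuous_on bounded_linear_cinner_left closed_tensor_power)
    finally show "closed (?X n)" .
    show "ell2.subspace (?X n)"
      by (rule ell2.subspaceI)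
        (auto simp: subproduct_system_def cinner_add_left intro: tensor_power_closure)
  qed
  show "vacuum \<in> ?X 0"
  proof -
    have one: "Poly_Mapping.single ([] :: 'a list) (1 :: complex) = 1"
      unfolding zero_list_def[symmetric] by (rule single_one)
    have "cinner vacuum (eval_basis f) = 0" if f: "f \<in> I" "homogeneous 0 f" for f
    proof -
      let ?c = "Poly_Mapping.lookup f []"
      have "f = Poly_Mapping.single [] ?c"
      proof (rule poly_mapping_eqI)
        fix w show "Poly_Mapping.lookup f w = Poly_Mapping.lookup (Poly_Mapping.single [] ?c) w"
          using f(2) by (cases "w = []") (auto simp: homogeneous_def lookup_single in_keys_iff)
      qed
      moreover have "?c = 0"
      proof (rule ccontr)
        assume c: "?c \<noteq> 0"
        have "f * Poly_Mapping.single [] (1 / ?c) = 1"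
          by (subst \<open>f = _\<close>) (use c in \<open>simp add: mult_single plus_list_def one\<close>)
        then have "1 \<in> I" using ideal(2)[OF f(1)] by metis
        then have "g \<in> I" for g using ideal(1)[of 1 g] by simp
        then show False using assms by (auto simp: homogeneous_ideal_def)
      qed
      ultimately have "f = 0" by simp
      then have "eval_basis f = 0" by (intro ell2_eqI) (simp add: eval_basis.rep_eq ell2_rep)
      then show ?thesis by simp
    qed
    then show ?thesis by (simp add: subproduct_system_def)
  qed
  fix m n and \<xi> \<eta> \<zeta> :: "'a list ell2"
  assume \<xi>: "\<xi> \<in> tensor_power m" and \<eta>: "\<eta> \<in> tensor_power n" and \<zeta>: "\<zeta> \<in> ?X (m + n)"
  have \<zeta>0: "cinner (eval_basis f) \<zeta> = 0" if "f \<in> I" "homogeneous (m + n) f" for f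
    using \<zeta> that cinner_commute[of "eval_basis f" \<zeta>] by (simp add: subproduct_system_def)
  show "cinner (tensor m \<xi> \<eta>) \<zeta> = 0" if orth: "\<And>\<theta>. \<theta> \<in> ?X m \<Longrightarrow> cinner \<xi> \<theta> = 0"
  proof -
    obtain g where g: "homogeneous n g" "eval_basis g = \<eta>" using homogeneous_exists[OF \<eta>] .
    have "cinner (tensor m (eval_basis f) \<eta>) \<zeta> = 0" if f: "f \<in> I" "homogeneous m f" for f
      using \<zeta>0[OF ideal(2)[OF f(1)] homogeneous_mult[OF f(2) g(1)]]
      by (simp add: eval_basis_mult[OF f(2)] g)
    then show ?thesis
      by (intro functional_eq_0[where F = "\<lambda>\<xi>. cinner (tensor m \<xi> \<eta>) \<zeta>", OF _ _ _ \<xi> orth])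
        (auto simp: tensor_add_left cinner_add_left tensor_scaleC_left)
  qed
  show "cinner (tensor m \<xi> \<eta>) \<zeta> = 0" if orth: "\<And>\<theta>. \<theta> \<in> ?X n \<Longrightarrow> cinner \<eta> \<theta> = 0"
  proof -
    obtain g where g: "homogeneous m g" "eval_basis g = \<xi>" using homogeneous_exists[OF \<xi>] .
    have "cinner (tensor m \<xi> (eval_basis f)) \<zeta> = 0" if f: "f \<in> I" "homogeneous n f" for f
      using \<zeta>0[OF ideal(1)[OF f(1)] homogeneous_mult[OF g(1) f(2)]]
      by (simp add: eval_basis_mult[OF g(1)] g)
    then show ?thesis
      by (intro functional_eq_0[where F = "\<lambda>\<eta>. cinner (tensor m \<xi> \<eta>) \<zeta>", OF _ _ _ \<eta> orth])
        (auto simp: tensor_add_right cinner_add_left tensor_scaleC_right)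
  qed
qed

section \<open>The tensor algebra\<close>

text \<open>
  The linear span of the creation operators, which is the unital algebra generated by the shifts.
  Scalar multiples of creation operators are again creation operators.
\<close>

inductive_set polys :: "'a fibres \<Rightarrow> ('a list ell2 \<Rightarrow>\<^sub>L 'a list ell2) set" for X where
  creation: "\<xi> \<in> X m \<Longrightarrow> creation X m \<xi> \<in> polys X"
| add: "A \<in> polys X \<Longrightarrow> B \<in> polys X \<Longrightarrow> A + B \<in> polys X"

text \<open>
  The \<open>n\<close>-th Fourier coefficient with respect to the gauge action.
\<close>

definition coefficient :: "nat \<Rightarrow> ('a list ell2 \<Rightarrow>\<^sub>L 'a list ell2) \<Rightarrow> 'a list ell2" where
  "coefficient n A = component n (blinfun_apply A vacuum)"

lemma bounded_linear_coeff: "bounded_linear (coefficient n)"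
  unfolding coefficient_def
  by (rule bounded_linear_compose[OF bounded_linear_component blinfun.bounded_linear_left])

lemmas coeff_add = linear_add[OF bounded_linear.linear[OF bounded_linear_coeff]]
lemmas coeff_diff = linear_diff[OF bounded_linear.linear[OF bounded_linear_coeff]]

lemma coeff_zero [simp]: "coefficient n 0 = 0"
  by (simp add: coefficient_def)

lemma coeff_scaleC: "coefficient n (scaleC_op c o\<^sub>L A) = scaleC c (coefficient n A)"
  by (simp add: coefficient_def component_scaleC)

lemma norm_coeff_le: "norm (coefficient n A) \<le> norm A"
  using norm_component_le[of n "blinfun_apply A vacuum"] norm_blinfun[of A vacuum]
  by (simp add: coefficient_def)

lemma scaleC_op_compose_diff: "A + (scaleC_op (-1) o\<^sub>L B) = A - B"
  by (rule blinfun_eqI) (simp add: plus_blinfun.rep_eq minus_blinfun.rep_eq)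

lemma closed_unital_algebra_tensor_algebra: "closed_unital_algebra X (tensor_algebra X)"
  unfolding tensor_algebra_def
  by (rule hull_in) (auto simp: closed_unital_algebra_def)

lemma tensor_algebra_closure:
  shows "closed (tensor_algebra X)" "fock_id X \<in> tensor_algebra X" "shift X i \<in> tensor_algebra X"
    "A \<in> tensor_algebra X \<Longrightarrow> scaleC_op c o\<^sub>L A \<in> tensor_algebra X"
    "A \<in> tensor_algebra X \<Longrightarrow> B \<in> tensor_algebra X \<Longrightarrow> A + B \<in> tensor_algebra X"
    "A \<in> tensor_algebra X \<Longrightarrow> B \<in> tensor_algebra X \<Longrightarrow> A - B \<in> tensor_algebra X"
    "A \<in> tensor_algebra X \<Longrightarrow> B \<in> tensor_algebra X \<Longrightarrow> A o\<^sub>L B \<in> tensor_algebra X"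
  using closed_unital_algebra_tensor_algebra[of X] hull_subset[of "range (shift X)" "closed_unital_algebra X"]
  by (auto simp: closed_unital_algebra_def tensor_algebra_def simp flip: scaleC_op_compose_diff)

context subproduct
begin

lemma fock_proj_mem: "fock_proj X \<in> tensor_algebra X"
  using tensor_algebra_closure(2)[of X] by (simp add: fock_id_eq)

lemma polys_scaleC: "A \<in> polys X \<Longrightarrow> scaleC_op c o\<^sub>L A \<in> polys X"
proof (induction rule: polys.induct)
  case (creation \<xi> m)
  then show ?case
    by (simp add: creation_scaleC[OF fibre_tp, symmetric] polys.creation fibre_closure)
next
  case (add A B)
  have "scaleC_op c o\<^sub>L (A + B) = (scaleC_op c o\<^sub>L A) + (scaleC_op c o\<^sub>L B)"
    by (rule blinfun_eqI) (simp add: plus_blinfun.rep_eq ell2.scale_right_distrib)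
  then show ?case using add by (simp add: polys.add)
qed

lemma creation_in_polys: "\<xi> \<in> tensor_power m \<Longrightarrow> L m \<xi> \<in> polys X"
  by (metis creation_p p_in polys.creation)

lemma polys_mult: "A \<in> polys X \<Longrightarrow> B \<in> polys X \<Longrightarrow> A o\<^sub>L B \<in> polys X"
proof (induction rule: polys.induct)
  case (creation \<xi> m)
  from creation(2) show ?case
  proof (induction rule: polys.induct)
    case (creation \<eta> n)
    then show ?case using \<open>\<xi> \<in> X m\<close>
      by (simp add: creation_mult fibre_tp creation_in_polys tensor_in)
  next
    case (add A B)
    have "L m \<xi> o\<^sub>L (A + B) = (L m \<xi> o\<^sub>L A) + (L m \<xi> o\<^sub>L B)"
      by (rule blinfun_eqI) (simp add: plus_blinfun.rep_eq blinfun.add_right)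
    then show ?case using add by (simp add: polys.add)
  qed
next
  case (add A A')
  have "(A + A') o\<^sub>L B = (A o\<^sub>L B) + (A' o\<^sub>L B)"
    by (rule blinfun_eqI) (simp add: plus_blinfun.rep_eq)
  then show ?case using add by (simp add: polys.add)
qed

lemma creation_mem: "\<xi> \<in> tensor_power m \<Longrightarrow> L m \<xi> \<in> tensor_algebra X"
proof (induction rule: tensor_power_induct)
  case (basis w)
  then show ?case
  proof (induction w arbitrary: m)
    case Nil
    then show ?case
      using fock_proj_mem by (simp add: fock_proj_eq_creation)
  next
    case (Cons i w)
    have "L m (basis_vec (i # w)) = shift X i o\<^sub>L L (length w) (basis_vec w)"
      using Cons.prems by (simp add: shift_eq creation_mult tensor_basis_vec)
    then show ?case using Cons.IH[of "length w"] by (simp add: tensor_algebra_closure)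
  qed
qed (simp_all add: creation_add creation_scaleC tensor_algebra_closure)

lemma polys_subset: "polys X \<subseteq> tensor_algebra X"
proof
  fix A assume "A \<in> polys X"
  then show "A \<in> tensor_algebra X"
    by (induction rule: polys.induct) (simp_all add: creation_mem fibre_tp tensor_algebra_closure)
qed

text \<open>
  Products of creation operators are creation operators of tensors, so the span is an algebra and
  its closure is a closed unital algebra; conversely the creation operator of a word is a product
  of shifts.
\<close>

lemma tensor_algebra_eq_closure: "tensor_algebra X = closure (polys X)"
proof
  show "closure (polys X) \<subseteq> tensor_algebra X"
    by (rule closure_minimal[OF polys_subset tensor_algebra_closure(1)])
  show "tensor_algebra X \<subseteq> closure (polys X)"
    unfolding tensor_algebra_def
  proof (rule hull_minimal)
    show "range (shift X) \<subseteq> closure (polys X)"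
      using closure_subset[of "polys X"] by (auto simp: shift_eq intro!: creation_in_polys)
    show "closed_unital_algebra X (closure (polys X))"
      unfolding closed_unital_algebra_def
    proof (intro conjI ballI allI)
      show "fock_id X \<in> closure (polys X)"
        using closure_subset[of "polys X"]
        by (auto simp: fock_id_eq fock_proj_eq_creation intro!: creation_in_polys)
      fix A assume "A \<in> closure (polys X)"
      then obtain a where a: "\<And>n. a n \<in> polys X" "a \<longlonglongrightarrow> A"
        by (auto simp: closure_sequential)
      show "scaleC_op c o\<^sub>L A \<in> closure (polys X)" for c
        unfolding closure_sequential
        by (intro exI[of _ "\<lambda>n. scaleC_op c o\<^sub>L a n"] conjI allI polys_scaleC a
            bounded_bilinear.tendsto[OF bounded_bilinear_blinfun_compose] tendsto_const)
      fix B assume "B \<in> closure (polys X)"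
      then obtain b where b: "\<And>n. b n \<in> polys X" "b \<longlonglongrightarrow> B"
        by (auto simp: closure_sequential)
      show "A + B \<in> closure (polys X)"
        unfolding closure_sequential
        by (intro exI[of _ "\<lambda>n. a n + b n"] conjI allI polys.add a b tendsto_add)
      show "A o\<^sub>L B \<in> closure (polys X)"
        unfolding closure_sequential
        by (intro exI[of _ "\<lambda>n. a n o\<^sub>L b n"] conjI allI polys_mult a b
            bounded_bilinear.tendsto[OF bounded_bilinear_blinfun_compose])
    qed simp
  qed
qed

lemma tensor_algebra_sequence:
  assumes "A \<in> tensor_algebra X"
  obtains a where "\<And>n. a n \<in> polys X" "a \<longlonglongrightarrow> A"
  using assms by (auto simp: tensor_algebra_eq_closure closure_sequential)

lemma coeff_creation: "\<xi> \<in> tensor_power m \<Longrightarrow> coefficient n (L m \<xi>) = (if n = m then p m \<xi> else 0)"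
  by (simp add: coefficient_def creation_vacuum component_same[OF p_tp])

text \<open>
  Elements of the tensor algebra act by convolution with their coefficients. For creation operators
  this is the definition, and both sides depend linearly and continuously on \<open>A\<close>.
\<close>

lemma component_apply:
  assumes "A \<in> tensor_algebra X"
  shows "component k (blinfun_apply A \<zeta>) =
    (\<Sum>i\<le>k. p k (tensor i (coefficient i A) (component (k - i) \<zeta>)))"
proof -
  let ?r = "\<lambda>A. \<Sum>i\<le>k. p k (tensor i (coefficient i A) (component (k - i) \<zeta>))"
  have lin: "bounded_linear (\<lambda>f. tensor i (component i f) h)" for i and h :: "'a list ell2"
  proof (rule bounded_linear_intro[where K = "norm h"])
    show "tensor i (component i (r *\<^sub>R f)) h = r *\<^sub>R tensor i (component i f) h" for r f
      using component_scaleC[of i "of_real r" f] tensor_scaleC_left[of i "of_real r" "component i f" h]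
      by simp
    show "norm (tensor i (component i f) h) \<le> norm f * norm h" for f
      by (simp add: norm_tensor mult_right_mono norm_component_le)
  qed (simp add: component_add tensor_add_left)
  have "closed {A. component k (blinfun_apply A \<zeta>) = ?r A}"
    unfolding coefficient_def
    by (intro closed_Collect_eq continuous_on_sum linear_continuous_on
        bounded_linear_compose[OF bounded_linear_component] blinfun.bounded_linear_left
        bounded_linear_compose[OF bounded_linear_orth_proj[OF closed_fibre]]
        bounded_linear_compose[OF lin])
  moreover have "polys X \<subseteq> {A. component k (blinfun_apply A \<zeta>) = ?r A}"
  proof (intro subsetI CollectI)
    fix A assume "A \<in> polys X"
    then show "component k (blinfun_apply A \<zeta>) = ?r A"
    proof (induction rule: polys.induct)
      case (creation \<xi> m)
      have "component k (blinfun_apply (L m \<xi>) \<zeta>) =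
          (if m \<le> k then p k (tensor m \<xi> (component (k - m) \<zeta>)) else 0)"
        by (simp add: creation_apply creation fibre_tp component_P component_tensor p_zero)
      also have "\<dots> = (\<Sum>i\<le>k. if i = m then p k (tensor m \<xi> (component (k - m) \<zeta>)) else 0)"
        by simp
      also have "\<dots> = ?r (L m \<xi>)"
        by (intro sum.cong) (auto simp: coeff_creation fibre_tp creation p_id p_zero)
      finally show ?case .
    next
      case (add A B)
      then show ?case
        by (simp add: plus_blinfun.rep_eq component_add coeff_add tensor_add_left p_add sum.distrib)
    qed
  qed
  ultimately show ?thesis
    using assms closure_minimal[of "polys X" "{A. component k (blinfun_apply A \<zeta>) = ?r A}"]
    by (auto simp: tensor_algebra_eq_closure)
qed

lemma coeff_mult:
  assumes "A \<in> tensor_algebra X"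
  shows "coefficient k (A o\<^sub>L B) = (\<Sum>i\<le>k. p k (tensor i (coefficient i A) (coefficient (k - i) B)))"
  using component_apply[OF assms, of k "blinfun_apply B vacuum"] by (simp add: coefficient_def)

lemma coeff_in:
  assumes "A \<in> tensor_algebra X"
  shows "coefficient k A \<in> X k"
proof -
  have "ell2.subspace (X k)" using closed_fibre[of k] by (simp add: closed_csubspace_def)
  then have "component k (blinfun_apply A vacuum) \<in> X k"
    unfolding component_apply[OF assms] by (intro ell2.subspace_sum p_in)
  then show ?thesis by (simp add: coefficient_def)
qed

lemma coeff_eqI:
  assumes "A \<in> tensor_algebra X" "B \<in> tensor_algebra X" "\<And>k. coefficient k A = coefficient k B"
  shows "A = B"
  by (rule blinfun_eqI, rule component_eqI) (simp add: component_apply assms)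

lemma tensor_algebra_proj:
  assumes "A \<in> tensor_algebra X"
  shows "fock_proj X o\<^sub>L A = A" "A o\<^sub>L fock_proj X = A"
proof -
  have 1: "coefficient k (fock_proj X o\<^sub>L A) = coefficient k A" for k
    using coeff_in[OF assms, of k] by (simp add: coefficient_def component_P p_id)
  show "fock_proj X o\<^sub>L A = A"
    by (rule coeff_eqI) (simp_all add: 1 assms fock_proj_mem tensor_algebra_closure)
  have "P vacuum = vacuum" by (simp add: P_homogeneous p_id vacuum_in)
  then have 2: "coefficient k (A o\<^sub>L fock_proj X) = coefficient k A" for k
    by (simp add: coefficient_def)
  show "A o\<^sub>L fock_proj X = A"
    by (rule coeff_eqI) (simp_all add: 2 assms fock_proj_mem tensor_algebra_closure)
qed

end

section \<open>Characters and the zero set\<close>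

primrec tensor_pow :: "nat \<Rightarrow> 'a list ell2 \<Rightarrow> 'a list ell2" where
  "tensor_pow 0 x = vacuum"
| "tensor_pow (Suc n) x = tensor 1 x (tensor_pow n x)"

lemma tensor_pow_in: "x \<in> tensor_power 1 \<Longrightarrow> tensor_pow n x \<in> tensor_power n"
  by (induction n) (auto dest: tensor_in)

lemma tensor_pow_add: "tensor_pow (m + n) x = tensor m (tensor_pow m x) (tensor_pow n x)"
  by (induction m) (simp_all add: tensor_assoc)

lemma norm_tensor_pow: "x \<in> tensor_power 1 \<Longrightarrow> norm (tensor_pow n x) = norm x ^ n"
  by (induction n) (simp_all add: norm_tensor)

lemma tensor_pow_scaleC: "tensor_pow n (scaleC c x) = scaleC (c ^ n) (tensor_pow n x)"
  by (induction n) (simp_all add: tensor_scaleC_left tensor_scaleC_right mult.commute)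

text \<open>
  A point \<open>\<lambda>\<close> of \<open>\<complex>\<^sup>d\<close> is represented by the vector \<open>x\<close> of degree \<open>1\<close> with the conjugate coordinates, so
  that \<open>\<langle>f(e), tensor_pow n x\<rangle> = f(\<lambda>)\<close> for \<open>f\<close> homogeneous of degree \<open>n\<close>. Thus \<open>tensor_pow n x\<close> lies in the
  \<open>n\<close>-th fibre exactly when the relations of degree \<open>n\<close> vanish at \<open>\<lambda>\<close>.
\<close>

definition zero_set :: "'a fibres \<Rightarrow> 'a list ell2 set" where
  "zero_set X = {x \<in> tensor_power 1. \<forall>n. tensor_pow n x \<in> X n}"

text \<open>
  For \<open>x\<close> in the open unit ball of the zero set this is the character at the point \<open>x\<close>.
\<close>

definition ev :: "'a list ell2 \<Rightarrow> ('a list ell2 \<Rightarrow>\<^sub>L 'a list ell2) \<Rightarrow> complex" where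
  "ev x A = suminf (\<lambda>n. cinner (coefficient n A) (tensor_pow n x))"

definition bounded_character ::
    "'a fibres \<Rightarrow> (('a list ell2 \<Rightarrow>\<^sub>L 'a list ell2) \<Rightarrow> complex) \<Rightarrow> bool" where
  "bounded_character X \<kappa> \<longleftrightarrow>
     (\<forall>A\<in>tensor_algebra X. \<forall>B\<in>tensor_algebra X.
        \<kappa> (A + B) = \<kappa> A + \<kappa> B \<and> \<kappa> (A o\<^sub>L B) = \<kappa> A * \<kappa> B) \<and>
     (\<forall>A\<in>tensor_algebra X. \<forall>c. \<kappa> (scaleC_op c o\<^sub>L A) = c * \<kappa> A) \<and>
     \<kappa> (fock_proj X) = 1 \<and> (\<exists>C. \<forall>A\<in>tensor_algebra X. cmod (\<kappa> A) \<le> C * norm A)"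

context subproduct
begin

lemma zero_set_scaleC: "x \<in> zero_set X \<Longrightarrow> scaleC c x \<in> zero_set X"
  by (simp add: zero_set_def tensor_pow_scaleC fibre_closure tensor_power_closure)

lemma zero_in_zero_set: "0 \<in> zero_set X"
proof -
  have "tensor_pow n 0 \<in> X n" for n :: nat
    by (cases n) (simp_all add: vacuum_in fibre_closure)
  then show ?thesis by (simp add: zero_set_def tensor_power_closure)
qed

lemma norm_ev_term:
  assumes "x \<in> tensor_power 1"
  shows "norm (cinner (coefficient n A) (tensor_pow n x)) \<le> norm A * norm x ^ n"
proof -
  have "norm (cinner (coefficient n A) (tensor_pow n x)) \<le> norm (coefficient n A) * norm (tensor_pow n x)"
    by (rule norm_cinner_le)
  also have "\<dots> \<le> norm A * norm x ^ n"
    by (intro mult_mono norm_coeff_le) (simp_all add: norm_tensor_pow[OF assms])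
  finally show ?thesis .
qed

lemma summable_ev:
  assumes "x \<in> tensor_power 1" "norm x < 1"
  shows "summable (\<lambda>n. norm (cinner (coefficient n A) (tensor_pow n x)))"
proof (rule summable_comparison_test')
  show "summable (\<lambda>n. norm A * norm x ^ n)"
    using assms by (intro summable_mult summable_geometric) simp
qed (simp add: norm_ev_term assms(1)[simplified])

lemma ev_creation: "\<xi> \<in> tensor_power m \<Longrightarrow> x \<in> zero_set X \<Longrightarrow> ev x (L m \<xi>) = cinner \<xi> (tensor_pow m x)"
proof -
  assume \<xi>: "\<xi> \<in> tensor_power m" and x: "x \<in> zero_set X"
  have "ev x (L m \<xi>) = (\<Sum>n\<in>{m}. cinner (coefficient n (L m \<xi>)) (tensor_pow n x))"
    unfolding ev_def by (rule suminf_finite) (simp_all add: coeff_creation \<xi>)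
  also have "\<dots> = cinner (p m \<xi>) (tensor_pow m x)" by (simp add: coeff_creation \<xi>)
  also have "\<dots> = cinner \<xi> (tensor_pow m x)" using x by (simp add: cinner_p zero_set_def)
  finally show ?thesis .
qed

text \<open>
  Convolution of coefficients becomes the Cauchy product of the evaluated series, because
  \<open>tensor_pow (i + j) x\<close> factors and lies in the fibre, where the projection in the convolution formula
  is invisible.
\<close>

lemma bounded_character_ev:
  assumes x: "x \<in> zero_set X" "norm x < 1"
  shows "bounded_character X (ev x)"
proof -
  have xt: "x \<in> tensor_power 1" using x by (simp add: zero_set_def)
  note summ = summable_ev[OF xt x(2)]
  note summ' = summable_norm_cancel[OF summ]
  show ?thesis
    unfolding bounded_character_def
  proof (intro conjI ballI allI exI)
    fix A B c assume A: "A \<in> tensor_algebra X"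
    show "ev x (scaleC_op c o\<^sub>L A) = c * ev x A"
      by (simp add: ev_def coeff_scaleC suminf_mult[OF summ'])
    have "cmod (ev x A) \<le> suminf (\<lambda>n. norm (cinner (coefficient n A) (tensor_pow n x)))"
      unfolding ev_def by (rule summable_norm[OF summ])
    also have "\<dots> \<le> suminf (\<lambda>n. norm A * norm x ^ n)"
    proof (rule suminf_le[OF _ summ])
      show "summable (\<lambda>n. norm A * norm x ^ n)"
        using x(2) by (intro summable_mult summable_geometric) simp
    qed (rule norm_ev_term[OF xt])
    also have "\<dots> = suminf (\<lambda>n. norm x ^ n) * norm A"
      using x(2) by (simp add: suminf_mult summable_geometric)
    finally show "cmod (ev x A) \<le> suminf (\<lambda>n. norm x ^ n) * norm A" .
    assume B: "B \<in> tensor_algebra X"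
    show "ev x (A + B) = ev x A + ev x B"
      by (simp add: ev_def coeff_add cinner_add_left suminf_add[OF summ' summ'])
    have "cinner (coefficient k (A o\<^sub>L B)) (tensor_pow k x) =
        (\<Sum>i\<le>k. cinner (coefficient i A) (tensor_pow i x) *
          cinner (coefficient (k - i) B) (tensor_pow (k - i) x))" for k
    proof -
      have xk: "tensor_pow k x \<in> X k" using x(1) by (simp add: zero_set_def)
      have "cinner (tensor i (coefficient i A) (coefficient (k - i) B)) (tensor_pow k x) =
          cinner (coefficient i A) (tensor_pow i x) * cinner (coefficient (k - i) B) (tensor_pow (k - i) x)"
        if "i \<le> k" for i
        using that tensor_pow_add[of i "k - i" x] cinner_tensor[OF fibre_tp[OF coeff_in[OF A]]]
        by simp
      then show ?thesis by (simp add: coeff_mult A cinner_sum_left cinner_p[OF xk])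
    qed
    then show "ev x (A o\<^sub>L B) = ev x A * ev x B"
      using Cauchy_product_sums[OF summ summ, of A B] by (simp add: ev_def sums_iff)
  next
    show "ev x (fock_proj X) = 1"
      by (simp add: fock_proj_eq_creation ev_creation x cinner_basis_vec Rep_basis_vec)
  qed
qed

context
  fixes \<kappa> assumes \<kappa>: "bounded_character X \<kappa>"
begin

lemma char_simps:
  "A \<in> tensor_algebra X \<Longrightarrow> B \<in> tensor_algebra X \<Longrightarrow> \<kappa> (A + B) = \<kappa> A + \<kappa> B"
  "A \<in> tensor_algebra X \<Longrightarrow> B \<in> tensor_algebra X \<Longrightarrow> \<kappa> (A o\<^sub>L B) = \<kappa> A * \<kappa> B"
  "A \<in> tensor_algebra X \<Longrightarrow> \<kappa> (scaleC_op c o\<^sub>L A) = c * \<kappa> A"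
  "\<kappa> (fock_proj X) = 1"
  using \<kappa> by (auto simp: bounded_character_def)

lemma char_diff:
  assumes "A \<in> tensor_algebra X" "B \<in> tensor_algebra X"
  shows "\<kappa> (A - B) = \<kappa> A - \<kappa> B"
  using char_simps(1)[OF assms(1) tensor_algebra_closure(4)[OF assms(2), of "-1"]]
  by (simp add: scaleC_op_compose_diff char_simps(3) assms)

text \<open>
  Applying the bound \<open>C\<close> to powers of \<open>A\<close> and taking roots removes the constant.
\<close>

lemma char_contractive:
  assumes A: "A \<in> tensor_algebra X"
  shows "cmod (\<kappa> A) \<le> norm A"
proof (rule ccontr)
  assume "\<not> ?thesis"
  then have less: "norm A < cmod (\<kappa> A)" by simp
  obtain C where C: "\<And>A. A \<in> tensor_algebra X \<Longrightarrow> cmod (\<kappa> A) \<le> C * norm A"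
    using \<kappa> unfolding bounded_character_def by blast
  define q where "q = norm A / cmod (\<kappa> A)"
  define An where "An n = ((o\<^sub>L) A ^^ n) (fock_proj X)" for n
  have An: "An n \<in> tensor_algebra X \<and> \<kappa> (An n) = \<kappa> A ^ n \<and> norm (An n) \<le> norm A ^ n" for n
  proof (induction n)
    case 0
    have "norm (fock_proj X) \<le> 1"
      by (rule norm_blinfun_bound) (simp_all add: norm_orth_proj_le closed_csubspace_fock)
    then show ?case by (simp add: An_def fock_proj_mem char_simps)
  next
    case (Suc n)
    have "norm (A o\<^sub>L An n) \<le> norm A * norm (An n)" by (rule norm_blinfun_compose)
    also have "\<dots> \<le> norm A * norm A ^ n" using Suc by (intro mult_left_mono) auto
    finally show ?case
      using Suc A by (simp add: An_def tensor_algebra_closure char_simps)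
  qed
  have C0: "C \<ge> 0"
    using C[of "fock_proj X"] mult_nonpos_nonneg[of C "norm (fock_proj X)"]
    by (cases "C \<ge> 0") (auto simp: fock_proj_mem char_simps)
  have "1 \<le> C * q ^ n" for n
  proof -
    have "cmod (\<kappa> A) ^ n \<le> C * norm (An n)" using C[of "An n"] An[of n] by (simp add: norm_power)
    also have "\<dots> \<le> C * norm A ^ n" using An[of n] C0 by (intro mult_left_mono) auto
    finally have "cmod (\<kappa> A) ^ n \<le> C * norm A ^ n" .
    moreover have "0 < cmod (\<kappa> A) ^ n"
      using less norm_ge_zero[of A] by (intro zero_less_power) linarith
    ultimately show ?thesis by (simp add: q_def power_divide pos_le_divide_eq)
  qed
  moreover have "0 \<le> q" "q < 1"
    using less norm_ge_zero[of A] by (simp_all add: q_def divide_less_eq)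
  then have "(\<lambda>n. C * q ^ n) \<longlonglongrightarrow> C * 0"
    by (intro tendsto_intros LIMSEQ_realpow_zero)
  ultimately show False
    using tendsto_lowerbound[of "\<lambda>n. C * q ^ n" 0 sequentially 1] by simp
qed

text \<open>
  The restriction to creation operators of degree \<open>1\<close> is represented by a vector \<open>x\<close>, and
  multiplicativity extends this to all degrees. Since creation operators see \<open>\<xi>\<close> only through its
  projection to the fibre, \<open>tensor_pow n x\<close> is orthogonal to the complement of the fibre. Finally
  \<open>\<parallel>x\<parallel>\<^sup>2\<close> is the value of the character at the creation operator of \<open>x\<close>, which has norm at most \<open>\<parallel>x\<parallel>\<close>.
\<close>

lemma char_point:
  obtains x where "x \<in> zero_set X" "norm x \<le> 1"
    "\<And>n \<xi>. \<xi> \<in> tensor_power n \<Longrightarrow> \<kappa> (L n \<xi>) = cinner \<xi> (tensor_pow n x)"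
proof -
  obtain x where x: "x \<in> tensor_power 1"
      "\<And>\<xi>. \<xi> \<in> tensor_power 1 \<Longrightarrow> \<kappa> (L 1 (component 1 \<xi>)) = cinner \<xi> x"
    by (rule cinner_functional[of "\<lambda>\<xi>. \<kappa> (L 1 (component 1 \<xi>))" 1])
      (auto simp: component_add component_scaleC creation_add creation_scaleC char_simps creation_mem)
  have x1: "\<kappa> (L 1 \<xi>) = cinner \<xi> x" if "\<xi> \<in> tensor_power 1" for \<xi>
    using x(2)[OF that] that by (simp add: component_same)
  have xn: "\<kappa> (L n \<xi>) = cinner \<xi> (tensor_pow n x)" if "\<xi> \<in> tensor_power n" for n \<xi>
    using that
  proof (induction rule: tensor_power_induct)
    case (basis w)
    then show ?case
    proof (induction w arbitrary: n)
      case Nil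
      then show ?case
        using char_simps(4) by (simp add: fock_proj_eq_creation cinner_basis_vec Rep_basis_vec)
    next
      case (Cons i w)
      let ?n = "length w"
      have e: "basis_vec (i # w) = tensor 1 (basis_vec [i]) (basis_vec w)"
        by (simp add: tensor_basis_vec)
      have "\<kappa> (L n (basis_vec (i # w))) = \<kappa> (L 1 (basis_vec [i]) o\<^sub>L L ?n (basis_vec w))"
        using Cons.prems by (simp add: creation_mult tensor_basis_vec)
      also have "\<dots> = cinner (basis_vec [i]) x * cinner (basis_vec w) (tensor_pow ?n x)"
        using x1[of "basis_vec [i]"] Cons.IH[of ?n] by (simp add: char_simps creation_mem)
      also have "\<dots> = cinner (basis_vec (i # w)) (tensor_pow n x)"
        using Cons.prems[symmetric] by (simp add: e cinner_tensor)
      finally show ?case .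
    qed
  qed (simp_all add: creation_add creation_scaleC char_simps creation_mem cinner_add_left)
  show ?thesis
  proof (rule that[OF _ _ xn])
    have "tensor_pow n x \<in> X n" for n
    proof -
      let ?y = "tensor_pow n x"
      have y: "?y \<in> tensor_power n" by (rule tensor_pow_in[OF x(1)])
      have "cinner (p n ?y) ?y = cinner ?y ?y"
        using xn[OF p_tp, of n ?y] xn[OF y] by (simp add: creation_p y)
      moreover have "cinner (?y - p n ?y) (p n ?y) = 0"
        by (rule orth_proj_orth[OF closed_fibre p_in])
      ultimately have "cinner (?y - p n ?y) (?y - p n ?y) = 0"
        by (simp add: cinner_diff_right cinner_diff_left)
      then have "p n ?y = ?y" by (simp add: cinner_same)
      then show ?thesis using p_in[of n ?y] by simp
    qed
    then show "x \<in> zero_set X" using x(1) by (simp add: zero_set_def)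
    have "(norm x)\<^sup>2 = cmod (\<kappa> (L 1 x))"
      using x1[OF x(1)] by (simp add: cinner_same norm_power)
    also have "\<dots> \<le> norm (L 1 x)" by (rule char_contractive[OF creation_mem[OF x(1)]])
    also have "\<dots> \<le> norm x" by (rule norm_creation_le[OF x(1)])
    finally show "norm x \<le> 1"
      by (cases "norm x = 0") (simp_all add: power2_eq_square)
  qed
qed

end

text \<open>
  Contractive characters are continuous, and finite sums of creation operators are dense.
\<close>

lemma char_eqI:
  assumes \<kappa>: "bounded_character X \<kappa>" and \<kappa>': "bounded_character X \<kappa>'"
    and eq: "\<And>n \<xi>. \<xi> \<in> X n \<Longrightarrow> \<kappa> (L n \<xi>) = \<kappa>' (L n \<xi>)" and A: "A \<in> tensor_algebra X"
  shows "\<kappa> A = \<kappa>' A"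
proof -
  have 1: "\<kappa> a = \<kappa>' a" if "a \<in> polys X" for a
    using that
  proof (induction rule: polys.induct)
    case (add a b)
    then have "a \<in> tensor_algebra X" "b \<in> tensor_algebra X" using polys_subset by auto
    with add show ?case by (simp add: char_simps(1)[OF \<kappa>] char_simps(1)[OF \<kappa>'])
  qed (rule eq)
  obtain a where a: "\<And>n. a n \<in> polys X" "a \<longlonglongrightarrow> A" using tensor_algebra_sequence[OF A] by metis
  have aT: "a n \<in> tensor_algebra X" for n using a polys_subset by auto
  have lim: "(\<lambda>n. \<psi> (a n)) \<longlonglongrightarrow> \<psi> A" if \<psi>: "bounded_character X \<psi>" for \<psi>
  proof (rule LIM_zero_cancel, rule Lim_null_comparison)
    show "\<forall>\<^sub>F n in sequentially. norm (\<psi> (a n) - \<psi> A) \<le> norm (a n - A)"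
      using char_contractive[OF \<psi>] aT A
      by (simp add: char_diff[OF \<psi>, symmetric] tensor_algebra_closure)
    show "(\<lambda>n. norm (a n - A)) \<longlonglongrightarrow> 0"
      using a(2) by (simp add: LIM_zero tendsto_norm_zero)
  qed
  show ?thesis
    by (rule LIMSEQ_unique[OF lim[OF \<kappa>]]) (use lim[OF \<kappa>'] 1 a in simp)
qed

end

section \<open>Discs in the unit ball\<close>

text \<open>
  Inner products are conjugate-linear in the second argument, so \<open>H\<close> itself is antiholomorphic. Such
  \<open>H\<close> arise from characters, whose points have conjugated coordinates.
\<close>

locale disc_in_ball =
  fixes H :: "complex \<Rightarrow> 'a list ell2"
  assumes holomorphic: "\<And>\<xi>. (\<lambda>z. cinner \<xi> (H z)) holomorphic_on ball 0 1"
    and norm_le: "\<And>z. cmod z < 1 \<Longrightarrow> norm (H z) \<le> 1"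
begin

text \<open>
  The maximum principle for \<open>\<langle>H w, H z\<rangle>\<close>, together with the case of equality in the Cauchy-Schwarz
  inequality.
\<close>

lemma constant_of_boundary:
  assumes "norm (H w) = 1" "cmod w < 1" "cmod z < 1"
  shows "H z = H w"
proof -
  let ?g = "\<lambda>z. cinner (H w) (H z)"
  have gw: "?g w = 1" using assms(1) by (simp add: cinner_same)
  have "?g constant_on ball 0 1"
  proof (rule maximum_modulus_principle[OF holomorphic])
    show "w \<in> ball 0 1" using assms by simp
    show "cmod (?g z) \<le> cmod (?g w)" if "z \<in> ball 0 1" for z
      using norm_cinner_le[of "H w" "H z"] norm_le[of z] that assms(1) gw by simp
  qed auto
  then have "?g z = 1" using gw assms unfolding constant_on_def by (metis mem_ball_0)
  then have "H w \<bullet> H z = 1" by (simp flip: Re_cinner)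
  then have "(norm (H z - H w))\<^sup>2 = (norm (H z))\<^sup>2 - 1"
    using assms(1) by (simp add: power2_norm_eq_inner inner_diff_left inner_diff_right inner_commute)
      (simp flip: power2_norm_eq_inner)
  also have "\<dots> \<le> 0" using norm_le[OF assms(3)] by (simp add: power_le_one)
  finally show ?thesis by simp
qed

end

text \<open>
  The Moebius involution of the disc that exchanges \<open>0\<close> and \<open>s\<close>.
\<close>

definition disc_flip :: "real \<Rightarrow> complex \<Rightarrow> complex" where
  "disc_flip s z = (of_real s - z) / (1 - of_real s * z)"

lemma disc_flip_Moebius: "disc_flip s z = - Moebius_function 0 (of_real s) z"
  by (simp add: disc_flip_def Moebius_function_simple minus_divide_left)

lemma disc_flip:
  assumes "0 \<le> s" "s < 1"
  shows "disc_flip s 0 = of_real s" "disc_flip s (of_real s) = 0"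
    "disc_flip s holomorphic_on ball 0 1"
    "cmod z < 1 \<Longrightarrow> cmod (disc_flip s z) < 1"
    "cmod z < 1 \<Longrightarrow> disc_flip s (disc_flip s z) = z"
proof -
  show "disc_flip s 0 = of_real s" "disc_flip s (of_real s) = 0"
    by (simp_all add: disc_flip_def)
  have s: "cmod (of_real s) < 1" using assms by simp
  have "(\<lambda>z. - Moebius_function 0 (of_real s) z) holomorphic_on ball 0 1"
    by (intro holomorphic_intros Moebius_function_holomorphic s)
  then show "disc_flip s holomorphic_on ball 0 1"
    by (simp add: disc_flip_Moebius fun_eq_iff cong: holomorphic_cong)
  show lt: "cmod (disc_flip s z) < 1" if z: "cmod z < 1"
    using Moebius_function_norm_lt_1[OF s z] by (simp add: disc_flip_Moebius)
  show "disc_flip s (disc_flip s z) = z" if z: "cmod z < 1"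
  proof -
    have "disc_flip s (- w) = Moebius_function 0 (- of_real s) w" for w
      by (simp add: disc_flip_def Moebius_function_simple add.commute)
    then show ?thesis
      using Moebius_function_compose[of "- of_real s" "of_real s" z] s z
      by (simp add: disc_flip_Moebius[of s z])
  qed
qed

context disc_in_ball
begin

text \<open>
  The Schwarz lemma applies to \<open>g \<circ> disc_flip s\<close>, which fixes \<open>0\<close> and maps \<open>s\<close> to \<open>norm b\<close>.
\<close>

lemma schwarz:
  fixes s :: real
  assumes s: "0 \<le> s" "s < 1" and H0: "H 0 = b" and Hs: "H (of_real s) = 0" and b: "b \<noteq> 0"
  defines "g \<equiv> \<lambda>z. cinner (scaleC (of_real (1 / norm b)) b) (H z)"
  shows "norm b \<le> s"
    and "norm b = s \<Longrightarrow> cmod z < 1 \<Longrightarrow> g z = disc_flip s z"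
proof -
  let ?v = "scaleC (of_real (1 / norm b)) b"
  have v: "norm ?v = 1" using b by (simp add: norm_scaleC norm_divide)
  have hg: "g holomorphic_on ball 0 1" unfolding g_def by (rule holomorphic)
  have g1: "cmod (g z) \<le> 1" if "cmod z < 1" for z
    using norm_cinner_le[of ?v "H z"] norm_le[OF that] v by (simp add: g_def)
  have gs: "g (of_real s) = 0" by (simp add: g_def Hs)
  have g0: "g 0 = of_real (norm b)"
    using b by (simp add: g_def H0 cinner_same power2_eq_square)
  have glt: "cmod (g z) < 1" if z: "cmod z < 1" for z
  proof (rule ccontr)
    assume "\<not> ?thesis"
    with g1[OF z] have gz: "cmod (g z) = 1" by simp
    have "g constant_on ball 0 1"
      by (rule maximum_modulus_principle[OF hg, where \<xi> = z and U = "ball 0 1"]) (use g1 gz z in auto)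
    then have "g z = g (of_real s)" using z s unfolding constant_on_def by (metis mem_ball_0 norm_of_real abs_of_nonneg)
    with gs gz show False by simp
  qed
  \<comment> \<open>Normalize the zero of \<open>g\<close> to lie at the origin.\<close>
  define h where "h = g \<circ> disc_flip s"
  have hh: "h holomorphic_on ball 0 1" unfolding h_def
    by (rule holomorphic_on_compose_gen[OF disc_flip(3)[OF s] hg]) (use disc_flip(4)[OF s] in auto)
  have h0: "h 0 = 0" by (simp add: h_def disc_flip[OF s] gs)
  have hs: "h (of_real s) = of_real (norm b)" by (simp add: h_def disc_flip[OF s] g0)
  have hlt: "cmod (h z) < 1" if "cmod z < 1" for z
    using glt disc_flip(4)[OF s that] by (simp add: h_def)
  have "cmod (h (of_real s)) \<le> cmod (of_real s)"
    by (rule Schwarz_Lemma(1)[OF hh h0 hlt]) (use s in auto)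
  then show "norm b \<le> s" using s by (simp add: hs)
  assume bs: "norm b = s" and z: "cmod z < 1"
  have "s \<noteq> 0" using b bs by auto
  have "\<exists>\<alpha>. (\<forall>z. cmod z < 1 \<longrightarrow> h z = \<alpha> * z) \<and> cmod \<alpha> = 1"
  proof (rule Schwarz_Lemma(3)[OF hh h0 hlt, of 0])
    show "(\<exists>z. cmod z < 1 \<and> z \<noteq> 0 \<and> cmod (h z) = cmod z) \<or> cmod (deriv h 0) = 1"
      using hs bs s \<open>s \<noteq> 0\<close> by (intro disjI1 exI[of _ "of_real s"]) auto
  qed auto
  then obtain \<alpha> where \<alpha>: "\<And>z. cmod z < 1 \<Longrightarrow> h z = \<alpha> * z" by auto
  have "\<alpha> = 1" using \<alpha>[of "of_real s"] hs bs s \<open>s \<noteq> 0\<close> by simp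
  then show "g z = disc_flip s z"
    using \<alpha>[OF disc_flip(4)[OF s z]] disc_flip(5)[OF s z] by (simp add: h_def)
qed

text \<open>
  By \<open>schwarz\<close> the component of \<open>H z\<close> along \<open>b\<close> is the conjugate of \<open>disc_flip s z\<close>, which tends to modulus \<open>1\<close> at the
  boundary. As \<open>H z\<close> stays in the unit ball, the remaining component \<open>K\<close> tends to \<open>0\<close> there, and the
  maximum principle forces it to vanish.
\<close>

lemma schwarz_equality:
  fixes s :: real
  assumes s: "0 < s" "s < 1" and H0: "H 0 = b" and Hs: "H (of_real s) = 0" and b: "norm b = s"
    and z: "cmod z < 1"
  shows "H z = scaleC (cnj (disc_flip s z) / of_real s) b"
proof -
  have s0: "0 \<le> s" using s by simp
  define v where "v = scaleC (of_real (1 / norm b)) b"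
  have b0: "b \<noteq> 0" using b s by auto
  have v: "norm v = 1" using b0 by (simp add: v_def norm_scaleC norm_divide)
  have g: "cinner v (H z) = disc_flip s z" if "cmod z < 1" for z
    using schwarz(2)[OF s0 s(2) H0 Hs b0 b that] by (simp only: v_def)
  define K where "K z = H z - scaleC (cnj (disc_flip s z)) v" for z
  have K: "(norm (K z))\<^sup>2 \<le> 1 - (cmod (disc_flip s z))\<^sup>2" if z: "cmod z < 1" for z
  proof -
    let ?c = "cnj (disc_flip s z)"
    have vv: "cinner v v = 1" using v by (simp only: cinner_same) simp
    have hv: "cinner (H z) v = ?c" using g[OF z] by (metis cinner_commute)
    have "cinner (K z) (K z) = cinner (H z) (H z) - ?c * cnj ?c"
      unfolding K_def
      by (simp only: cinner_diff_left cinner_diff_right cinner_scaleC_left cinner_scaleC_right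
          hv g[OF z] vv) simp
    then have "complex_of_real ((norm (K z))\<^sup>2) = of_real ((norm (H z))\<^sup>2 - (cmod ?c)\<^sup>2)"
      by (simp only: cinner_same complex_norm_square of_real_diff)
    then have "(norm (K z))\<^sup>2 = (norm (H z))\<^sup>2 - (cmod (disc_flip s z))\<^sup>2"
      by (simp only: of_real_eq_iff complex_mod_cnj)
    then show ?thesis using norm_le[OF z] by (simp add: power_le_one)
  qed
  have zero: "cinner \<xi> (K (disc_flip s w)) = 0" if w: "cmod w < 1" for \<xi> w
  proof -
    let ?f = "\<lambda>w. cinner \<xi> (K (disc_flip s w))"
    have "(\<lambda>z. cinner \<xi> (H z) - disc_flip s z * cinner \<xi> v) holomorphic_on ball 0 1"
      by (intro holomorphic_intros holomorphic disc_flip(3)[OF s0 s(2)])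
    then have hk: "(\<lambda>z. cinner \<xi> (K z)) holomorphic_on ball 0 1"
      by (simp add: K_def cinner_diff_right)
    have "((\<lambda>z. cinner \<xi> (K z)) \<circ> disc_flip s) holomorphic_on ball 0 1"
      by (rule holomorphic_on_compose_gen[OF disc_flip(3)[OF s0 s(2)] hk])
        (use disc_flip(4)[OF s0 s(2)] in auto)
    then have hf: "?f holomorphic_on ball 0 1" by (simp add: o_def)
    have bd: "cmod (?f x) \<le> norm \<xi> * sqrt (1 - (cmod x)\<^sup>2)" if x: "cmod x < 1" for x
    proof -
      have "(norm (K (disc_flip s x)))\<^sup>2 \<le> 1 - (cmod x)\<^sup>2"
        using K[OF disc_flip(4)[OF s0 s(2) x]] by (simp add: disc_flip(5)[OF s0 s(2) x])
      then have "norm (K (disc_flip s x)) \<le> sqrt (1 - (cmod x)\<^sup>2)"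
        by (rule real_le_rsqrt)
      then show ?thesis
        using norm_cinner_le[of \<xi> "K (disc_flip s x)"] by (meson mult_left_mono norm_ge_zero order_trans)
    qed
    have "cmod (?f w) \<le> norm \<xi> * sqrt (1 - \<rho>\<^sup>2)" if \<rho>: "cmod w < \<rho>" "\<rho> < 1" for \<rho>
    proof (rule maximum_modulus_frontier[where f = ?f and S = "cball 0 \<rho>" and \<xi> = w])
      have r0: "0 < \<rho>" using \<rho>(1) norm_ge_zero[of w] by linarith
      have sub: "cball 0 \<rho> \<subseteq> ball (0::complex) 1" using \<rho> by auto
      show "?f holomorphic_on interior (cball 0 \<rho>)"
        using holomorphic_on_subset[OF hf] sub by (meson interior_subset order_trans)
      show "continuous_on (closure (cball 0 \<rho>)) ?f"
        using holomorphic_on_imp_continuous_on[OF holomorphic_on_subset[OF hf sub]] by simp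
      show "w \<in> cball 0 \<rho>" using \<rho> by simp
      show "cmod (?f x) \<le> norm \<xi> * sqrt (1 - \<rho>\<^sup>2)" if "x \<in> frontier (cball 0 \<rho>)" for x
        using bd[of x] that \<rho> r0 by simp
    qed auto
    moreover have "((\<lambda>\<rho>. norm \<xi> * sqrt (1 - \<rho>\<^sup>2)) \<longlongrightarrow> norm \<xi> * sqrt (1 - 1\<^sup>2)) (at_left 1)"
      by (intro tendsto_intros)
    moreover have "\<forall>\<^sub>F \<rho> in at_left 1. cmod w < \<rho> \<and> \<rho> < 1"
      using w eventually_at_left_field by blast
    ultimately have "cmod (?f w) \<le> norm \<xi> * sqrt (1 - 1\<^sup>2)"
      by (intro tendsto_lowerbound[of _ _ "at_left (1::real)"]) (auto elim: eventually_mono)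
    then show ?thesis by simp
  qed
  have "cinner (K z) (K z) = 0"
    using zero[OF disc_flip(4)[OF s0 s(2) z], of "K z"] by (simp add: disc_flip(5)[OF s0 s(2) z])
  then have "K z = 0" by (simp add: cinner_same)
  then have "H z = scaleC (cnj (disc_flip s z)) v" by (simp add: K_def)
  then show ?thesis by (simp add: b v_def)
qed

end

text \<open>
  Since \<open>disc_flip s (\<omega> * s) = s * (1 - \<omega>) / (1 - s\<^sup>2 * \<omega>)\<close>, the requirement is
  \<open>\<bar>1 - \<omega>\<bar> = \<bar>1 - s\<^sup>2 * \<omega>\<bar>\<close>, which for unimodular \<open>\<omega>\<close> means that its real part is \<open>(1 + s\<^sup>2) / 2\<close>.
\<close>

lemma disc_flip_circle:
  assumes s: "0 < s" "s < 1"
  obtains \<omega> where "cmod \<omega> = 1" "cmod (disc_flip s (\<omega> * of_real s)) = s"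
proof -
  define q where "q = s\<^sup>2"
  have q: "0 < q" "q < 1" using s by (auto simp: q_def power_less_one_iff abs_square_less_1)
  then have s2: "0 < s\<^sup>2" "s\<^sup>2 < 1" by (simp_all only: q_def)
  \<comment> \<open>The real part of \<open>\<omega>\<close>, obtained by solving \<open>2 - 2 * c = 1 - 2 * q * c + q\<^sup>2\<close>.\<close>
  define c where "c = (1 + q) / 2"
  have c: "0 < c" "c < 1" using q by (auto simp: c_def)
  then have c2: "c\<^sup>2 \<le> 1" by (simp add: power_le_one)
  define \<omega> where "\<omega> = Complex c (sqrt (1 - c\<^sup>2))"
  have \<omega>: "cmod \<omega> = 1" using c2 by (simp add: \<omega>_def cmod_def)
  have eq: "(cmod (1 - \<omega>))\<^sup>2 = (cmod (1 - of_real (s\<^sup>2) * \<omega>))\<^sup>2"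
  proof -
    have "(cmod (1 - of_real t * \<omega>))\<^sup>2 = 1 - 2 * t * c + t\<^sup>2" for t :: real
      using c2 by (simp add: \<omega>_def cmod_power2 power_mult_distrib) (simp add: power2_eq_square algebra_simps)
    from this[of 1] this[of "s\<^sup>2"] show ?thesis
      by (simp add: c_def q_def field_simps power2_eq_square)
  qed
  then have eq': "cmod (1 - \<omega>) = cmod (1 - of_real (s\<^sup>2) * \<omega>)"
    by (simp add: power2_eq_iff_nonneg)
  have ne: "cmod (1 - of_real (s\<^sup>2) * \<omega>) \<noteq> 0"
  proof
    assume "cmod (1 - of_real (s\<^sup>2) * \<omega>) = 0"
    then have "cmod (of_real (s\<^sup>2) * \<omega>) = 1" by (metis eq_iff_diff_eq_0 norm_eq_zero norm_one)
    then show False using s2 by (simp add: norm_mult \<omega> del: of_real_power)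
  qed
  have "disc_flip s (\<omega> * of_real s) = of_real s * (1 - \<omega>) / (1 - of_real (s\<^sup>2) * \<omega>)"
    by (simp add: disc_flip_def power2_eq_square algebra_simps)
  then have "cmod (disc_flip s (\<omega> * of_real s)) = s * cmod (1 - \<omega>) / cmod (1 - of_real (s\<^sup>2) * \<omega>)"
    using s by (simp add: norm_divide norm_mult)
  also have "\<dots> = s" using ne by (simp add: eq')
  finally show ?thesis using that \<omega> by blast
qed

section \<open>Conjugation by similarities\<close>

lemma blinfun_compose_assoc: "(A o\<^sub>L B) o\<^sub>L C = A o\<^sub>L (B o\<^sub>L C)"
  by (rule blinfun_eqI) simp

lemma norm_sum_graded:
  fixes f :: "nat \<Rightarrow> 'a list ell2"
  assumes "finite A" "\<And>n. f n \<in> tensor_power n"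
  shows "(norm (\<Sum>n\<in>A. f n))\<^sup>2 = (\<Sum>n\<in>A. (norm (f n))\<^sup>2)"
  using assms(1)
proof (rule norm_sum_Pythagorean)
  show "pairwise (\<lambda>i j. orthogonal (f i) (f j)) A"
  proof (rule pairwiseI)
    fix i j :: nat assume "i \<noteq> j"
    have "cinner (f i) (f j) = cinner (f i) (component i (f j))"
      by (rule cinner_component_right[OF assms(2), symmetric])
    also have "component i (f j) = 0" using \<open>i \<noteq> j\<close> by (simp add: component_same[OF assms(2)])
    finally show "orthogonal (f i) (f j)" by (simp add: orthogonal_def flip: Re_cinner)
  qed
qed

text \<open>
  The images of the components are pairwise orthogonal, so Pythagoras turns the bounds on the
  individual degrees into convergence of the sum and a bound on its norm.
\<close>

lemma graded_operator:
  fixes W :: "nat \<Rightarrow> 'a list ell2 \<Rightarrow> 'b list ell2"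
  assumes add: "\<And>n f g. W n (f + g) = W n f + W n g"
    and scale: "\<And>n c f. W n (scaleC c f) = scaleC c (W n f)"
    and tp: "\<And>n f. W n f \<in> tensor_power n"
    and bound: "\<And>n f. norm (W n f) \<le> C * norm (component n f)" and C: "0 \<le> C"
  obtains T where "norm T \<le> C" "\<And>n f. component n (blinfun_apply T f) = W n f"
proof -
  have sums_le: "norm (\<Sum>n\<in>A. W n f) \<le> C * norm (\<Sum>n\<in>A. component n f)" if "finite A" for A f
  proof (rule power2_le_imp_le)
    have "(norm (\<Sum>n\<in>A. W n f))\<^sup>2 = (\<Sum>n\<in>A. (norm (W n f))\<^sup>2)"
      by (rule norm_sum_graded[OF that tp])
    also have "\<dots> \<le> (\<Sum>n\<in>A. (C * norm (component n f))\<^sup>2)"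
      by (intro sum_mono power_mono bound) simp
    also have "\<dots> = C\<^sup>2 * (\<Sum>n\<in>A. (norm (component n f))\<^sup>2)"
      by (simp add: power_mult_distrib sum_distrib_left)
    also have "\<dots> = (C * norm (\<Sum>n\<in>A. component n f))\<^sup>2"
      by (simp add: norm_sum_graded[OF that component_in] power_mult_distrib)
    finally show "(norm (\<Sum>n\<in>A. W n f))\<^sup>2 \<le> (C * norm (\<Sum>n\<in>A. component n f))\<^sup>2" .
  qed (simp add: C)
  have sums: "(\<lambda>n. W n f) sums suminf (\<lambda>n. W n f)" for f
  proof (rule summable_sums, unfold summable_Cauchy, intro allI impI)
    fix e :: real assume e: "e > 0"
    have "summable (\<lambda>n. component n f)" using component_sums[of f] by (auto simp: summable_def)
    then obtain N where N: "\<And>m n. m \<ge> N \<Longrightarrow> norm (sum (\<lambda>n. component n f) {m..<n}) < e / (C + 1)"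
      using e C unfolding summable_Cauchy by (metis add_nonneg_pos divide_pos_pos zero_less_one)
    have "norm (sum (\<lambda>n. W n f) {m..<n}) < e" if "m \<ge> N" for m n
    proof -
      have "norm (sum (\<lambda>n. W n f) {m..<n}) \<le> C * norm (sum (\<lambda>n. component n f) {m..<n})"
        by (rule sums_le) simp
      also have "\<dots> \<le> (C + 1) * norm (sum (\<lambda>n. component n f) {m..<n})"
        by (intro mult_right_mono) auto
      also have "\<dots> < (C + 1) * (e / (C + 1))"
        using C N[OF that] by (intro mult_strict_left_mono) auto
      also have "\<dots> = e" using C by simp
      finally show ?thesis .
    qed
    then show "\<exists>N. \<forall>m\<ge>N. \<forall>n. norm (sum (\<lambda>n. W n f) {m..<n}) < e" by blast
  qed
  let ?T = "\<lambda>f. suminf (\<lambda>n. W n f)"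
  have scaleR: "W n (r *\<^sub>R f) = r *\<^sub>R W n f" for n r f
    using scale[of n "of_real r" f] by simp
  have bound_T: "norm (?T f) \<le> norm f * C" for f
  proof (rule LIMSEQ_le_const2)
    show "(\<lambda>N. norm (\<Sum>n<N. W n f)) \<longlonglongrightarrow> norm (?T f)"
      using sums[of f] unfolding sums_def by (rule tendsto_norm)
    have "norm (\<Sum>n<N. W n f) \<le> norm f * C" for N
    proof -
      have "norm (\<Sum>n<N. component n f) \<le> norm f"
        by (rule norm_ell2_mono)
          (simp add: sum_ell2_rep component.rep_eq sum.delta if_distrib cong: if_cong)
      then show ?thesis
        using sums_le[of "{..<N}" f] C by (simp add: mult.commute) (meson mult_left_mono order_trans)
    qed
    then show "\<exists>N. \<forall>n\<ge>N. norm (\<Sum>n<n. W n f) \<le> norm f * C" by blast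
  qed
  have lin: "bounded_linear ?T"
  proof (rule bounded_linear_intro[OF _ _ bound_T])
    show "?T (f + g) = ?T f + ?T g" for f g
      using sums_unique2[OF sums[of "f + g"]] sums_add[OF sums[of f] sums[of g]] by (simp add: add)
    show "?T (r *\<^sub>R f) = r *\<^sub>R ?T f" for r f
      using sums_unique2[OF sums[of "r *\<^sub>R f"]] sums_scaleR_right[OF sums[of f], of r]
      by (simp add: scaleR)
  qed
  have T: "blinfun_apply (Blinfun ?T) f = ?T f" for f by (simp only: bounded_linear_Blinfun_apply[OF lin])
  show ?thesis
  proof (rule that[of "Blinfun ?T"])
    show "norm (Blinfun ?T) \<le> C"
      using C bound_T by (intro norm_blinfun_bound) (simp_all add: T mult.commute)
    show "component n (blinfun_apply (Blinfun ?T) f) = W n f" for n f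
    proof -
      have "(\<lambda>k. component n (W k f)) sums component n (?T f)"
        by (rule bounded_linear.sums[OF bounded_linear_component sums])
      moreover have "(\<lambda>k. component n (W k f)) = (\<lambda>k. if k = n then W n f else 0)"
        by (auto simp: component_same[OF tp])
      moreover have "(\<lambda>k. if k = n then W n f else 0) sums W n f" by (rule sums_single)
      ultimately show ?thesis unfolding T by (metis sums_unique2)
    qed
  qed
qed

subsection \<open>Bounded homomorphisms of tensor algebras\<close>

text \<open>
  The norm bound is a parameter, so that contractive and merely bounded homomorphisms can be
  composed and inverted in the same lemmas.
\<close>

definition bounded_hom ::
    "'a fibres \<Rightarrow> 'b fibres \<Rightarrow> real \<Rightarrow> (('a list ell2 \<Rightarrow>\<^sub>L 'a list ell2) \<Rightarrow> ('b list ell2 \<Rightarrow>\<^sub>L 'b list ell2)) \<Rightarrow> bool" where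
  "bounded_hom X Y C \<phi> \<longleftrightarrow>
     (\<forall>A\<in>tensor_algebra X. \<phi> A \<in> tensor_algebra Y \<and> norm (\<phi> A) \<le> C * norm A) \<and>
     (\<forall>A\<in>tensor_algebra X. \<forall>B\<in>tensor_algebra X.
        \<phi> (A + B) = \<phi> A + \<phi> B \<and> \<phi> (A o\<^sub>L B) = \<phi> A o\<^sub>L \<phi> B) \<and>
     (\<forall>A\<in>tensor_algebra X. \<forall>c. \<phi> (scaleC_op c o\<^sub>L A) = scaleC_op c o\<^sub>L \<phi> A) \<and>
     \<phi> (fock_proj X) = fock_proj Y"

definition iso_pair where
  "iso_pair X Y C D \<phi> \<psi> \<longleftrightarrow> 0 \<le> C \<and> 0 \<le> D \<and> bounded_hom X Y C \<phi> \<and> bounded_hom Y X D \<psi> \<and>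
     (\<forall>A\<in>tensor_algebra X. \<psi> (\<phi> A) = A) \<and> (\<forall>B\<in>tensor_algebra Y. \<phi> (\<psi> B) = B)"

text \<open>
  The algebraic part of \<open>intertwining_maps\<close>, with bijectivity replaced by a condition that makes sense
  for each direction of an inverse pair separately.
\<close>

definition intertwiner :: "'a fibres \<Rightarrow> 'b fibres \<Rightarrow> (nat \<Rightarrow> 'a list ell2 \<Rightarrow> 'b list ell2) \<Rightarrow> bool" where
  "intertwiner X Y V \<longleftrightarrow>
     (\<forall>n. \<forall>\<xi>\<in>X n. V n \<xi> \<in> Y n) \<and>
     (\<forall>n. \<forall>\<xi>\<in>X n. \<forall>\<eta>\<in>X n. V n (\<xi> + \<eta>) = V n \<xi> + V n \<eta>) \<and>
     (\<forall>n. \<forall>\<xi>\<in>X n. \<forall>c. V n (scaleC c \<xi>) = scaleC c (V n \<xi>)) \<and>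
     (\<forall>m n. \<forall>\<xi>\<in>X m. \<forall>\<eta>\<in>X n.
        V (m + n) (orth_proj (X (m + n)) (tensor m \<xi> \<eta>)) =
        orth_proj (Y (m + n)) (tensor m (V m \<xi>) (V n \<eta>)))"

locale subproduct_pair = X: subproduct X + Y: subproduct Y
  for X :: "'a::finite fibres" and Y :: "'b::finite fibres"
begin

lemma intertwinerD:
  assumes "intertwiner X Y V"
  shows "\<xi> \<in> X n \<Longrightarrow> V n \<xi> \<in> Y n"
    "\<xi> \<in> X n \<Longrightarrow> \<eta> \<in> X n \<Longrightarrow> V n (\<xi> + \<eta>) = V n \<xi> + V n \<eta>"
    "\<xi> \<in> X n \<Longrightarrow> V n (scaleC c \<xi>) = scaleC c (V n \<xi>)"
    "\<xi> \<in> X m \<Longrightarrow> \<eta> \<in> X n \<Longrightarrow> V (m + n) (X.p (m + n) (tensor m \<xi> \<eta>)) =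
        Y.p (m + n) (tensor m (V m \<xi>) (V n \<eta>))"
    "V n 0 = 0"
proof -
  show "V n 0 = 0"
    using assms X.fibre_closure(2)[of n] ell2.scale_zero_left
    unfolding intertwiner_def by metis
qed (use assms in \<open>auto simp: intertwiner_def\<close>)

lemma intertwiner_operator:
  assumes V: "intertwiner X Y V" and bound: "\<And>n \<xi>. \<xi> \<in> X n \<Longrightarrow> norm (V n \<xi>) \<le> C * norm \<xi>"
    and C: "0 \<le> C"
  obtains T where "norm T \<le> C" "\<And>n f. component n (blinfun_apply T f) = V n (X.p n (component n f))"
proof (rule graded_operator[of "\<lambda>n f. V n (X.p n (component n f))" C])
  note V' = intertwinerD[OF V]
  show "V n (X.p n (component n (f + g))) = V n (X.p n (component n f)) + V n (X.p n (component n g))"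
    for n f g by (simp add: component_add X.p_add V' X.p_in)
  show "V n (X.p n (component n (scaleC c f))) = scaleC c (V n (X.p n (component n f)))" for n c f
    by (simp add: component_scaleC X.p_scaleC V' X.p_in)
  show "V n (X.p n (component n f)) \<in> tensor_power n" for n f
    by (intro Y.fibre_tp V' X.p_in)
  show "norm (V n (X.p n (component n f))) \<le> C * norm (component n f)" for n f
    using bound[OF X.p_in, of n "component n f"] mult_left_mono[OF X.norm_p_le C] by (meson order_trans)
qed (use C that in auto)

end

text \<open>
  The multiplicativity of \<open>V\<close> turns the conjugate of the creation operator of \<open>\<xi>\<close> into the creation
  operator of \<open>V m \<xi>\<close>. So conjugation maps the span of the creation operators of \<open>X\<close> into that of \<open>Y\<close>,
  and by continuity one tensor algebra into the other.
\<close>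

lemma conj_bounded_hom:
  fixes X :: "'a::finite fibres" and Y :: "'b::finite fibres"
  assumes "subproduct_pair X Y" and V: "intertwiner X Y V"
    and WV: "\<And>n \<eta>. \<eta> \<in> Y n \<Longrightarrow> W n \<eta> \<in> X n \<and> V n (W n \<eta>) = \<eta>"
    and VW: "\<And>n \<xi>. \<xi> \<in> X n \<Longrightarrow> W n (V n \<xi>) = \<xi>"
    and S: "\<And>n f. component n (blinfun_apply S f) = V n (orth_proj (X n) (component n f))"
    and T: "\<And>n f. component n (blinfun_apply T f) = W n (orth_proj (Y n) (component n f))"
  defines "\<phi> \<equiv> \<lambda>A. S o\<^sub>L A o\<^sub>L T"
  shows "bounded_hom X Y (norm S * norm T) \<phi>"
    and "S o\<^sub>L T = fock_proj Y"
    and "\<xi> \<in> X m \<Longrightarrow> \<phi> (creation X m \<xi>) = creation Y m (V m \<xi>)"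
proof -
  interpret subproduct_pair X Y by fact
  note V' = intertwinerD[OF V]
  show ST: "S o\<^sub>L T = fock_proj Y"
    by (rule blinfun_eqI, rule component_eqI)
      (simp add: S T Y.component_P WV Y.p_in X.p_id)
  have TS: "T o\<^sub>L S = fock_proj X"
    by (rule blinfun_eqI, rule component_eqI)
      (simp add: S T X.component_P V' VW X.p_in Y.p_id)
  have SP: "S o\<^sub>L fock_proj X = S"
    by (rule blinfun_eqI, rule component_eqI) (simp add: S X.component_P X.p_id X.p_in)
  show creation: "\<phi> (creation X m \<xi>) = creation Y m (V m \<xi>)" if \<xi>: "\<xi> \<in> X m" for \<xi> m
  proof (rule blinfun_eqI, rule component_eqI)
    fix \<eta> k
    have V\<xi>: "V m \<xi> \<in> tensor_power m" by (rule Y.fibre_tp[OF V'(1)[OF \<xi>]])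
    have lhs: "component k (blinfun_apply (\<phi> (creation X m \<xi>)) \<eta>) =
        V k (X.p k (component k (tensor m \<xi> (blinfun_apply T \<eta>))))"
      by (simp add: \<phi>_def S X.creation_apply X.fibre_tp \<xi> X.component_P X.p_id X.p_in)
    have rhs: "component k (blinfun_apply (creation Y m (V m \<xi>)) \<eta>) =
        Y.p k (component k (tensor m (V m \<xi>) \<eta>))"
      by (simp add: Y.creation_apply V\<xi> Y.component_P)
    show "component k (blinfun_apply (\<phi> (creation X m \<xi>)) \<eta>) =
        component k (blinfun_apply (creation Y m (V m \<xi>)) \<eta>)"
    proof (cases "k < m")
      case True
      then show ?thesis unfolding lhs rhs
        by (simp add: component_tensor V\<xi> X.fibre_tp \<xi> X.p_zero Y.p_zero V')
    next
      case False
      let ?j = "k - m" let ?\<eta> = "Y.p ?j (component ?j \<eta>)"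
      have k: "k = m + ?j" using False by simp
      have "V k (X.p k (component k (tensor m \<xi> (blinfun_apply T \<eta>)))) =
          V (m + ?j) (X.p (m + ?j) (tensor m \<xi> (W ?j ?\<eta>)))"
        using False by (simp add: component_tensor X.fibre_tp \<xi> T)
      also have "\<dots> = Y.p (m + ?j) (tensor m (V m \<xi>) (V ?j (W ?j ?\<eta>)))"
        by (rule V'(4)[OF \<xi>]) (simp add: WV Y.p_in)
      also have "\<dots> = Y.p (m + ?j) (tensor m (V m \<xi>) ?\<eta>)" by (simp add: WV Y.p_in)
      also have "\<dots> = Y.p (m + ?j) (tensor m (V m \<xi>) (component ?j \<eta>))"
        by (rule Y.p_tensor_p_right[OF V\<xi>]) simp
      also have "\<dots> = Y.p k (component k (tensor m (V m \<xi>) \<eta>))"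
        using False by (simp add: component_tensor V\<xi>)
      finally show ?thesis unfolding lhs rhs .
    qed
  qed
  have add: "\<phi> (A + B) = \<phi> A + \<phi> B" for A B
    by (rule blinfun_eqI) (simp add: \<phi>_def plus_blinfun.rep_eq blinfun.add_right)
  have polys: "\<phi> A \<in> polys Y" if "A \<in> polys X" for A
    using that
    by (induction rule: polys.induct) (simp_all add: creation add polys.add polys.creation V')
  have norm_\<phi>: "norm (\<phi> A) \<le> norm S * norm T * norm A" for A
  proof -
    have "norm (\<phi> A) \<le> norm (S o\<^sub>L A) * norm T" unfolding \<phi>_def by (rule norm_blinfun_compose)
    also have "\<dots> \<le> norm S * norm A * norm T" by (intro mult_right_mono norm_blinfun_compose) simp
    finally show ?thesis by (simp add: mult_ac)
  qed
  have mem: "\<phi> A \<in> tensor_algebra Y" if A: "A \<in> tensor_algebra X" for A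
  proof -
    obtain a where a: "\<And>n. a n \<in> polys X" "a \<longlonglongrightarrow> A" using X.tensor_algebra_sequence[OF A] by metis
    have "(\<lambda>n. \<phi> (a n)) \<longlonglongrightarrow> \<phi> A"
      unfolding \<phi>_def
      by (intro bounded_bilinear.tendsto[OF bounded_bilinear_blinfun_compose] tendsto_const a)
    then show ?thesis
      unfolding Y.tensor_algebra_eq_closure closure_sequential using polys[OF a(1)]
      by (intro exI[of _ "\<lambda>n. \<phi> (a n)"]) simp
  qed
  show "bounded_hom X Y (norm S * norm T) \<phi>"
    unfolding bounded_hom_def
  proof (intro conjI ballI allI mem norm_\<phi> add)
    fix A B c assume A: "A \<in> tensor_algebra X" 
    have Sc: "blinfun_apply S (scaleC c f) = scaleC c (blinfun_apply S f)" for f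
      by (rule component_eqI)
        (simp add: S component_scaleC X.p_scaleC V' X.p_in)
    show "\<phi> (scaleC_op c o\<^sub>L A) = scaleC_op c o\<^sub>L \<phi> A"
      by (rule blinfun_eqI) (simp add: \<phi>_def Sc)
    assume B: "B \<in> tensor_algebra X"
    have "\<phi> A o\<^sub>L \<phi> B = S o\<^sub>L A o\<^sub>L ((T o\<^sub>L S) o\<^sub>L B) o\<^sub>L T"
      by (simp add: \<phi>_def blinfun_compose_assoc)
    also have "\<dots> = \<phi> (A o\<^sub>L B)"
      unfolding TS X.tensor_algebra_proj(1)[OF B] by (simp add: \<phi>_def blinfun_compose_assoc)
    finally show "\<phi> (A o\<^sub>L B) = \<phi> A o\<^sub>L \<phi> B" by simp
  next
    show "\<phi> (fock_proj X) = fock_proj Y" by (simp add: \<phi>_def SP ST)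
  qed
qed

text \<open>
  The inverse of an intertwiner is again one, so that \<open>conj_bounded_hom\<close> applies in both directions.
\<close>

lemma conj_iso_pair:
  fixes X :: "'a::finite fibres" and Y :: "'b::finite fibres"
  assumes XY: "subproduct_pair X Y" and V: "intertwining_maps X Y V"
    and C: "\<And>n \<xi>. \<xi> \<in> X n \<Longrightarrow> norm (V n \<xi>) \<le> C * norm \<xi>" "0 \<le> C"
    and D: "\<And>n \<eta>. \<eta> \<in> Y n \<Longrightarrow> norm (inv_into (X n) (V n) \<eta>) \<le> D * norm \<eta>" "0 \<le> D"
  obtains S T where "norm S \<le> C" "norm T \<le> D"
    "iso_pair X Y (C * D) (C * D) (\<lambda>A. S o\<^sub>L A o\<^sub>L T) (\<lambda>B. T o\<^sub>L B o\<^sub>L S)"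
    "\<And>m \<xi>. \<xi> \<in> X m \<Longrightarrow> S o\<^sub>L creation X m \<xi> o\<^sub>L T = creation Y m (V m \<xi>)"
proof -
  interpret subproduct_pair X Y by fact
  have YX: "subproduct_pair Y X" by unfold_locales
  interpret YX: subproduct_pair Y X by fact
  define W where "W n = inv_into (X n) (V n)" for n
  have bij: "bij_betw (V n) (X n) (Y n)" for n using V by (simp add: intertwining_maps_def)
  have V1: "V n \<xi> \<in> Y n" if "\<xi> \<in> X n" for n \<xi> using bij_betwE[OF bij] that by blast
  have WV: "W n \<eta> \<in> X n" "V n (W n \<eta>) = \<eta>" if "\<eta> \<in> Y n" for n \<eta>
    using bij_betw_inv_into_right[OF bij that] bij_betwE[OF bij_betw_inv_into[OF bij]] that
    by (auto simp: W_def)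
  have VW: "W n (V n \<xi>) = \<xi>" if "\<xi> \<in> X n" for n \<xi>
    using bij_betw_inv_into_left[OF bij that] by (simp add: W_def)
  have iV: "intertwiner X Y V"
    using V V1 by (simp add: intertwining_maps_def intertwiner_def)
  note V' = intertwinerD[OF iV]
  have iW: "intertwiner Y X W"
    unfolding intertwiner_def
  proof (intro conjI allI ballI)
    fix n \<xi> \<eta> c assume \<xi>: "\<xi> \<in> Y n"
    show "W n \<xi> \<in> X n" by (rule WV[OF \<xi>])
    have "W n (scaleC c (V n (W n \<xi>))) = scaleC c (W n \<xi>)"
      using VW[of "scaleC c (W n \<xi>)" n] by (simp add: V' WV(1)[OF \<xi>] X.fibre_closure)
    then show "W n (scaleC c \<xi>) = scaleC c (W n \<xi>)" by (simp add: WV \<xi>)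
    assume \<eta>: "\<eta> \<in> Y n"
    have "W n (V n (W n \<xi>) + V n (W n \<eta>)) = W n \<xi> + W n \<eta>"
      using VW[of "W n \<xi> + W n \<eta>" n] by (simp add: V' WV(1)[OF \<xi>] WV(1)[OF \<eta>] X.fibre_closure)
    then show "W n (\<xi> + \<eta>) = W n \<xi> + W n \<eta>" by (simp add: WV \<xi> \<eta>)
  next
    fix m n \<xi> \<eta> assume \<xi>: "\<xi> \<in> Y m" and \<eta>: "\<eta> \<in> Y n"
    have "Y.p (m + n) (tensor m \<xi> \<eta>) = V (m + n) (X.p (m + n) (tensor m (W m \<xi>) (W n \<eta>)))"
      using V'(4)[OF WV(1)[OF \<xi>] WV(1)[OF \<eta>]] by (simp add: WV \<xi> \<eta>)
    then show "W (m + n) (Y.p (m + n) (tensor m \<xi> \<eta>)) = X.p (m + n) (tensor m (W m \<xi>) (W n \<eta>))"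
      by (simp add: VW X.p_in)
  qed
  obtain S where S: "norm S \<le> C" "\<And>n f. component n (blinfun_apply S f) = V n (X.p n (component n f))"
    using intertwiner_operator[OF iV C] by metis
  obtain T where T: "norm T \<le> D" "\<And>n f. component n (blinfun_apply T f) = W n (Y.p n (component n f))"
    using YX.intertwiner_operator[OF iW _ D(2)] D(1) unfolding W_def by metis
  have 1: "bounded_hom X Y (norm S * norm T) (\<lambda>A. S o\<^sub>L A o\<^sub>L T)" "S o\<^sub>L T = fock_proj Y"
      "\<And>m \<xi>. \<xi> \<in> X m \<Longrightarrow> S o\<^sub>L creation X m \<xi> o\<^sub>L T = creation Y m (V m \<xi>)"
    using conj_bounded_hom[OF XY iV _ VW S(2) T(2)] WV by blast+
  have 2: "bounded_hom Y X (norm T * norm S) (\<lambda>A. T o\<^sub>L A o\<^sub>L S)" "T o\<^sub>L S = fock_proj X"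
    using conj_bounded_hom[OF YX iW _ WV(2) T(2) S(2)] V1 VW by blast+
  have mono: "bounded_hom X' Y' K \<theta> \<Longrightarrow> K \<le> K' \<Longrightarrow> bounded_hom X' Y' K' \<theta>"
    for X' :: "'x fibres" and Y' :: "'y fibres" and K K' \<theta>
    unfolding bounded_hom_def by (meson mult_right_mono norm_ge_zero order_trans)
  have ST: "norm S * norm T \<le> C * D" "norm T * norm S \<le> C * D"
    using mult_mono[OF S(1) T(1)] C(2) by (simp_all add: mult.commute)
  show ?thesis
  proof (rule that[OF S(1) T(1) _ 1(3)])
    have A: "T o\<^sub>L (S o\<^sub>L A o\<^sub>L T) o\<^sub>L S = A" if "A \<in> tensor_algebra X" for A
    proof -
      have "T o\<^sub>L (S o\<^sub>L A o\<^sub>L T) o\<^sub>L S = ((T o\<^sub>L S) o\<^sub>L A) o\<^sub>L (T o\<^sub>L S)"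
        by (simp add: blinfun_compose_assoc)
      then show ?thesis by (simp add: 2 X.tensor_algebra_proj[OF that])
    qed
    have B: "S o\<^sub>L (T o\<^sub>L B o\<^sub>L S) o\<^sub>L T = B" if "B \<in> tensor_algebra Y" for B
    proof -
      have "S o\<^sub>L (T o\<^sub>L B o\<^sub>L S) o\<^sub>L T = ((S o\<^sub>L T) o\<^sub>L B) o\<^sub>L (S o\<^sub>L T)"
        by (simp add: blinfun_compose_assoc)
      then show ?thesis by (simp add: 1(2) Y.tensor_algebra_proj[OF that])
    qed
    show "iso_pair X Y (C * D) (C * D) (\<lambda>A. S o\<^sub>L A o\<^sub>L T) (\<lambda>B. T o\<^sub>L B o\<^sub>L S)"
      unfolding iso_pair_def
      using mono[OF 1(1) ST(1)] mono[OF 2(1) ST(2)] A B mult_nonneg_nonneg[OF C(2) D(2)] by blast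
  qed
qed

section \<open>Moving the vacuum character\<close>

lemma bounded_homD:
  assumes "bounded_hom X Y C \<phi>"
  shows "A \<in> tensor_algebra X \<Longrightarrow> \<phi> A \<in> tensor_algebra Y"
    "A \<in> tensor_algebra X \<Longrightarrow> norm (\<phi> A) \<le> C * norm A"
    "A \<in> tensor_algebra X \<Longrightarrow> B \<in> tensor_algebra X \<Longrightarrow> \<phi> (A + B) = \<phi> A + \<phi> B"
    "A \<in> tensor_algebra X \<Longrightarrow> B \<in> tensor_algebra X \<Longrightarrow> \<phi> (A o\<^sub>L B) = \<phi> A o\<^sub>L \<phi> B"
    "A \<in> tensor_algebra X \<Longrightarrow> \<phi> (scaleC_op c o\<^sub>L A) = scaleC_op c o\<^sub>L \<phi> A"
    "\<phi> (fock_proj X) = fock_proj Y"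
  using assms by (auto simp: bounded_hom_def)

lemma iso_pairD:
  assumes "iso_pair X Y C D \<phi> \<psi>"
  shows "0 \<le> C" "0 \<le> D" "bounded_hom X Y C \<phi>" "bounded_hom Y X D \<psi>"
    "A \<in> tensor_algebra X \<Longrightarrow> \<psi> (\<phi> A) = A" "B \<in> tensor_algebra Y \<Longrightarrow> \<phi> (\<psi> B) = B"
  using assms by (auto simp: iso_pair_def)

lemma iso_pair_sym: "iso_pair X Y C D \<phi> \<psi> \<Longrightarrow> iso_pair Y X D C \<psi> \<phi>"
  by (auto simp: iso_pair_def)

lemma bounded_hom_compose:
  assumes \<phi>: "bounded_hom X Y C \<phi>" and \<theta>: "bounded_hom Y Z D \<theta>" and "0 \<le> D"
  shows "bounded_hom X Z (D * C) (\<theta> \<circ> \<phi>)"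
proof -
  have "norm (\<theta> (\<phi> A)) \<le> D * C * norm A" if "A \<in> tensor_algebra X" for A
    using bounded_homD(2)[OF \<theta> bounded_homD(1)[OF \<phi> that]]
      mult_left_mono[OF bounded_homD(2)[OF \<phi> that] \<open>0 \<le> D\<close>] by simp
  then show ?thesis
    unfolding bounded_hom_def o_def
    by (simp add: bounded_homD[OF \<phi>] bounded_homD[OF \<theta>])
qed

lemma iso_pair_trans:
  assumes 1: "iso_pair X Y C D \<phi> \<psi>" and 2: "iso_pair Y Z C' D' \<phi>' \<psi>'"
  shows "iso_pair X Z (C' * C) (D * D') (\<phi>' \<circ> \<phi>) (\<psi> \<circ> \<psi>')"
  unfolding iso_pair_def
  by (auto intro!: bounded_hom_compose iso_pairD[OF 1] iso_pairD[OF 2] mult_nonneg_nonneg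
      simp: iso_pairD[OF 1] iso_pairD[OF 2] bounded_homD(1)[OF iso_pairD(3)[OF 1]]
        bounded_homD(1)[OF iso_pairD(4)[OF 2]])

text \<open>
  A choice of the point provided by \<open>char_point\<close>, determined by the values of the character on
  creation operators of degree \<open>1\<close>.
\<close>

definition char_pt ::
    "'a fibres \<Rightarrow> (('a list ell2 \<Rightarrow>\<^sub>L 'a list ell2) \<Rightarrow> complex) \<Rightarrow> 'a list ell2" where
  "char_pt X \<kappa> = (SOME x. x \<in> zero_set X \<and> norm x \<le> 1 \<and>
     (\<forall>n. \<forall>\<xi>\<in>tensor_power n. \<kappa> (creation X n \<xi>) = cinner \<xi> (tensor_pow n x)))"

context subproduct
begin

lemma char_pt:
  assumes "bounded_character X \<kappa>"
  shows "char_pt X \<kappa> \<in> zero_set X" "norm (char_pt X \<kappa>) \<le> 1"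
    "\<xi> \<in> tensor_power n \<Longrightarrow> \<kappa> (L n \<xi>) = cinner \<xi> (tensor_pow n (char_pt X \<kappa>))"
proof -
  have "\<exists>x. x \<in> zero_set X \<and> norm x \<le> 1 \<and>
     (\<forall>n. \<forall>\<xi>\<in>tensor_power n. \<kappa> (creation X n \<xi>) = cinner \<xi> (tensor_pow n x))"
    using char_point[OF assms] by metis
  from someI_ex[OF this] show "char_pt X \<kappa> \<in> zero_set X" "norm (char_pt X \<kappa>) \<le> 1"
    "\<xi> \<in> tensor_power n \<Longrightarrow> \<kappa> (L n \<xi>) = cinner \<xi> (tensor_pow n (char_pt X \<kappa>))"
    by (auto simp: char_pt_def)
qed

lemma tensor_pow_1: "x \<in> tensor_power 1 \<Longrightarrow> tensor_pow 1 x = x"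
  using tensor_vacuum_right[of x 1] by simp

lemma zero_set_tp: "x \<in> zero_set X \<Longrightarrow> x \<in> tensor_power 1"
  by (simp add: zero_set_def)

lemma char_pt_tp: "bounded_character X \<kappa> \<Longrightarrow> char_pt X \<kappa> \<in> tensor_power 1"
  using char_pt(1) zero_set_tp by blast

lemma char_pt_1:
  assumes "bounded_character X \<kappa>" "\<xi> \<in> tensor_power 1"
  shows "\<kappa> (L 1 \<xi>) = cinner \<xi> (char_pt X \<kappa>)"
  using char_pt(3)[OF assms] by (simp only: tensor_pow_1[OF char_pt_tp[OF assms(1)]])

lemma char_eq_ev:
  assumes \<kappa>: "bounded_character X \<kappa>" and "norm (char_pt X \<kappa>) < 1" and A: "A \<in> tensor_algebra X"
  shows "\<kappa> A = ev (char_pt X \<kappa>) A"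
proof (rule char_eqI[OF \<kappa> bounded_character_ev[OF char_pt(1)[OF \<kappa>] assms(2)] _ A])
  fix n \<xi> assume "\<xi> \<in> X n"
  then show "\<kappa> (L n \<xi>) = ev (char_pt X \<kappa>) (L n \<xi>)"
    by (simp add: char_pt[OF \<kappa>] ev_creation fibre_tp)
qed

lemma norm_scaleC_less_1: "cmod c < 1 \<Longrightarrow> norm u \<le> 1 \<Longrightarrow> norm (scaleC c u) < 1"
  by (simp add: norm_scaleC) (metis mult_left_le norm_ge_zero order_le_less_trans)

text \<open>
  On a complex line through \<open>0\<close> evaluation is a power series in the (conjugated) parameter.
\<close>

lemma ev_holomorphic:
  assumes u: "u \<in> tensor_power 1" "norm u \<le> 1"
  shows "(\<lambda>z. ev (scaleC (cnj z) u) A) holomorphic_on ball 0 1"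
proof (rule power_series_holomorphic)
  fix z :: complex assume z: "z \<in> ball 0 1"
  have "norm (scaleC (cnj z) u) < 1"
    using z u(2) by (simp add: norm_scaleC_less_1)
  then have "summable (\<lambda>n. cinner (coefficient n A) (tensor_pow n (scaleC (cnj z) u)))"
    using summable_norm_cancel[OF summable_ev[of "scaleC (cnj z) u"]] u tensor_power_closure by blast
  then have "(\<lambda>n. cinner (coefficient n A) (tensor_pow n (scaleC (cnj z) u))) sums ev (scaleC (cnj z) u) A"
    by (simp add: ev_def summable_sums)
  then show "(\<lambda>n. cinner (coefficient n A) (tensor_pow n u) * (z - 0) ^ n) sums ev (scaleC (cnj z) u) A"
    by (simp add: tensor_pow_scaleC mult.commute)
qed

lemma bounded_character_ev_0: "bounded_character X (ev 0)"
  by (rule bounded_character_ev[OF zero_in_zero_set]) simp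

lemma ev_vacuum: "ev 0 A = cinner (coefficient 0 A) vacuum"
proof -
  have "ev 0 A = (\<Sum>n\<in>{0}. cinner (coefficient n A) (tensor_pow n 0))"
    unfolding ev_def
  proof (rule suminf_finite)
    fix n :: nat assume "n \<notin> {0}"
    then show "cinner (coefficient n A) (tensor_pow n 0) = 0" by (cases n) auto
  qed simp
  then show ?thesis by simp
qed

end

lemma bounded_character_compose:
  assumes "subproduct Y" and \<phi>: "bounded_hom X Y C \<phi>" and \<kappa>: "bounded_character Y \<kappa>"
  shows "bounded_character X (\<kappa> \<circ> \<phi>)"
proof -
  interpret subproduct Y by fact
  have "cmod (\<kappa> (\<phi> A)) \<le> C * norm A" if "A \<in> tensor_algebra X" for A
    using char_contractive[OF \<kappa> bounded_homD(1)[OF \<phi> that]] bounded_homD(2)[OF \<phi> that] by simp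
  then show ?thesis
    unfolding bounded_character_def o_def
    by (auto simp: bounded_homD[OF \<phi>] char_simps[OF \<kappa>])
qed

context subproduct_pair
begin

lemma disc_in_ball_hom:
  assumes \<phi>: "bounded_hom X Y C \<phi>" and u: "u \<in> zero_set Y" "norm u \<le> 1"
  shows "disc_in_ball (\<lambda>z. char_pt X (ev (scaleC (cnj z) u) \<circ> \<phi>))"
proof
  have ch: "bounded_character X (ev (scaleC (cnj z) u) \<circ> \<phi>)" if "cmod z < 1" for z
  proof (rule bounded_character_compose[OF Y.subproduct_axioms \<phi> Y.bounded_character_ev])
    show "scaleC (cnj z) u \<in> zero_set Y" by (rule Y.zero_set_scaleC[OF u(1)])
    show "norm (scaleC (cnj z) u) < 1"
      using that u(2) by (simp add: Y.norm_scaleC_less_1)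
  qed
  show "norm (char_pt X (ev (scaleC (cnj z) u) \<circ> \<phi>)) \<le> 1" if "cmod z < 1" for z
    by (rule X.char_pt(2)[OF ch[OF that]])
  fix \<xi>
  have "(\<lambda>z. ev (scaleC (cnj z) u) (\<phi> (X.L 1 (component 1 \<xi>)))) holomorphic_on ball 0 1"
    by (rule Y.ev_holomorphic[OF Y.zero_set_tp[OF u(1)] u(2)])
  moreover have "ev (scaleC (cnj z) u) (\<phi> (X.L 1 (component 1 \<xi>))) =
      cinner \<xi> (char_pt X (ev (scaleC (cnj z) u) \<circ> \<phi>))" if "z \<in> ball 0 1" for z
  proof -
    have c: "bounded_character X (ev (scaleC (cnj z) u) \<circ> \<phi>)" using ch that by simp
    show ?thesis
      using X.char_pt_1[OF c component_in, of \<xi>] cinner_component_left[OF X.char_pt_tp[OF c], of \<xi>]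
      by simp
  qed
  ultimately show "(\<lambda>z. cinner \<xi> (char_pt X (ev (scaleC (cnj z) u) \<circ> \<phi>))) holomorphic_on ball 0 1"
    by (rule holomorphic_transform)
qed

text \<open>
  Otherwise the induced map of points, which sends the disc through \<open>a\<close> into the closed ball and \<open>0\<close>
  to the sphere, would be constant on this disc. As \<open>\<phi>\<close> is surjective, the characters at \<open>0\<close> and
  \<open>u / 2\<close> would coincide, but they differ at the creation operator of \<open>u\<close>.
\<close>

lemma point_norm_less_1:
  assumes iso: "iso_pair X Y C D \<phi> \<psi>" and a: "a \<in> zero_set Y" "a \<noteq> 0"
  shows "norm (char_pt X (ev 0 \<circ> \<phi>)) < 1"
proof (rule ccontr)
  note \<phi> = iso_pairD(3)[OF iso] and \<psi> = iso_pairD(4)[OF iso]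
  define u where "u = scaleC (of_real (1 / norm a)) a"
  have u: "u \<in> zero_set Y" "norm u = 1"
    using a by (auto simp: u_def norm_scaleC norm_divide intro: Y.zero_set_scaleC)
  interpret disc_in_ball "\<lambda>z. char_pt X (ev (scaleC (cnj z) u) \<circ> \<phi>)"
    using disc_in_ball_hom[OF \<phi> u(1)] u(2) by simp
  let ?y = "scaleC (cnj (1/2)) u"
  have y: "?y \<in> zero_set Y" "norm ?y < 1" using u by (auto simp: norm_scaleC intro: Y.zero_set_scaleC)
  have ey: "bounded_character Y (ev ?y)" by (rule Y.bounded_character_ev[OF y])
  assume "\<not> ?thesis"
  then have "norm (char_pt X (ev 0 \<circ> \<phi>)) = 1"
    using X.char_pt(2)[OF bounded_character_compose[OF Y.subproduct_axioms \<phi> Y.bounded_character_ev_0]] by simp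
  then have pt: "char_pt X (ev ?y \<circ> \<phi>) = char_pt X (ev 0 \<circ> \<phi>)"
    using constant_of_boundary[of 0 "1/2"] by simp
  have "(ev ?y \<circ> \<phi>) A = (ev 0 \<circ> \<phi>) A" if "A \<in> tensor_algebra X" for A
  proof (rule X.char_eqI[OF _ _ _ that])
    show c: "bounded_character X (ev ?y \<circ> \<phi>)" "bounded_character X (ev 0 \<circ> \<phi>)"
      by (rule bounded_character_compose[OF Y.subproduct_axioms \<phi>], rule ey Y.bounded_character_ev_0)+
    show "(ev ?y \<circ> \<phi>) (X.L n \<xi>) = (ev 0 \<circ> \<phi>) (X.L n \<xi>)" if "\<xi> \<in> X n" for n \<xi>
      using X.char_pt(3)[OF c(1) X.fibre_tp[OF that]] X.char_pt(3)[OF c(2) X.fibre_tp[OF that]] pt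
      by simp
  qed
  from this[of "\<psi> (Y.L 1 u)"]
  have "ev ?y (Y.L 1 u) = ev 0 (Y.L 1 u)"
    using Y.creation_mem[OF Y.zero_set_tp[OF u(1)]] iso_pairD(6)[OF iso] bounded_homD(1)[OF \<psi>]
    by simp
  moreover have "ev 0 (Y.L 1 u) = 0"
    using Y.ev_creation[OF Y.zero_set_tp[OF u(1)] Y.zero_in_zero_set] by simp
  moreover have "ev ?y (Y.L 1 u) = 1/2"
    using Y.ev_creation[OF Y.zero_set_tp[OF u(1)] y(1)] u(2)
    by (simp only: Y.tensor_pow_1[OF Y.zero_set_tp[OF y(1)]]) (simp add: cinner_same)
  ultimately show False by simp
qed

text \<open>
  Pulling \<open>ev 0\<close> back along \<open>\<psi>\<close> and then along \<open>\<phi>\<close> gives \<open>ev 0\<close> again, and in between it is the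
  evaluation at its point.
\<close>

lemma hom_at_preimage:
  assumes iso: "iso_pair X Y C D \<phi> \<psi>" and a: "norm (char_pt Y (ev 0 \<circ> \<psi>)) < 1"
    and A: "A \<in> tensor_algebra X"
  shows "ev (char_pt Y (ev 0 \<circ> \<psi>)) (\<phi> A) = ev 0 A"
proof -
  note \<phi> = iso_pairD(3)[OF iso] and \<psi> = iso_pairD(4)[OF iso]
  have "bounded_character Y (ev 0 \<circ> \<psi>)"
    by (rule bounded_character_compose[OF X.subproduct_axioms \<psi> X.bounded_character_ev_0])
  from Y.char_eq_ev[OF this a bounded_homD(1)[OF \<phi> A]] show ?thesis
    by (simp add: iso_pairD(5)[OF iso A])
qed

text \<open>
  The curve to which the Schwarz lemma is applied: the image, under the map of points induced by
  \<open>\<phi>\<close>, of the disc through the point \<open>a\<close> that is mapped to \<open>0\<close>.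
\<close>

lemma disc_setup:
  assumes iso: "iso_pair X Y C D \<phi> \<psi>"
    and a: "a = char_pt Y (ev 0 \<circ> \<psi>)" "a \<noteq> 0" "norm a < 1"
  defines "u \<equiv> scaleC (of_real (1 / norm a)) a"
  defines "H \<equiv> \<lambda>z. char_pt X (ev (scaleC (cnj z) u) \<circ> \<phi>)"
  shows "disc_in_ball H" "H 0 = char_pt X (ev 0 \<circ> \<phi>)" "H (of_real (norm a)) = 0"
    "u \<in> zero_set Y" "norm u = 1"
proof -
  note \<phi> = iso_pairD(3)[OF iso] and \<psi> = iso_pairD(4)[OF iso]
  have "bounded_character Y (ev 0 \<circ> \<psi>)"
    by (rule bounded_character_compose[OF X.subproduct_axioms \<psi> X.bounded_character_ev_0])
  then have az: "a \<in> zero_set Y" unfolding a(1) by (rule Y.char_pt)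
  show u: "u \<in> zero_set Y" "norm u = 1"
    using a az by (auto simp: u_def norm_scaleC norm_divide intro: Y.zero_set_scaleC)
  show "disc_in_ball H" unfolding H_def using disc_in_ball_hom[OF \<phi> u(1)] u(2) by simp
  show "H 0 = char_pt X (ev 0 \<circ> \<phi>)" by (simp add: H_def)
  have "scaleC (cnj (of_real (norm a))) u = a"
    using a(2) by (simp only: u_def ell2.scale_scale) (simp flip: of_real_mult)
  then have "H (of_real (norm a)) = char_pt X (ev a \<circ> \<phi>)" by (simp add: H_def)
  also have "\<dots> = 0"
  proof -
    have "bounded_character X (ev a \<circ> \<phi>)"
      by (rule bounded_character_compose[OF Y.subproduct_axioms \<phi> Y.bounded_character_ev[OF az a(3)]])
    note c = X.char_pt_1[OF this X.char_pt_tp[OF this]] X.char_pt_tp[OF this]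
    have "cinner (char_pt X (ev a \<circ> \<phi>)) (char_pt X (ev a \<circ> \<phi>)) = ev 0 (X.L 1 (char_pt X (ev a \<circ> \<phi>)))"
      using hom_at_preimage[OF iso _ X.creation_mem[OF c(2)]] a c(1) by simp
    also have "\<dots> = 0" using X.ev_creation[OF c(2) X.zero_in_zero_set] by simp
    finally show ?thesis by (simp add: cinner_same)
  qed
  finally show "H (of_real (norm a)) = 0" .
qed

lemma point_norm_le:
  assumes iso: "iso_pair X Y C D \<phi> \<psi>"
    and a: "a = char_pt Y (ev 0 \<circ> \<psi>)" "a \<noteq> 0" "norm a < 1"
  shows "norm (char_pt X (ev 0 \<circ> \<phi>)) \<le> norm a"
proof (cases "char_pt X (ev 0 \<circ> \<phi>) = 0")
  case False
  note d = disc_setup[OF iso a]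
  interpret disc_in_ball "\<lambda>z. char_pt X (ev (scaleC (cnj z) (scaleC (of_real (1 / norm a)) a)) \<circ> \<phi>)"
    by (rule d)
  show ?thesis by (rule schwarz(1)[OF _ a(3) d(2) d(3) False]) simp
qed simp

end

text \<open>
  Multiplication by \<open>c ^ n\<close> on the fibre of degree \<open>n\<close> is a unitary intertwiner of \<open>X\<close> with itself; the
  automorphism that it implements rotates the points of characters.
\<close>

lemma (in subproduct) gauge:
  assumes c: "cmod c = 1"
  obtains \<gamma> \<gamma>' where "iso_pair X X 1 1 \<gamma> \<gamma>'"
    "\<And>x A. x \<in> zero_set X \<Longrightarrow> norm x < 1 \<Longrightarrow> A \<in> tensor_algebra X \<Longrightarrow> ev x (\<gamma> A) = ev (scaleC (cnj c) x) A"
proof -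
  have XX: "subproduct_pair X X" by unfold_locales
  let ?V = "\<lambda>n. scaleC (c ^ n) :: 'a list ell2 \<Rightarrow> _"
  have c0: "c \<noteq> 0" using c by auto
  have inv: "scaleC (c ^ n) (scaleC (inverse c ^ n) \<xi>) = \<xi>" "scaleC (inverse c ^ n) (scaleC (c ^ n) \<xi>) = \<xi>"
    for n \<xi>
  proof -
    have e: "c ^ n * inverse c ^ n = 1" "inverse c ^ n * c ^ n = 1"
      using c0 by (simp_all add: power_inverse)
    show "scaleC (c ^ n) (scaleC (inverse c ^ n) \<xi>) = \<xi>"
      "scaleC (inverse c ^ n) (scaleC (c ^ n) \<xi>) = \<xi>" by (simp_all only: ell2.scale_scale ell2.scale_one e)
  qed
  have inj: "inj_on (?V n) (X n)" for n by (rule inj_on_inverseI[where g = "scaleC (inverse c ^ n)"]) (rule inv)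
  have bij: "bij_betw (?V n) (X n) (X n)" for n
    unfolding bij_betw_def
  proof (intro conjI inj equalityI subsetI)
    show "\<xi> \<in> ?V n ` X n" if "\<xi> \<in> X n" for \<xi>
      using that inv(1)[of n \<xi>] by (intro image_eqI[of _ _ "scaleC (inverse c ^ n) \<xi>"]) (auto intro: fibre_closure)
  qed (auto intro: fibre_closure)
  have V: "intertwining_maps X X ?V"
    unfolding intertwining_maps_def
    by (auto simp: bij ell2.scale_right_distrib p_scaleC tensor_scaleC_left tensor_scaleC_right
        power_add mult_ac)
  have n1: "norm (?V n \<xi>) \<le> 1 * norm \<xi>" for n \<xi> using c by (simp add: norm_scaleC norm_power)
  have n2: "norm (inv_into (X n) (?V n) \<xi>) \<le> 1 * norm \<xi>" if "\<xi> \<in> X n" for n \<xi>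
  proof -
    have "inv_into (X n) (?V n) \<xi> = scaleC (inverse c ^ n) \<xi>"
      by (rule inv_into_f_eq[OF inj fibre_closure(5)[OF that] inv(1)])
    then show ?thesis using c by (simp add: norm_scaleC norm_power norm_inverse)
  qed
  obtain S T where ST: "iso_pair X X (1 * 1) (1 * 1) (\<lambda>A. S o\<^sub>L A o\<^sub>L T) (\<lambda>B. T o\<^sub>L B o\<^sub>L S)"
    "\<And>m \<xi>. \<xi> \<in> X m \<Longrightarrow> S o\<^sub>L L m \<xi> o\<^sub>L T = L m (scaleC (c ^ m) \<xi>)"
    by (rule conj_iso_pair[OF XX V n1 _ n2]) auto
  show ?thesis
  proof (rule that[of "\<lambda>A. S o\<^sub>L A o\<^sub>L T"])
    show "iso_pair X X 1 1 (\<lambda>A. S o\<^sub>L A o\<^sub>L T) (\<lambda>B. T o\<^sub>L B o\<^sub>L S)" using ST(1) by simp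
    fix x A assume x: "x \<in> zero_set X" "norm x < 1" and A: "A \<in> tensor_algebra X"
    have cx: "scaleC (cnj c) x \<in> zero_set X" "norm (scaleC (cnj c) x) < 1"
      using x c by (auto simp: norm_scaleC intro: zero_set_scaleC)
    have "(ev x \<circ> (\<lambda>A. S o\<^sub>L A o\<^sub>L T)) A = ev (scaleC (cnj c) x) A"
    proof (rule char_eqI[OF _ bounded_character_ev[OF cx] _ A])
      show "bounded_character X (ev x \<circ> (\<lambda>A. S o\<^sub>L A o\<^sub>L T))"
        by (rule bounded_character_compose[OF subproduct_axioms iso_pairD(3)[OF ST(1)] bounded_character_ev[OF x]])
      show "(ev x \<circ> (\<lambda>A. S o\<^sub>L A o\<^sub>L T)) (L n \<xi>) = ev (scaleC (cnj c) x) (L n \<xi>)" if "\<xi> \<in> X n" for n \<xi>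
        using x(1) cx(1) that
        by (simp add: ST(2) ev_creation fibre_tp fibre_closure tensor_pow_scaleC tensor_power_closure)
    qed
    then show "ev x (S o\<^sub>L A o\<^sub>L T) = ev (scaleC (cnj c) x) A" by simp
  qed
qed

text \<open>
  Write \<open>F\<close> for the map of points induced by \<open>\<phi>\<close>, so that \<open>b = F 0\<close> and \<open>F a = 0\<close>. By the Schwarz
  lemma \<open>a\<close> and \<open>b\<close> have the same norm \<open>s\<close> and \<open>F\<close> maps the disc of \<open>a\<close> to that of \<open>b\<close> by \<open>disc_flip s\<close>. With
  \<open>\<omega>\<close> from \<open>disc_flip_circle\<close>, rotating \<open>b\<close> by the conjugate of \<open>\<omega>\<close> gives a point \<open>F y\<close> where \<open>y\<close> again has norm \<open>s\<close>; so \<open>y\<close>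
  is a rotation of \<open>a\<close>. The points thus move along
  \<open>0 \<mapsto> b \<mapsto> F y \<mapsto> y \<mapsto> a \<mapsto> 0\<close>, where the steps are \<open>F\<close>, a rotation, the inverse of \<open>F\<close>, a rotation and
  \<open>F\<close>. When \<open>a\<close> or \<open>b\<close> vanishes, \<open>\<phi>\<close> itself preserves the vacuum character.
\<close>

theorem (in subproduct_pair) vacuum_preserving:
  assumes iso: "iso_pair X Y C D \<phi> \<psi>"
  obtains C' D' \<phi>' \<psi>' where "iso_pair X Y C' D' \<phi>' \<psi>'"
    "\<And>A. A \<in> tensor_algebra X \<Longrightarrow> ev 0 (\<phi>' A) = ev 0 A" "C = 1 \<Longrightarrow> D = 1 \<Longrightarrow> C' = 1 \<and> D' = 1"
proof -
  interpret YX: subproduct_pair Y X by unfold_locales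
  note \<phi> = iso_pairD(3)[OF iso] and \<psi> = iso_pairD(4)[OF iso]
  note osi = iso_pair_sym[OF iso]
  define a where "a = char_pt Y (ev 0 \<circ> \<psi>)"
  define b where "b = char_pt X (ev 0 \<circ> \<phi>)"
  have ca: "bounded_character Y (ev 0 \<circ> \<psi>)" and cb: "bounded_character X (ev 0 \<circ> \<phi>)"
    by (rule bounded_character_compose[OF X.subproduct_axioms \<psi> X.bounded_character_ev_0],
        rule bounded_character_compose[OF Y.subproduct_axioms \<phi> Y.bounded_character_ev_0])
  have az: "a \<in> zero_set Y" and bz: "b \<in> zero_set X"
    unfolding a_def b_def by (rule Y.char_pt[OF ca], rule X.char_pt[OF cb])
  show ?thesis
  proof (cases "a = 0 \<or> b = 0")
    case True
    have "ev 0 (\<phi> A) = ev 0 A" if A: "A \<in> tensor_algebra X" for A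
      using True
    proof
      assume "a = 0"
      then show ?thesis using hom_at_preimage[OF iso _ A] by (simp add: a_def)
    next
      assume "b = 0"
      then show ?thesis using X.char_eq_ev[OF cb _ A] by (simp add: b_def)
    qed
    then show ?thesis using that[OF iso] by blast
  next
    case False
    then have a0: "a \<noteq> 0" and b0: "b \<noteq> 0" by auto
    have b1: "norm b < 1" unfolding b_def by (rule point_norm_less_1[OF iso az a0])
    have a1: "norm a < 1" unfolding a_def by (rule YX.point_norm_less_1[OF osi bz b0])
    have "norm b \<le> norm a" unfolding b_def by (rule point_norm_le[OF iso a_def a0 a1])
    moreover have "norm a \<le> norm b" unfolding a_def by (rule YX.point_norm_le[OF osi b_def b0 b1])
    ultimately have ab: "norm b = norm a" by simp
    define s where "s = norm a"
    have s: "0 < s" "s < 1" using a0 a1 by (simp_all add: s_def)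
    define u where "u = scaleC (of_real (1 / norm a)) a"
    note d = disc_setup[OF iso a_def a0 a1, folded u_def b_def s_def]
    interpret disc_in_ball "\<lambda>z. char_pt X (ev (scaleC (cnj z) u) \<circ> \<phi>)" by (rule d(1))
    obtain \<omega> where \<omega>: "cmod \<omega> = 1" "cmod (disc_flip s (\<omega> * of_real s)) = s"
      using disc_flip_circle[OF s] .
    define z where "z = disc_flip s (\<omega> * of_real s)"
    have z: "cmod z < 1" "cmod z = s" using \<omega> s by (simp_all add: z_def)
    have fz: "disc_flip s z = \<omega> * of_real s"
      unfolding z_def using s \<omega>(1) by (intro disc_flip(5)) (simp_all add: norm_mult)
    define y where "y = scaleC (cnj z) u"
    have y: "y \<in> zero_set Y" "norm y < 1"
      using d(4,5) z by (auto simp: y_def norm_scaleC intro: Y.zero_set_scaleC)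
    have "char_pt X (ev y \<circ> \<phi>) = scaleC (cnj (disc_flip s z) / of_real s) b"
      unfolding y_def
      by (rule schwarz_equality[OF s d(2) d(3) _ z(1)]) (simp add: ab s_def)
    also have "\<dots> = scaleC (cnj \<omega>) b" unfolding fz using s by simp
    finally have pt_y: "char_pt X (ev y \<circ> \<phi>) = scaleC (cnj \<omega>) b" .
    obtain \<gamma> \<gamma>' where \<gamma>: "iso_pair X X 1 1 \<gamma> \<gamma>'"
      "\<And>x A. x \<in> zero_set X \<Longrightarrow> norm x < 1 \<Longrightarrow> A \<in> tensor_algebra X \<Longrightarrow>
        ev x (\<gamma> A) = ev (scaleC (cnj \<omega>) x) A"
      using X.gauge[OF \<omega>(1)] by metis
    \<comment> \<open>Gauge automorphisms rotate points by the conjugate: multiplying \<open>y\<close> by \<open>cnj \<tau>\<close> gives \<open>a\<close>.\<close>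
    define \<tau> where "\<tau> = of_real s / z"
    have \<tau>: "cmod \<tau> = 1" using z s by (simp add: \<tau>_def norm_divide)
    have z0: "z \<noteq> 0" using z s by auto
    obtain \<delta> \<delta>' where \<delta>: "iso_pair Y Y 1 1 \<delta> \<delta>'"
      "\<And>x A. x \<in> zero_set Y \<Longrightarrow> norm x < 1 \<Longrightarrow> A \<in> tensor_algebra Y \<Longrightarrow>
        ev x (\<delta> A) = ev (scaleC (cnj \<tau>) x) A"
      using Y.gauge[OF \<tau>] by metis
    have \<tau>y: "scaleC (cnj \<tau>) y = a"
      using z0 a0 s by (simp add: \<tau>_def y_def u_def s_def)
    note \<gamma>h = iso_pairD(3)[OF \<gamma>(1)] and \<delta>h = iso_pairD(3)[OF \<delta>(1)]
    let ?\<theta> = "\<phi> \<circ> (\<gamma> \<circ> (\<psi> \<circ> (\<delta> \<circ> \<phi>)))"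
    have iso': "iso_pair X Y (C * (1 * (D * (1 * C)))) ((((D * 1) * C) * 1) * D) ?\<theta>
        ((((\<psi> \<circ> \<delta>') \<circ> \<phi>) \<circ> \<gamma>') \<circ> \<psi>)"
      using iso_pair_trans[OF iso_pair_trans[OF iso_pair_trans[OF iso_pair_trans[OF iso \<delta>(1)] osi] \<gamma>(1)] iso]
      by (simp add: o_assoc mult_ac)
    show ?thesis
    proof (rule that[OF iso'])
      fix A assume A: "A \<in> tensor_algebra X"
      note m1 = bounded_homD(1)[OF \<phi> A]
      note m2 = bounded_homD(1)[OF \<delta>h m1]
      note m3 = bounded_homD(1)[OF \<psi> m2]
      note m4 = bounded_homD(1)[OF \<gamma>h m3]
      have "ev 0 (?\<theta> A) = (ev 0 \<circ> \<phi>) (\<gamma> (\<psi> (\<delta> (\<phi> A))))" by simp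
      also have "\<dots> = ev b (\<gamma> (\<psi> (\<delta> (\<phi> A))))"
        unfolding b_def by (rule X.char_eq_ev[OF cb _ m4]) (use b1 in \<open>simp add: b_def\<close>)
      also have "\<dots> = ev (scaleC (cnj \<omega>) b) (\<psi> (\<delta> (\<phi> A)))" by (rule \<gamma>(2)[OF bz b1 m3])
      also have "\<dots> = (ev y \<circ> \<phi>) (\<psi> (\<delta> (\<phi> A)))"
        unfolding pt_y[symmetric]
      proof (rule X.char_eq_ev[OF _ _ m3, symmetric])
        show "bounded_character X (ev y \<circ> \<phi>)"
          by (rule bounded_character_compose[OF Y.subproduct_axioms \<phi> Y.bounded_character_ev[OF y]])
        show "norm (char_pt X (ev y \<circ> \<phi>)) < 1" using b1 \<omega>(1) by (simp add: pt_y norm_scaleC)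
      qed
      also have "\<dots> = ev y (\<delta> (\<phi> A))" by (simp add: iso_pairD(6)[OF iso m2])
      also have "\<dots> = ev a (\<phi> A)" using \<delta>(2)[OF y m1] by (simp add: \<tau>y)
      also have "\<dots> = ev 0 A" using hom_at_preimage[OF iso _ A] a1 by (simp add: a_def)
      finally show "ev 0 (?\<theta> A) = ev 0 A" .
    qed simp
  qed
qed

section \<open>Similarities from vacuum-preserving isomorphisms\<close>

text \<open>
  The filtration of the tensor algebra by the order of vanishing at the vacuum character.
\<close>

definition vanishes_below :: "nat \<Rightarrow> ('a list ell2 \<Rightarrow>\<^sub>L 'a list ell2) \<Rightarrow> bool" where
  "vanishes_below m A \<longleftrightarrow> (\<forall>k<m. coefficient k A = 0)"

lemma (in subproduct) vanishes_below_mult: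
  assumes "A \<in> tensor_algebra X" "vanishes_below m A" "vanishes_below n B"
  shows "vanishes_below (m + n) (A o\<^sub>L B)"
  unfolding vanishes_below_def
proof (intro allI impI)
  fix k assume k: "k < m + n"
  have "p k (tensor i (coefficient i A) (coefficient (k - i) B)) = 0" if "i \<le> k" for i
  proof (cases "i < m")
    case False
    then have "k - i < n" using k that by linarith
    then show ?thesis using assms(3) by (simp add: vanishes_below_def p_zero)
  qed (use assms(2) in \<open>simp add: vanishes_below_def p_zero\<close>)
  then show "coefficient k (A o\<^sub>L B) = 0" by (simp add: coeff_mult assms(1))
qed

lemma bounded_hom_zero: "bounded_hom X Y C \<phi> \<Longrightarrow> \<phi> 0 = 0"
proof -
  assume "bounded_hom X Y C \<phi>"
  moreover have "0 \<in> tensor_algebra X"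
    using tensor_algebra_closure(6)[OF tensor_algebra_closure(2) tensor_algebra_closure(2), of X] by simp
  ultimately have "\<phi> (0 + 0) = \<phi> 0 + \<phi> 0" by (intro bounded_homD(3))
  then show ?thesis by simp
qed

lemma bounded_hom_diff:
  assumes \<phi>: "bounded_hom X Y C \<phi>" and "A \<in> tensor_algebra X" "B \<in> tensor_algebra X"
  shows "\<phi> (A - B) = \<phi> A - \<phi> B"
proof -
  have "\<phi> (A + (scaleC_op (-1) o\<^sub>L B)) = \<phi> A + (scaleC_op (-1) o\<^sub>L \<phi> B)"
    by (simp only: bounded_homD(3,5)[OF \<phi>] assms tensor_algebra_closure(4))
  then show ?thesis by (simp only: scaleC_op_compose_diff)
qed

context subproduct_pair
begin

context
  fixes C \<phi>
  assumes \<phi>: "bounded_hom X Y C \<phi>" and C: "0 \<le> C"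
    and vacuum: "\<And>A. A \<in> tensor_algebra X \<Longrightarrow> ev 0 (\<phi> A) = ev 0 A"
begin

text \<open>
  In degree \<open>1\<close> this is the hypothesis on \<open>ev 0\<close>. The creation operator of a word of length \<open>n\<close> is a
  product of \<open>n\<close> creation operators of degree \<open>1\<close>, and orders of vanishing add up.
\<close>

lemma vanishes_below_creation:
  assumes "\<xi> \<in> tensor_power n"
  shows "vanishes_below n (\<phi> (X.L n \<xi>))"
  using assms
proof (induction rule: tensor_power_induct)
  case (basis w)
  then show ?case
  proof (induction w arbitrary: n)
    case (Cons i w)
    let ?A = "X.L 1 (basis_vec [i])" and ?B = "X.L (length w) (basis_vec w)"
    have A: "?A \<in> tensor_algebra X" and B: "?B \<in> tensor_algebra X"
      by (rule X.creation_mem; simp)+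
    have "ev 0 (\<phi> ?A) = 0"
      using X.ev_creation[of "basis_vec [i]" 1, OF _ X.zero_in_zero_set]
      unfolding vacuum[OF A] by simp
    then have "Rep_ell2 (coefficient 0 (\<phi> ?A)) [] = 0"
      by (simp add: Y.ev_vacuum cinner_basis_vec)
    moreover have "coefficient 0 (\<phi> ?A) \<in> tensor_power 0" by (simp add: coefficient_def)
    ultimately have "Rep_ell2 (coefficient 0 (\<phi> ?A)) w = 0" for w
      using tensor_power_zeroD[of "coefficient 0 (\<phi> ?A)" 0 w] by (cases "w = []") auto
    then have "coefficient 0 (\<phi> ?A) = 0" by (intro ell2_eqI) (simp add: zero_ell2.rep_eq)
    then have "vanishes_below 1 (\<phi> ?A)" by (simp add: vanishes_below_def)
    then have "vanishes_below (1 + length w) (\<phi> ?A o\<^sub>L \<phi> ?B)"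
      by (rule Y.vanishes_below_mult[OF bounded_homD(1)[OF \<phi> A]]) (rule Cons.IH[OF refl])
    moreover have "?A o\<^sub>L ?B = X.L n (basis_vec (i # w))"
      using Cons.prems[symmetric] by (simp add: X.creation_mult tensor_basis_vec)
    then have "\<phi> ?A o\<^sub>L \<phi> ?B = \<phi> (X.L n (basis_vec (i # w)))"
      using bounded_homD(4)[OF \<phi> A B] by metis
    ultimately show ?case using Cons.prems by simp
  qed (simp add: vanishes_below_def)
next
  case (add f g)
  then show ?case
    by (simp add: X.creation_add bounded_homD(3)[OF \<phi>] X.creation_mem vanishes_below_def coeff_add)
next
  case (scale c f)
  then show ?case
    by (simp add: X.creation_scaleC bounded_homD(5)[OF \<phi>] X.creation_mem vanishes_below_def coeff_scaleC)
qed

text \<open>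
  An element \<open>A\<close> of order \<open>m\<close> is a limit of polynomials, but these need not have order \<open>m\<close>. Removing the
  coefficients below \<open>m\<close> is a bounded operation \<open>R\<close> that fixes \<open>A\<close> and maps polynomials to polynomials
  of order \<open>m\<close>, to which \<open>vanishes_below_creation\<close> applies.
\<close>

lemma vanishes_below_hom:
  assumes A: "A \<in> tensor_algebra X" and "vanishes_below m A"
  shows "vanishes_below m (\<phi> A)"
  unfolding vanishes_below_def
proof (intro allI impI)
  fix k assume k: "k < m"
  define R where "R A = A - (\<Sum>j<m. X.L j (coefficient j A))" for A
  define G where "G A = coefficient k (\<phi> (R A))" for A
  have ct: "coefficient j A \<in> tensor_power j" for j and A :: "'a list ell2 \<Rightarrow>\<^sub>L 'a list ell2"
    by (simp add: coefficient_def)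
  have LT: "X.L j (coefficient j A) \<in> tensor_algebra X" for j A
    by (rule X.creation_mem[OF ct])
  have zero: "0 \<in> tensor_algebra X"
    using tensor_algebra_closure(6)[OF A A] by simp
  have sumT: "(\<Sum>j\<in>J. X.L j (coefficient j A)) \<in> tensor_algebra X" if "finite J" for J A
    using that by (induction J) (simp_all add: zero tensor_algebra_closure LT)
  have RT: "R B \<in> tensor_algebra X" if "B \<in> tensor_algebra X" for B
    unfolding R_def by (intro tensor_algebra_closure that sumT) simp
  have Radd: "R (A + B) = R A + R B" for A B
    by (simp add: R_def coeff_add X.creation_add ct sum.distrib)
  have Gadd: "G (A + B) = G A + G B" if "A \<in> tensor_algebra X" "B \<in> tensor_algebra X" for A B
    using that by (simp add: G_def Radd bounded_homD(3)[OF \<phi>] RT coeff_add)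
  have Gbound: "norm (G B) \<le> C * (1 + real m) * norm B" if B: "B \<in> tensor_algebra X" for B
  proof -
    have "norm (\<Sum>j<m. X.L j (coefficient j B)) \<le> (\<Sum>j<m. norm B)"
      by (rule sum_norm_le) (meson X.norm_creation_le[OF ct] norm_coeff_le order_trans)
    then have "norm (R B) \<le> (1 + real m) * norm B"
      unfolding R_def using norm_triangle_ineq4[of B "\<Sum>j<m. X.L j (coefficient j B)"]
      by (simp add: algebra_simps)
    moreover have "norm (G B) \<le> norm (\<phi> (R B))" unfolding G_def by (rule norm_coeff_le)
    moreover have "norm (\<phi> (R B)) \<le> C * norm (R B)" by (rule bounded_homD(2)[OF \<phi> RT[OF B]])
    ultimately show ?thesis using mult_left_mono[of "norm (R B)" _ C] C by (smt (verit) mult.assoc)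
  qed
  have Gpoly: "G B = 0" if "B \<in> polys X" for B
    using that
  proof (induction rule: polys.induct)
    case (creation \<xi> n)
    have "(\<Sum>j<m. X.L j (coefficient j (X.L n \<xi>))) = (\<Sum>j<m. if j = n then X.L n \<xi> else 0)"
      using creation
      by (intro sum.cong) (simp_all add: X.coeff_creation X.fibre_tp X.p_id X.creation_zero)
    then have "R (X.L n \<xi>) = (if n < m then 0 else X.L n \<xi>)" by (simp add: R_def)
    then show ?case
      using vanishes_below_creation[OF X.fibre_tp[OF creation]] k
      by (simp add: G_def bounded_hom_zero[OF \<phi>] vanishes_below_def)
  next
    case (add A B)
    then have "A \<in> tensor_algebra X" "B \<in> tensor_algebra X" using X.polys_subset by auto
    with add show ?case by (simp add: Gadd)
  qed
  obtain a where a: "\<And>n. a n \<in> polys X" "a \<longlonglongrightarrow> A" using X.tensor_algebra_sequence[OF A] by metis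
  have aT: "a n \<in> tensor_algebra X" for n using a(1) X.polys_subset by auto
  have "norm (G A) \<le> C * (1 + real m) * norm (A - a n)" for n
  proof -
    have "G A = G ((A - a n) + a n)" by simp
    also have "\<dots> = G (A - a n)"
      by (subst Gadd) (simp_all add: A aT tensor_algebra_closure Gpoly a)
    finally show ?thesis using Gbound[of "A - a n"] by (simp add: A aT tensor_algebra_closure)
  qed
  moreover have "(\<lambda>n. C * (1 + real m) * norm (A - a n)) \<longlonglongrightarrow> C * (1 + real m) * norm (A - A)"
    by (intro tendsto_intros a)
  ultimately have "norm (G A) \<le> C * (1 + real m) * norm (A - A)"
    by (intro LIMSEQ_le_const) auto
  then have "G A = 0" by simp
  moreover have "R A = A"
    using assms(2) by (simp add: R_def vanishes_below_def X.creation_zero)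
  ultimately show "coefficient k (\<phi> A) = 0" by (simp add: G_def)
qed

lemma leading_coeff_bound:
  assumes "\<xi> \<in> X n"
  shows "norm (coefficient n (\<phi> (X.L n \<xi>))) \<le> C * norm \<xi>"
proof -
  have "norm (coefficient n (\<phi> (X.L n \<xi>))) \<le> norm (\<phi> (X.L n \<xi>))" by (rule norm_coeff_le)
  also have "\<dots> \<le> C * norm (X.L n \<xi>)"
    by (rule bounded_homD(2)[OF \<phi> X.creation_mem[OF X.fibre_tp[OF assms]]])
  finally show ?thesis by (simp add: X.norm_creation assms)
qed

lemma leading_coeff_in: "\<xi> \<in> X n \<Longrightarrow> coefficient n (\<phi> (X.L n \<xi>)) \<in> Y n"
  by (rule Y.coeff_in[OF bounded_homD(1)[OF \<phi> X.creation_mem[OF X.fibre_tp]]])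

text \<open>
  In the convolution of two elements of orders \<open>m\<close> and \<open>n\<close>, only one term has total degree \<open>m + n\<close>.
\<close>

lemma leading_coeff_mult:
  assumes \<xi>: "\<xi> \<in> X m" and \<eta>: "\<eta> \<in> X n"
  shows "coefficient (m + n) (\<phi> (X.L (m + n) (X.p (m + n) (tensor m \<xi> \<eta>)))) =
    Y.p (m + n) (tensor m (coefficient m (\<phi> (X.L m \<xi>))) (coefficient n (\<phi> (X.L n \<eta>))))"
proof -
  note t = X.fibre_tp[OF \<xi>] X.fibre_tp[OF \<eta>]
  let ?A = "\<phi> (X.L m \<xi>)" and ?B = "\<phi> (X.L n \<eta>)"
  let ?f = "\<lambda>i. Y.p (m + n) (tensor i (coefficient i ?A) (coefficient (m + n - i) ?B))"
  have A: "?A \<in> tensor_algebra Y" by (rule bounded_homD(1)[OF \<phi> X.creation_mem[OF t(1)]])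
  have "\<phi> (X.L (m + n) (X.p (m + n) (tensor m \<xi> \<eta>))) = ?A o\<^sub>L ?B"
    by (simp add: X.creation_p tensor_in t X.creation_mem flip: X.creation_mult bounded_homD(4)[OF \<phi>])
  then have "coefficient (m + n) (\<phi> (X.L (m + n) (X.p (m + n) (tensor m \<xi> \<eta>)))) = (\<Sum>i\<le>m + n. ?f i)"
    by (simp add: Y.coeff_mult[OF A])
  also have "\<dots> = (\<Sum>i\<in>{m}. ?f i)"
  proof (rule sum.mono_neutral_right)
    show "\<forall>i\<in>{..m + n} - {m}. ?f i = 0"
    proof
      fix i assume i: "i \<in> {..m + n} - {m}"
      show "?f i = 0"
      proof (cases "i < m")
        case True
        then show ?thesis
          using vanishes_below_creation[OF t(1)] by (simp add: vanishes_below_def Y.p_zero)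
      next
        case False
        then have "m + n - i < n" using i by auto
        then show ?thesis
          using vanishes_below_creation[OF t(2)] by (simp add: vanishes_below_def Y.p_zero)
      qed
    qed
  qed auto
  finally show ?thesis by simp
qed

end

text \<open>
  \<open>\<phi>\<close> of the creation operator of \<open>\<xi>\<close> differs from the creation operator of its leading coefficient by an
  element of order \<open>n + 1\<close>, and \<open>\<psi>\<close> preserves this order. So applying \<open>\<psi>\<close> leaves an error that is not
  visible in degree \<open>n\<close>.
\<close>

lemma leading_coeff_inverse:
  assumes iso: "iso_pair X Y C D \<phi> \<psi>"
    and vacuum: "\<And>A. A \<in> tensor_algebra X \<Longrightarrow> ev 0 (\<phi> A) = ev 0 A"
    and vacuum': "\<And>B. B \<in> tensor_algebra Y \<Longrightarrow> ev 0 (\<psi> B) = ev 0 B"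
    and \<xi>: "\<xi> \<in> X n"
  shows "coefficient n (\<psi> (Y.L n (coefficient n (\<phi> (X.L n \<xi>))))) = \<xi>"
proof -
  interpret YX: subproduct_pair Y X by unfold_locales
  note \<phi> = iso_pairD(3)[OF iso] and \<psi> = iso_pairD(4)[OF iso]
  have LX: "X.L n \<xi> \<in> tensor_algebra X" by (rule X.creation_mem[OF X.fibre_tp[OF \<xi>]])
  have c: "coefficient n (\<phi> (X.L n \<xi>)) \<in> Y n" by (rule Y.coeff_in[OF bounded_homD(1)[OF \<phi> LX]])
  let ?B = "\<phi> (X.L n \<xi>)" and ?B' = "Y.L n (coefficient n (\<phi> (X.L n \<xi>)))"
  have B: "?B \<in> tensor_algebra Y" "?B' \<in> tensor_algebra Y"
    by (rule bounded_homD(1)[OF \<phi> LX], rule Y.creation_mem[OF Y.fibre_tp[OF c]])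
  have "vanishes_below n ?B"
    by (rule vanishes_below_creation[OF \<phi> iso_pairD(1)[OF iso] vacuum X.fibre_tp[OF \<xi>]])
  then have "vanishes_below (Suc n) (?B - ?B')"
    by (simp add: vanishes_below_def coeff_diff Y.coeff_creation Y.fibre_tp[OF c] Y.p_id c less_Suc_eq)
  then have "vanishes_below (Suc n) (\<psi> (?B - ?B'))"
    by (intro YX.vanishes_below_hom[OF \<psi> iso_pairD(2)[OF iso] vacuum'] tensor_algebra_closure B)
  moreover have "\<psi> (?B - ?B') = X.L n \<xi> - \<psi> ?B'"
    by (simp add: bounded_hom_diff[OF \<psi> B] iso_pairD(5)[OF iso LX])
  ultimately have "coefficient n (X.L n \<xi>) = coefficient n (\<psi> ?B')"
    by (simp add: vanishes_below_def coeff_diff)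
  then show ?thesis by (simp add: X.coeff_creation X.fibre_tp \<xi> X.p_id)
qed

theorem intertwining_of_iso_pair:
  assumes iso: "iso_pair X Y C D \<phi> \<psi>"
    and vacuum: "\<And>A. A \<in> tensor_algebra X \<Longrightarrow> ev 0 (\<phi> A) = ev 0 A"
  obtains V where "intertwining_maps X Y V"
    "\<And>n \<xi>. \<xi> \<in> X n \<Longrightarrow> norm (V n \<xi>) \<le> C * norm \<xi>"
    "\<And>n \<eta>. \<eta> \<in> Y n \<Longrightarrow> norm (inv_into (X n) (V n) \<eta>) \<le> D * norm \<eta>"
proof -
  interpret YX: subproduct_pair Y X by unfold_locales
  note \<phi> = iso_pairD(3)[OF iso] and \<psi> = iso_pairD(4)[OF iso]
  have vacuum': "ev 0 (\<psi> B) = ev 0 B" if "B \<in> tensor_algebra Y" for B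
    using vacuum[OF bounded_homD(1)[OF \<psi> that]] iso_pairD(6)[OF iso that] by simp
  define V where "V n \<xi> = coefficient n (\<phi> (X.L n \<xi>))" for n \<xi>
  define W where "W n \<eta> = coefficient n (\<psi> (Y.L n \<eta>))" for n \<eta>
  have V: "V n \<xi> \<in> Y n" if "\<xi> \<in> X n" for n \<xi>
    unfolding V_def by (rule leading_coeff_in[OF \<phi> iso_pairD(1)[OF iso] vacuum that])
  have W: "W n \<eta> \<in> X n" if "\<eta> \<in> Y n" for n \<eta>
    unfolding W_def by (rule YX.leading_coeff_in[OF \<psi> iso_pairD(2)[OF iso] vacuum' that])
  have WV: "W n (V n \<xi>) = \<xi>" if "\<xi> \<in> X n" for n \<xi>
    unfolding V_def W_def by (rule leading_coeff_inverse[OF iso vacuum vacuum' that])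
  have VW: "V n (W n \<eta>) = \<eta>" if "\<eta> \<in> Y n" for n \<eta>
    unfolding V_def W_def by (rule YX.leading_coeff_inverse[OF iso_pair_sym[OF iso] vacuum' vacuum that])
  have bij: "bij_betw (V n) (X n) (Y n)" for n
    by (rule bij_betw_byWitness[where f' = "W n"]) (auto simp: V W WV VW)
  show ?thesis
  proof (rule that)
    show "intertwining_maps X Y V"
      unfolding intertwining_maps_def
    proof (intro conjI allI ballI bij)
      fix n c \<xi> assume \<xi>: "\<xi> \<in> X n"
      note t = X.fibre_tp[OF \<xi>]
      show "V n (scaleC c \<xi>) = scaleC c (V n \<xi>)"
        by (simp add: V_def X.creation_scaleC t bounded_homD(5)[OF \<phi>] X.creation_mem coeff_scaleC)
      show "V n (\<xi> + \<eta>) = V n \<xi> + V n \<eta>" if "\<eta> \<in> X n" for \<eta>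
        using X.fibre_tp[OF that] t
        by (simp add: V_def X.creation_add bounded_homD(3)[OF \<phi>] X.creation_mem coeff_add)
    next
      fix m n \<xi> \<eta> assume \<xi>: "\<xi> \<in> X m" and \<eta>: "\<eta> \<in> X n"
      show "V (m + n) (X.p (m + n) (tensor m \<xi> \<eta>)) = Y.p (m + n) (tensor m (V m \<xi>) (V n \<eta>))"
        unfolding V_def by (rule leading_coeff_mult[OF \<phi> iso_pairD(1)[OF iso] vacuum \<xi> \<eta>])
    qed
    show "norm (V n \<xi>) \<le> C * norm \<xi>" if "\<xi> \<in> X n" for n \<xi>
      unfolding V_def by (rule leading_coeff_bound[OF \<phi> iso_pairD(1)[OF iso] vacuum that])
    show "norm (inv_into (X n) (V n) \<eta>) \<le> D * norm \<eta>" if \<eta>: "\<eta> \<in> Y n" for n \<eta>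
    proof -
      have "inv_into (X n) (V n) \<eta> = W n \<eta>"
        using bij_betw_inv_into_left[OF bij W[OF \<eta>]] VW[OF \<eta>] by simp
      then show ?thesis
        unfolding W_def using YX.leading_coeff_bound[OF \<psi> iso_pairD(2)[OF iso] vacuum' \<eta>] by simp
    qed
  qed
qed

end

section \<open>The bounded inverse theorem\<close>

text \<open>
  The Banach isomorphism theorem between closed subspaces. By Baire's theorem the closure of the image
  \<open>E k\<close> of some ball contains an open ball of \<open>S'\<close>, so every \<open>y\<close> is approximated up to half its norm by
  the image of a vector of norm at most \<open>K * norm y\<close>. Correcting the error repeatedly gives a
  geometric series of preimages.
\<close>

lemma bounded_inverse:
  fixes f :: "'x::banach \<Rightarrow> 'y::banach"
  assumes S: "subspace S" "closed S" and S': "subspace S'" "closed S'"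
    and add: "\<And>x y. x \<in> S \<Longrightarrow> y \<in> S \<Longrightarrow> f (x + y) = f x + f y"
    and scale: "\<And>r x. x \<in> S \<Longrightarrow> f (r *\<^sub>R x) = r *\<^sub>R f x"
    and bound: "\<And>x. x \<in> S \<Longrightarrow> norm (f x) \<le> C * norm x"
    and bij: "bij_betw f S S'"
  obtains D where "0 \<le> D" "\<And>y. y \<in> S' \<Longrightarrow> norm (inv_into S f y) \<le> D * norm y"
proof -
  have fS: "f x \<in> S'" if "x \<in> S" for x using bij_betwE[OF bij] that by blast
  have f0: "f 0 = 0" using scale[of 0 0] S(1) by (simp add: subspace_0)
  have diff: "f (x - y) = f x - f y" if "x \<in> S" "y \<in> S" for x y
    using add[of x "(-1) *\<^sub>R y"] scale[of y "-1"] that S(1) by (simp add: subspace_scale subspace_neg)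
  define E where "E k = f ` {x \<in> S. norm x \<le> real k}" for k :: nat
  let ?T = "top_of_set S'"
  have "\<exists>k. ?T interior_of (closure (E k)) \<noteq> {}"
  proof (rule ccontr)
    assume "\<nexists>k. ?T interior_of (closure (E k)) \<noteq> {}"
    then have int: "?T interior_of (closure (E k)) = {}" for k by blast
    have "?T interior_of \<Union>(range (\<lambda>k. closure (E k))) = {}"
    proof (rule Baire_category_alt)
      have "completely_metrizable_space ?T"
        by (rule completely_metrizable_space_closedin[OF completely_metrizable_space_euclidean])
          (use S'(2) in \<open>simp add: closed_closedin[symmetric]\<close>)
      then show "completely_metrizable_space ?T \<or> locally_compact_space ?T \<and> regular_space ?T" ..
      fix T assume "T \<in> range (\<lambda>k. closure (E k))"
      then obtain k where T: "T = closure (E k)" by auto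
      have "closure (E k) \<subseteq> S'" by (rule closure_minimal) (auto simp: E_def fS S')
      then show "closedin ?T T \<and> ?T interior_of T = {}"
        using int T by (auto intro: closed_subset)
    qed simp
    moreover have "S' \<subseteq> \<Union>(range (\<lambda>k. closure (E k)))"
    proof
      fix y assume "y \<in> S'"
      then obtain x where x: "x \<in> S" "f x = y" using bij by (auto simp: bij_betw_def)
      obtain k :: nat where "norm x \<le> real k" using real_arch_simple by blast
      then have "y \<in> E k" using x by (auto simp: E_def)
      then show "y \<in> \<Union>(range (\<lambda>k. closure (E k)))" using closure_subset by blast
    qed
    then have "S' \<subseteq> ?T interior_of \<Union>(range (\<lambda>k. closure (E k)))"
      by (intro interior_of_maximal) simp_all
    moreover have "0 \<in> S'" using S'(1) by (rule subspace_0)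
    ultimately show False by blast
  qed
  then obtain k y0 where y0: "y0 \<in> ?T interior_of (closure (E k))" by blast
  then obtain U where U: "openin ?T U" "y0 \<in> U" "U \<subseteq> closure (E k)"
    by (auto simp: interior_of_def)
  have y0S: "y0 \<in> S'" using U openin_subset[OF U(1)] by auto
  obtain e where e: "e > 0" "ball y0 e \<inter> S' \<subseteq> U"
    using U(1,2) by (auto simp: openin_contains_ball)
  \<comment> \<open>Differences of two points of the open ball around \<open>y0\<close> fill a ball around \<open>0\<close>, at the cost of
        doubling the radius \<open>k\<close>.\<close>
  have approx: "\<exists>x\<in>S. norm x \<le> 2 * real k \<and> norm (y - f x) < \<epsilon>"
    if y: "y \<in> S'" "norm y < e" and \<epsilon>: "\<epsilon> > 0" for y \<epsilon>
  proof -
    have "y0 + y \<in> ball y0 e \<inter> S'" using y y0S S'(1) by (simp add: subspace_add dist_norm)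
    then have "y0 + y \<in> closure (E k)" "y0 \<in> closure (E k)" using e U by auto
    then obtain z1 z2 where z: "z1 \<in> E k" "dist z1 (y0 + y) < \<epsilon>/2" "z2 \<in> E k" "dist z2 y0 < \<epsilon>/2"
      using \<epsilon> unfolding closure_approachable by (meson half_gt_zero)
    then obtain x1 x2 where x: "x1 \<in> S" "norm x1 \<le> real k" "f x1 = z1" "x2 \<in> S" "norm x2 \<le> real k" "f x2 = z2"
      by (auto simp: E_def)
    have "norm (y - f (x1 - x2)) = norm ((y0 + y - z1) - (y0 - z2))"
      using x by (simp add: diff algebra_simps)
    also have "\<dots> \<le> norm (y0 + y - z1) + norm (y0 - z2)" by (rule norm_triangle_ineq4)
    also have "\<dots> < \<epsilon>" using z by (simp add: dist_norm norm_minus_commute)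
    finally have "norm (y - f (x1 - x2)) < \<epsilon>" .
    moreover have "norm (x1 - x2) \<le> 2 * real k"
      using norm_triangle_ineq4[of x1 x2] x by linarith
    ultimately show ?thesis using x S(1) by (intro bexI[of _ "x1 - x2"]) (simp_all add: subspace_diff)
  qed
  \<comment> \<open>Rescaling \<open>y\<close> to norm \<open>e / 2\<close> multiplies the bound \<open>2 * k\<close> by \<open>2 * norm y / e\<close>.\<close>
  define K where "K = 4 * real k / e"
  have K0: "0 \<le> K" using e by (simp add: K_def)
  have "\<exists>x. x \<in> S \<and> norm x \<le> K * norm y \<and> norm (y - f x) \<le> norm y / 2" if y: "y \<in> S'" for y
  proof (cases "y = 0")
    case True
    then show ?thesis using f0 S(1) by (intro exI[of _ 0]) (simp add: subspace_0)
  next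
    case False
    \<comment> \<open>Chosen so that \<open>y / r\<close> has norm \<open>e / 2\<close>.\<close>
    define r where "r = 2 * norm y / e"
    have r: "r > 0" using False e by (simp add: r_def)
    have "norm (inverse r *\<^sub>R y) = e / 2" using False e by (simp add: r_def)
    then have "inverse r *\<^sub>R y \<in> S'" "norm (inverse r *\<^sub>R y) < e"
      using y S'(1) e by (simp_all add: subspace_scale)
    then obtain x where x: "x \<in> S" "norm x \<le> 2 * real k" "norm (inverse r *\<^sub>R y - f x) < e / 4"
      using approx[of "inverse r *\<^sub>R y" "e / 4"] e by auto
    have "y - f (r *\<^sub>R x) = r *\<^sub>R (inverse r *\<^sub>R y - f x)"
      using x r by (simp add: scale scaleR_right_diff_distrib)
    then have "norm (y - f (r *\<^sub>R x)) = r * norm (inverse r *\<^sub>R y - f x)" using r by simp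
    also have "\<dots> \<le> r * (e / 4)" using x(3) r by (intro mult_left_mono) auto
    also have "\<dots> = norm y / 2" using e by (simp add: r_def)
    finally have 1: "norm (y - f (r *\<^sub>R x)) \<le> norm y / 2" .
    have "norm (r *\<^sub>R x) \<le> r * (2 * real k)" using x r by (simp add: mult_left_mono)
    also have "\<dots> = K * norm y" by (simp add: r_def K_def)
    finally show ?thesis using 1 x S(1) by (intro exI[of _ "r *\<^sub>R x"]) (simp add: subspace_scale)
  qed
  then obtain h where h: "\<And>y. y \<in> S' \<Longrightarrow> h y \<in> S" "\<And>y. y \<in> S' \<Longrightarrow> norm (h y) \<le> K * norm y"
      "\<And>y. y \<in> S' \<Longrightarrow> norm (y - f (h y)) \<le> norm y / 2"
    by metis
  show ?thesis
  proof (rule that[of "2 * K"])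
    show "0 \<le> 2 * K" using K0 by simp
    fix y assume y: "y \<in> S'"
    define Y where "Y n = ((\<lambda>y. y - f (h y)) ^^ n) y" for n
    have YS: "Y n \<in> S'" for n
      by (induction n) (simp_all add: Y_def y subspace_diff[OF S'(1)] fS h)
    have Yn: "norm (Y n) \<le> norm y * (1/2) ^ n" for n
    proof (induction n)
      case (Suc n)
      have "norm (Y (Suc n)) \<le> norm (Y n) / 2" using h(3)[OF YS[of n]] by (simp add: Y_def)
      then show ?case using Suc by simp
    qed (simp add: Y_def)
    have hn: "norm (h (Y n)) \<le> K * norm y * (1/2) ^ n" for n
      using order_trans[OF h(2)[OF YS] mult_left_mono[OF Yn K0]] by (simp add: mult.assoc)
    have geo: "(\<lambda>n. K * norm y * (1/2::real) ^ n) sums (K * norm y * 2)"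
      using sums_mult[OF geometric_sums[of "1/2::real"], of "K * norm y"] by simp
    have summ: "summable (\<lambda>n. h (Y n))"
      by (rule summable_comparison_test'[OF sums_summable[OF geo]]) (rule hn)
    let ?x = "suminf (\<lambda>n. h (Y n))"
    have lim: "(\<lambda>n. \<Sum>i<n. h (Y i)) \<longlonglongrightarrow> ?x" by (rule summable_LIMSEQ[OF summ])
    have pS: "(\<Sum>i<n. h (Y i)) \<in> S" for n by (intro subspace_sum[OF S(1)] h YS)
    have xS: "?x \<in> S" by (rule closed_sequentially[OF S(2) pS lim])
    have fp: "f (\<Sum>i<n. h (Y i)) = y - Y n" for n
    proof (induction n)
      case (Suc n)
      have "f ((\<Sum>i<n. h (Y i)) + h (Y n)) = f (\<Sum>i<n. h (Y i)) + f (h (Y n))"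
        by (intro add pS h YS)
      then show ?case using Suc by (simp add: Y_def)
    qed (simp add: Y_def f0)
    have "(\<lambda>n. f (\<Sum>i<n. h (Y i))) \<longlonglongrightarrow> f ?x"
    proof (rule LIM_zero_cancel, rule Lim_null_comparison)
      show "\<forall>\<^sub>F n in sequentially. norm (f (\<Sum>i<n. h (Y i)) - f ?x) \<le> C * norm ((\<Sum>i<n. h (Y i)) - ?x)"
        using bound[OF subspace_diff[OF S(1) pS xS]] by (simp add: diff pS xS)
      show "(\<lambda>n. C * norm ((\<Sum>i<n. h (Y i)) - ?x)) \<longlonglongrightarrow> 0"
        using tendsto_mult_right_zero[OF tendsto_norm_zero[OF LIM_zero[OF lim]]] by simp
    qed
    moreover have "(\<lambda>n. f (\<Sum>i<n. h (Y i))) \<longlonglongrightarrow> y - 0"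
      unfolding fp
    proof (intro tendsto_diff tendsto_const Lim_null_comparison[where f = Y])
      show "\<forall>\<^sub>F n in sequentially. norm (Y n) \<le> norm y * (1/2) ^ n" using Yn by simp
      show "(\<lambda>n. norm y * (1/2::real) ^ n) \<longlonglongrightarrow> 0"
        by (intro tendsto_mult_right_zero LIMSEQ_realpow_zero) auto
    qed
    ultimately have "f ?x = y" using LIMSEQ_unique by force
    then have "inv_into S f y = ?x" using xS bij by (metis bij_betw_inv_into_left)
    moreover have "norm ?x \<le> K * norm y * 2"
      using norm_suminf_le[OF hn sums_summable[OF geo]] sums_unique[OF geo] by simp
    ultimately show "norm (inv_into S f y) \<le> 2 * K * norm y" by (simp add: mult_ac)
  qed
qed

section \<open>Operator matrices\<close>

lemma matrix_apply_bounded: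
  fixes A :: "nat \<Rightarrow> nat \<Rightarrow> 'b ell2 \<Rightarrow>\<^sub>L 'b ell2"
  shows "bdd_above ((\<lambda>\<xi>. L2_set (\<lambda>i. norm (\<Sum>j<n. blinfun_apply (A i j) (\<xi> j))) {..<n}) `
     {\<xi>. L2_set (\<lambda>j. norm (\<xi> j)) {..<n} \<le> 1})"
proof (rule bdd_aboveI2)
  fix \<xi> :: "nat \<Rightarrow> 'b ell2" assume "\<xi> \<in> {\<xi>. L2_set (\<lambda>j. norm (\<xi> j)) {..<n} \<le> 1}"
  then have \<xi>: "norm (\<xi> j) \<le> 1" if "j < n" for j
    using that member_le_L2_set[of "{..<n}" j "\<lambda>j. norm (\<xi> j)"] by simp
  have "L2_set (\<lambda>i. norm (\<Sum>j<n. blinfun_apply (A i j) (\<xi> j))) {..<n} \<le>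
      (\<Sum>i<n. norm (\<Sum>j<n. blinfun_apply (A i j) (\<xi> j)))"
    by (rule L2_set_le_sum) simp
  also have "\<dots> \<le> (\<Sum>i<n. \<Sum>j<n. norm (A i j))"
  proof (intro sum_mono order_trans[OF norm_sum])
    fix i j assume "j \<in> {..<n}"
    then show "norm (blinfun_apply (A i j) (\<xi> j)) \<le> norm (A i j)"
      using norm_blinfun[of "A i j" "\<xi> j"] mult_left_mono[OF \<xi>, of j "norm (A i j)"] by simp
  qed
  finally show "L2_set (\<lambda>i. norm (\<Sum>j<n. blinfun_apply (A i j) (\<xi> j))) {..<n} \<le>
      (\<Sum>i<n. \<Sum>j<n. norm (A i j))" .
qed

text \<open>
  Rescaling to the unit ball of the direct sum, over which the supremum is taken.
\<close>

lemma matrix_norm_apply: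
  fixes A :: "nat \<Rightarrow> nat \<Rightarrow> 'b ell2 \<Rightarrow>\<^sub>L 'b ell2"
  shows "L2_set (\<lambda>i. norm (\<Sum>j<n. blinfun_apply (A i j) (\<xi> j))) {..<n} \<le>
     matrix_norm n A * L2_set (\<lambda>j. norm (\<xi> j)) {..<n}"
proof (cases "L2_set (\<lambda>j. norm (\<xi> j)) {..<n} = 0")
  case True
  then have "\<xi> j = 0" if "j < n" for j using that by (simp add: L2_set_eq_0_iff)
  then show ?thesis using True by (simp add: L2_set_def)
next
  case False
  define r where "r = L2_set (\<lambda>j. norm (\<xi> j)) {..<n}"
  have r: "r > 0" using False L2_set_nonneg[of "\<lambda>j. norm (\<xi> j)" "{..<n}"]
    by (metis less_eq_real_def r_def)
  have sc: "L2_set (\<lambda>j. norm (inverse r *\<^sub>R \<zeta> j)) {..<n} = inverse r * L2_set (\<lambda>j. norm (\<zeta> j)) {..<n}"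
    for \<zeta> :: "nat \<Rightarrow> 'b ell2"
    using r by (simp add: L2_set_right_distrib)
  have "L2_set (\<lambda>i. norm (\<Sum>j<n. blinfun_apply (A i j) (inverse r *\<^sub>R \<xi> j))) {..<n} \<le> matrix_norm n A"
    unfolding matrix_norm_def
    by (rule cSUP_upper[OF _ matrix_apply_bounded]) (use r in \<open>simp only: mem_Collect_eq sc, simp add: r_def\<close>)
  moreover have "(\<Sum>j<n. blinfun_apply (A i j) (inverse r *\<^sub>R \<xi> j)) =
      inverse r *\<^sub>R (\<Sum>j<n. blinfun_apply (A i j) (\<xi> j))" for i
    by (simp add: blinfun.scaleR_right scaleR_sum_right)
  ultimately have "inverse r * L2_set (\<lambda>i. norm (\<Sum>j<n. blinfun_apply (A i j) (\<xi> j))) {..<n} \<le> matrix_norm n A"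
    by (simp only: sc)
  then show ?thesis using r by (simp add: r_def[symmetric] field_simps)
qed

lemma matrix_norm_nonneg: "0 \<le> matrix_norm n A"
proof -
  have "L2_set (\<lambda>i. norm (\<Sum>j<n. blinfun_apply (A i j) 0)) {..<n} \<le> matrix_norm n A"
    unfolding matrix_norm_def
    by (rule cSUP_upper[OF _ matrix_apply_bounded]) (simp add: L2_set_def)
  then show ?thesis by (simp add: L2_set_def)
qed

lemma matrix_norm_le:
  fixes A :: "nat \<Rightarrow> nat \<Rightarrow> 'b ell2 \<Rightarrow>\<^sub>L 'b ell2"
  assumes "\<And>\<xi>. L2_set (\<lambda>i. norm (\<Sum>j<n. blinfun_apply (A i j) (\<xi> j))) {..<n} \<le>
      K * L2_set (\<lambda>j. norm (\<xi> j)) {..<n}" "0 \<le> K"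
  shows "matrix_norm n A \<le> K"
  unfolding matrix_norm_def
proof (rule cSUP_least)
  show "{\<xi> :: nat \<Rightarrow> 'b ell2. L2_set (\<lambda>j. norm (\<xi> j)) {..<n} \<le> 1} \<noteq> {}"
    by (auto simp: L2_set_def intro!: exI[of _ "\<lambda>_. 0"])
  fix \<xi> :: "nat \<Rightarrow> 'b ell2" assume "\<xi> \<in> {\<xi>. L2_set (\<lambda>j. norm (\<xi> j)) {..<n} \<le> 1}"
  then show "L2_set (\<lambda>i. norm (\<Sum>j<n. blinfun_apply (A i j) (\<xi> j))) {..<n} \<le> K"
    using assms(1)[of \<xi>] mult_left_mono[of "L2_set (\<lambda>j. norm (\<xi> j)) {..<n}" 1 K] assms(2) by simp
qed

lemma matrix_norm_conj:
  fixes A :: "nat \<Rightarrow> nat \<Rightarrow> 'b ell2 \<Rightarrow>\<^sub>L 'b ell2"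
    and S :: "'b ell2 \<Rightarrow>\<^sub>L 'c ell2" and T :: "'c ell2 \<Rightarrow>\<^sub>L 'b ell2"
  shows "matrix_norm n (\<lambda>i j. S o\<^sub>L A i j o\<^sub>L T) \<le> norm S * norm T * matrix_norm n A"
proof (rule matrix_norm_le)
  fix \<xi> :: "nat \<Rightarrow> 'c ell2"
  let ?\<eta> = "\<lambda>i. \<Sum>j<n. blinfun_apply (A i j) (blinfun_apply T (\<xi> j))"
  have "L2_set (\<lambda>i. norm (\<Sum>j<n. blinfun_apply (S o\<^sub>L A i j o\<^sub>L T) (\<xi> j))) {..<n} =
      L2_set (\<lambda>i. norm (blinfun_apply S (?\<eta> i))) {..<n}"
    by (simp add: blinfun.sum_right)
  also have "\<dots> \<le> L2_set (\<lambda>i. norm S * norm (?\<eta> i)) {..<n}"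
    by (rule L2_set_mono) (simp_all add: norm_blinfun)
  also have "\<dots> = norm S * L2_set (\<lambda>i. norm (?\<eta> i)) {..<n}" by (simp add: L2_set_right_distrib)
  also have "\<dots> \<le> norm S * (matrix_norm n A * L2_set (\<lambda>j. norm (blinfun_apply T (\<xi> j))) {..<n})"
    by (intro mult_left_mono matrix_norm_apply) simp
  also have "\<dots> \<le> norm S * (matrix_norm n A * L2_set (\<lambda>j. norm T * norm (\<xi> j)) {..<n})"
    by (intro mult_left_mono L2_set_mono norm_blinfun matrix_norm_nonneg) simp_all
  also have "\<dots> = norm S * norm T * matrix_norm n A * L2_set (\<lambda>j. norm (\<xi> j)) {..<n}"
    by (simp add: L2_set_right_distrib[symmetric] mult_ac)
  finally show "L2_set (\<lambda>i. norm (\<Sum>j<n. blinfun_apply (S o\<^sub>L A i j o\<^sub>L T) (\<xi> j))) {..<n} \<le>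
      norm S * norm T * matrix_norm n A * L2_set (\<lambda>j. norm (\<xi> j)) {..<n}" .
qed (simp add: matrix_norm_nonneg)

lemma matrix_norm_cong: "(\<And>i j. i < n \<Longrightarrow> j < n \<Longrightarrow> A i j = B i j) \<Longrightarrow> matrix_norm n A = matrix_norm n B"
  unfolding matrix_norm_def by (intro SUP_cong refl L2_set_cong arg_cong[of _ _ norm] sum.cong) auto

lemma matrix_norm_1: "matrix_norm 1 (\<lambda>i j. A) = norm A"
proof (rule antisym)
  show "matrix_norm 1 (\<lambda>i j. A) \<le> norm A"
    by (rule matrix_norm_le) (simp_all add: norm_blinfun L2_set_def)
  show "norm A \<le> matrix_norm 1 (\<lambda>i j. A)"
  proof (rule norm_blinfun_bound)
    show "norm (blinfun_apply A \<xi>) \<le> matrix_norm 1 (\<lambda>i j. A) * norm \<xi>" for \<xi>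
      using matrix_norm_apply[where n = 1 and A = "\<lambda>i j. A" and \<xi> = "\<lambda>_. \<xi>"] by (simp add: L2_set_def)
  qed (rule matrix_norm_nonneg)
qed

section \<open>The classification theorem\<close>

context subproduct_pair
begin

lemma algebra_iso_of_iso_pair:
  assumes "iso_pair X Y C D \<phi> \<psi>"
  shows "algebra_iso (tensor_algebra X) (tensor_algebra Y) \<phi>"
  unfolding algebra_iso_def
proof (intro conjI ballI allI)
  note i = iso_pairD[OF assms]
  show "bij_betw \<phi> (tensor_algebra X) (tensor_algebra Y)"
    by (rule bij_betw_byWitness[where f' = \<psi>])
      (auto simp: i(5,6) bounded_homD(1)[OF i(3)] bounded_homD(1)[OF i(4)])
qed (simp_all add: bounded_homD[OF iso_pairD(3)[OF assms]])

text \<open>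
  A surjective homomorphism is automatically unital, since the image of the unit acts as a unit.
\<close>

lemma iso_pair_of_algebra_iso:
  assumes iso: "algebra_iso (tensor_algebra X) (tensor_algebra Y) \<phi>"
    and C: "\<And>A. A \<in> tensor_algebra X \<Longrightarrow> norm (\<phi> A) \<le> C * norm A" "0 \<le> C"
    and D: "\<And>B. B \<in> tensor_algebra Y \<Longrightarrow> norm (inv_into (tensor_algebra X) \<phi> B) \<le> D * norm B" "0 \<le> D"
  shows "iso_pair X Y C D \<phi> (inv_into (tensor_algebra X) \<phi>)"
proof -
  let ?TX = "tensor_algebra X" and ?TY = "tensor_algebra Y"
  define \<psi> where "\<psi> = inv_into ?TX \<phi>"
  have bij: "bij_betw \<phi> ?TX ?TY" using iso by (simp add: algebra_iso_def)
  have \<phi>: "\<phi> A \<in> ?TY" if "A \<in> ?TX" for A using bij_betwE[OF bij] that by blast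
  have \<psi>: "\<psi> B \<in> ?TX" if "B \<in> ?TY" for B
    using bij_betwE[OF bij_betw_inv_into[OF bij]] that by (auto simp: \<psi>_def)
  have inv: "\<And>A. A \<in> ?TX \<Longrightarrow> \<psi> (\<phi> A) = A" "\<And>B. B \<in> ?TY \<Longrightarrow> \<phi> (\<psi> B) = B"
    using bij_betw_inv_into_left[OF bij] bij_betw_inv_into_right[OF bij] by (auto simp: \<psi>_def)
  have hom: "\<And>A B. A \<in> ?TX \<Longrightarrow> B \<in> ?TX \<Longrightarrow> \<phi> (A + B) = \<phi> A + \<phi> B"
      "\<And>A B. A \<in> ?TX \<Longrightarrow> B \<in> ?TX \<Longrightarrow> \<phi> (A o\<^sub>L B) = \<phi> A o\<^sub>L \<phi> B"
      "\<And>A c. A \<in> ?TX \<Longrightarrow> \<phi> (scaleC_op c o\<^sub>L A) = scaleC_op c o\<^sub>L \<phi> A"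
    using iso by (auto simp: algebra_iso_def)
  have "\<phi> (fock_proj X) o\<^sub>L \<phi> (\<psi> (fock_proj Y)) = \<phi> (\<psi> (fock_proj Y))"
    using X.tensor_algebra_proj(1)[OF \<psi>[OF Y.fock_proj_mem]]
    by (simp flip: hom(2)[OF X.fock_proj_mem \<psi>[OF Y.fock_proj_mem]])
  then have unit: "\<phi> (fock_proj X) = fock_proj Y"
    using Y.tensor_algebra_proj(2)[OF \<phi>[OF X.fock_proj_mem]] by (simp add: inv Y.fock_proj_mem)
  have unit': "\<psi> (fock_proj Y) = fock_proj X"
    using inv(1)[OF X.fock_proj_mem] unit by simp
  have h1: "bounded_hom X Y C \<phi>"
    unfolding bounded_hom_def using C(1) \<phi> hom unit by simp
  have h2: "bounded_hom Y X D \<psi>"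
    unfolding bounded_hom_def
  proof (intro conjI ballI allI)
    fix A B c assume A: "A \<in> ?TY"
    show "\<psi> A \<in> ?TX" by (rule \<psi>[OF A])
    show "norm (\<psi> A) \<le> D * norm A" unfolding \<psi>_def by (rule D(1)[OF A])
    show "\<psi> (scaleC_op c o\<^sub>L A) = scaleC_op c o\<^sub>L \<psi> A"
      using inv(1)[OF tensor_algebra_closure(4)[OF \<psi>[OF A], of c]] by (simp add: hom \<psi> A inv)
    assume B: "B \<in> ?TY"
    show "\<psi> (A + B) = \<psi> A + \<psi> B"
      using inv(1)[OF tensor_algebra_closure(5)[OF \<psi>[OF A] \<psi>[OF B]]] by (simp add: hom \<psi> A B inv)
    show "\<psi> (A o\<^sub>L B) = \<psi> A o\<^sub>L \<psi> B"
      using inv(1)[OF tensor_algebra_closure(7)[OF \<psi>[OF A] \<psi>[OF B]]] by (simp add: hom \<psi> A B inv)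
  qed (rule unit')
  show ?thesis using h1 h2 inv C(2) D(2) by (simp add: iso_pair_def \<psi>_def)
qed

lemma completely_isometric_imp_isometric:
  assumes "completely_isometrically_isomorphic (tensor_algebra X) (tensor_algebra Y)"
  shows "isometrically_isomorphic (tensor_algebra X) (tensor_algebra Y)"
proof -
  obtain \<phi> where \<phi>: "algebra_iso (tensor_algebra X) (tensor_algebra Y) \<phi>"
      "completely_isometric_on (tensor_algebra X) \<phi>"
    using assms by (auto simp: completely_isometrically_isomorphic_def)
  have "norm (\<phi> A) = norm A" if "A \<in> tensor_algebra X" for A
    using \<phi>(2)[unfolded completely_isometric_on_def, rule_format, of 1 "\<lambda>i j. A"] that
    by (simp only: matrix_norm_1)
  then show ?thesis using \<phi>(1) by (auto simp: isometrically_isomorphic_def isometric_on_def)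
qed

text \<open>
  With both bounds equal to \<open>1\<close> the leading-coefficient maps are isometries, hence unitary by
  polarization.
\<close>

lemma isometric_imp_isomorphic:
  assumes "isometrically_isomorphic (tensor_algebra X) (tensor_algebra Y)"
  shows "isomorphic_subproduct X Y"
proof -
  obtain \<phi> where \<phi>: "algebra_iso (tensor_algebra X) (tensor_algebra Y) \<phi>"
      "\<And>A. A \<in> tensor_algebra X \<Longrightarrow> norm (\<phi> A) = norm A"
    using assms by (auto simp: isometrically_isomorphic_def isometric_on_def)
  have bij: "bij_betw \<phi> (tensor_algebra X) (tensor_algebra Y)" using \<phi>(1) by (simp add: algebra_iso_def)
  have "norm (inv_into (tensor_algebra X) \<phi> B) \<le> 1 * norm B" if "B \<in> tensor_algebra Y" for B
    using \<phi>(2)[of "inv_into (tensor_algebra X) \<phi> B"] that bij_betw_inv_into_right[OF bij that]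
      bij_betwE[OF bij_betw_inv_into[OF bij]] by simp
  then have "iso_pair X Y 1 1 \<phi> (inv_into (tensor_algebra X) \<phi>)"
    using \<phi> by (intro iso_pair_of_algebra_iso) simp_all
  then obtain \<phi>' \<psi>' where iso: "iso_pair X Y 1 1 \<phi>' \<psi>'"
      "\<And>A. A \<in> tensor_algebra X \<Longrightarrow> ev 0 (\<phi>' A) = ev 0 A"
    by (rule vacuum_preserving) auto
  obtain V where V: "intertwining_maps X Y V" "\<And>n \<xi>. \<xi> \<in> X n \<Longrightarrow> norm (V n \<xi>) \<le> 1 * norm \<xi>"
    "\<And>n \<eta>. \<eta> \<in> Y n \<Longrightarrow> norm (inv_into (X n) (V n) \<eta>) \<le> 1 * norm \<eta>"
    by (rule intertwining_of_iso_pair[OF iso]) auto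
  have bijV: "bij_betw (V n) (X n) (Y n)" for n using V(1) by (simp add: intertwining_maps_def)
  have VY: "V n \<xi> \<in> Y n" if "\<xi> \<in> X n" for n \<xi> using bij_betwE[OF bijV] that by blast
  have norm_V: "norm (V n \<xi>) = norm \<xi>" if "\<xi> \<in> X n" for n \<xi>
    using V(2)[OF that] V(3)[OF VY[OF that]] bij_betw_inv_into_left[OF bijV that] by simp
  have add: "V n (\<xi> + \<eta>) = V n \<xi> + V n \<eta>" if "\<xi> \<in> X n" "\<eta> \<in> X n" for n \<xi> \<eta>
    using V(1) that by (simp add: intertwining_maps_def)
  have scale: "V n (scaleC c \<xi>) = scaleC c (V n \<xi>)" if "\<xi> \<in> X n" for n c \<xi>
    using V(1) that by (simp add: intertwining_maps_def)
  have inner: "V n \<xi> \<bullet> V n \<eta> = \<xi> \<bullet> \<eta>" if "\<xi> \<in> X n" "\<eta> \<in> X n" for n \<xi> \<eta>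
  proof -
    have "(norm (V n \<xi> + V n \<eta>))\<^sup>2 = (norm (\<xi> + \<eta>))\<^sup>2"
      using norm_V[of "\<xi> + \<eta>" n] that by (simp add: add X.fibre_closure)
    moreover have "(norm (V n \<xi>))\<^sup>2 = (norm \<xi>)\<^sup>2" "(norm (V n \<eta>))\<^sup>2 = (norm \<eta>)\<^sup>2"
      using norm_V that by auto
    ultimately show ?thesis
      by (simp add: power2_norm_eq_inner inner_add_left inner_add_right inner_commute)
  qed
  have "cinner (V n \<xi>) (V n \<eta>) = cinner \<xi> \<eta>" if "\<xi> \<in> X n" "\<eta> \<in> X n" for n \<xi> \<eta>
    unfolding cinner_eq_inner scale[OF that(1), symmetric]
    by (simp only: inner that X.fibre_closure(5)[OF that(1)])
  then show ?thesis using V(1) by (auto simp: isomorphic_subproduct_def)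
qed

lemma isomorphic_imp_completely_isometric:
  assumes "isomorphic_subproduct X Y"
  shows "completely_isometrically_isomorphic (tensor_algebra X) (tensor_algebra Y)"
proof -
  obtain V where V: "intertwining_maps X Y V"
      "\<And>n \<xi> \<eta>. \<xi> \<in> X n \<Longrightarrow> \<eta> \<in> X n \<Longrightarrow> cinner (V n \<xi>) (V n \<eta>) = cinner \<xi> \<eta>"
    using assms by (auto simp: isomorphic_subproduct_def)
  have bij: "bij_betw (V n) (X n) (Y n)" for n using V(1) by (simp add: intertwining_maps_def)
  have norm_V: "norm (V n \<xi>) = norm \<xi>" if "\<xi> \<in> X n" for n \<xi>
  proof -
    have "(norm (V n \<xi>))\<^sup>2 = (norm \<xi>)\<^sup>2"
      using V(2)[OF that that] by (simp only: cinner_same of_real_eq_iff)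
    then show ?thesis by (simp add: power2_eq_iff_nonneg)
  qed
  have n1: "norm (V n \<xi>) \<le> 1 * norm \<xi>" if "\<xi> \<in> X n" for n \<xi> using norm_V[OF that] by simp
  have n2: "norm (inv_into (X n) (V n) \<eta>) \<le> 1 * norm \<eta>" if "\<eta> \<in> Y n" for n \<eta>
    using norm_V[of "inv_into (X n) (V n) \<eta>" n] bij_betw_inv_into_right[OF bij that]
      bij_betwE[OF bij_betw_inv_into[OF bij]] that by simp
  obtain S T where S: "norm S \<le> 1" and T: "norm T \<le> 1"
    and iso: "iso_pair X Y (1 * 1) (1 * 1) (\<lambda>A. S o\<^sub>L A o\<^sub>L T) (\<lambda>B. T o\<^sub>L B o\<^sub>L S)"
    by (rule conj_iso_pair[OF subproduct_pair_axioms V(1) n1 _ n2]) auto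
  let ?\<phi> = "\<lambda>A. S o\<^sub>L A o\<^sub>L T"
  have ST: "norm S * norm T \<le> 1" "norm T * norm S \<le> 1"
    using S T by (simp_all add: mult_le_one)
  have "matrix_norm n (\<lambda>i j. ?\<phi> (A i j)) = matrix_norm n A"
    if A: "\<And>i j. i < n \<Longrightarrow> j < n \<Longrightarrow> A i j \<in> tensor_algebra X" for n A
  proof (rule antisym)
    have "matrix_norm n (\<lambda>i j. ?\<phi> (A i j)) \<le> norm S * norm T * matrix_norm n A"
      by (rule matrix_norm_conj)
    then show "matrix_norm n (\<lambda>i j. ?\<phi> (A i j)) \<le> matrix_norm n A"
      using mult_right_mono[OF ST(1) matrix_norm_nonneg[of n A]] by simp
    have "matrix_norm n A = matrix_norm n (\<lambda>i j. T o\<^sub>L ?\<phi> (A i j) o\<^sub>L S)"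
      using iso_pairD(5)[OF iso A] by (intro matrix_norm_cong) simp
    also have "\<dots> \<le> norm T * norm S * matrix_norm n (\<lambda>i j. ?\<phi> (A i j))"
      by (rule matrix_norm_conj)
    finally show "matrix_norm n A \<le> matrix_norm n (\<lambda>i j. ?\<phi> (A i j))"
      using mult_right_mono[OF ST(2) matrix_norm_nonneg[of n "\<lambda>i j. ?\<phi> (A i j)"]] by simp
  qed
  then show ?thesis
    using algebra_iso_of_iso_pair[OF iso]
    unfolding completely_isometrically_isomorphic_def completely_isometric_on_def by blast
qed

text \<open>
  The \<open>1 \<times> 1\<close> matrices show that the isomorphism is bounded, and the bounded inverse theorem applies
  to the closed subspaces formed by the two tensor algebras.
\<close>

lemma completely_bounded_imp_topological:
  assumes "completely_boundedly_isomorphic (tensor_algebra X) (tensor_algebra Y)"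
  shows "topologically_isomorphic (tensor_algebra X) (tensor_algebra Y)"
proof -
  obtain \<phi> C where \<phi>: "algebra_iso (tensor_algebra X) (tensor_algebra Y) \<phi>"
      "\<And>n A. (\<forall>i<n. \<forall>j<n. A i j \<in> tensor_algebra X) \<Longrightarrow>
        matrix_norm n (\<lambda>i j. \<phi> (A i j)) \<le> C * matrix_norm n A"
    using assms unfolding completely_boundedly_isomorphic_def completely_bounded_on_def by metis
  have bound: "norm (\<phi> A) \<le> C * norm A" if "A \<in> tensor_algebra X" for A
    using \<phi>(2)[of 1 "\<lambda>i j. A"] that by (simp only: matrix_norm_1) simp
  have real: "scaleC_op (of_real r) o\<^sub>L A = r *\<^sub>R A" for r and A :: "'x ell2 \<Rightarrow>\<^sub>L 'x ell2"
    by (rule blinfun_eqI) (simp add: scaleR_blinfun.rep_eq)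
  have sub: "subspace (tensor_algebra Z)" for Z :: "'z fibres"
  proof (rule subspaceI)
    show "0 \<in> tensor_algebra Z"
      using tensor_algebra_closure(6)[OF tensor_algebra_closure(2) tensor_algebra_closure(2), of Z] by simp
    show "r *\<^sub>R A \<in> tensor_algebra Z" if "A \<in> tensor_algebra Z" for r A
      using tensor_algebra_closure(4)[OF that, of "of_real r"] by (simp add: real)
  qed (rule tensor_algebra_closure(5))
  obtain D where "\<And>B. B \<in> tensor_algebra Y \<Longrightarrow> norm (inv_into (tensor_algebra X) \<phi> B) \<le> D * norm B"
  proof (rule bounded_inverse[OF sub tensor_algebra_closure(1) sub tensor_algebra_closure(1), of X \<phi> C Y])
    show "\<phi> (r *\<^sub>R A) = r *\<^sub>R \<phi> A" if "A \<in> tensor_algebra X" for r A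
      using \<phi>(1) that unfolding algebra_iso_def by (metis real)
  qed (use \<phi>(1) bound in \<open>auto simp: algebra_iso_def\<close>)
  then show ?thesis
    using \<phi>(1) bound unfolding topologically_isomorphic_def bounded_on_def by blast
qed

lemma le_abs_mult_norm: "x \<le> K * norm A \<Longrightarrow> x \<le> \<bar>K\<bar> * norm A"
  by (meson abs_ge_self mult_right_mono norm_ge_zero order_trans)

lemma topological_imp_similar:
  assumes "topologically_isomorphic (tensor_algebra X) (tensor_algebra Y)"
  shows "similar_subproduct X Y"
proof -
  obtain \<phi> C D where \<phi>: "algebra_iso (tensor_algebra X) (tensor_algebra Y) \<phi>"
      "\<And>A. A \<in> tensor_algebra X \<Longrightarrow> norm (\<phi> A) \<le> C * norm A"
      "\<And>B. B \<in> tensor_algebra Y \<Longrightarrow> norm (inv_into (tensor_algebra X) \<phi> B) \<le> D * norm B"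
    using assms unfolding topologically_isomorphic_def bounded_on_def by metis
  have "iso_pair X Y \<bar>C\<bar> \<bar>D\<bar> \<phi> (inv_into (tensor_algebra X) \<phi>)"
    by (rule iso_pair_of_algebra_iso[OF \<phi>(1)]) (auto intro: le_abs_mult_norm \<phi>(2,3))
  then obtain C' D' \<phi>' \<psi>' where iso: "iso_pair X Y C' D' \<phi>' \<psi>'"
      "\<And>A. A \<in> tensor_algebra X \<Longrightarrow> ev 0 (\<phi>' A) = ev 0 A"
    by (rule vacuum_preserving) auto
  obtain V where "intertwining_maps X Y V" "\<And>n \<xi>. \<xi> \<in> X n \<Longrightarrow> norm (V n \<xi>) \<le> C' * norm \<xi>"
      "\<And>n \<eta>. \<eta> \<in> Y n \<Longrightarrow> norm (inv_into (X n) (V n) \<eta>) \<le> D' * norm \<eta>"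
    using intertwining_of_iso_pair[OF iso] by metis
  then show ?thesis unfolding similar_subproduct_def by blast
qed

lemma similar_imp_completely_bounded:
  assumes "similar_subproduct X Y"
  shows "completely_boundedly_isomorphic (tensor_algebra X) (tensor_algebra Y)"
proof -
  obtain V C D where V: "intertwining_maps X Y V"
      "\<And>n \<xi>. \<xi> \<in> X n \<Longrightarrow> norm (V n \<xi>) \<le> C * norm \<xi>"
      "\<And>n \<eta>. \<eta> \<in> Y n \<Longrightarrow> norm (inv_into (X n) (V n) \<eta>) \<le> D * norm \<eta>"
    using assms unfolding similar_subproduct_def by metis
  obtain S T where iso: "iso_pair X Y (\<bar>C\<bar> * \<bar>D\<bar>) (\<bar>C\<bar> * \<bar>D\<bar>) (\<lambda>A. S o\<^sub>L A o\<^sub>L T) (\<lambda>B. T o\<^sub>L B o\<^sub>L S)"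
    by (rule conj_iso_pair[OF subproduct_pair_axioms V(1) le_abs_mult_norm[OF V(2)] _ le_abs_mult_norm[OF V(3)]]) auto
  have "completely_bounded_on (tensor_algebra X) (\<lambda>A. S o\<^sub>L A o\<^sub>L T)"
    unfolding completely_bounded_on_def using matrix_norm_conj by blast
  then show ?thesis
    using algebra_iso_of_iso_pair[OF iso] unfolding completely_boundedly_isomorphic_def by blast
qed

end

theorem theorem3p4:
  fixes I :: "'a::finite free_algebra set" and J :: "'b::finite free_algebra set"
    and X :: "'a fibres" and Y :: "'b fibres"
  assumes "homogeneous_ideal I" and "homogeneous_ideal J"
    and "X = subproduct_system I" and "Y = subproduct_system J"
  shows
    "((completely_isometrically_isomorphic (tensor_algebra X) (tensor_algebra Y) \<longleftrightarrow>
         isometrically_isomorphic (tensor_algebra X) (tensor_algebra Y)) \<and>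
      (isometrically_isomorphic (tensor_algebra X) (tensor_algebra Y) \<longleftrightarrow>
         isomorphic_subproduct X Y)) \<and>
     ((completely_boundedly_isomorphic (tensor_algebra X) (tensor_algebra Y) \<longleftrightarrow>
         topologically_isomorphic (tensor_algebra X) (tensor_algebra Y)) \<and>
      (topologically_isomorphic (tensor_algebra X) (tensor_algebra Y) \<longleftrightarrow>
         similar_subproduct X Y))"
proof -
  interpret subproduct_pair X Y
    unfolding assms(3,4) subproduct_pair_def
    by (intro conjI subproduct_of_ideal assms(1,2))
  show ?thesis
    using completely_isometric_imp_isometric isometric_imp_isomorphic
      isomorphic_imp_completely_isometric completely_bounded_imp_topological
      topological_imp_similar similar_imp_completely_bounded
    by blast
qed

end
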